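(* Let $p\colon(0,\infty)\to\mathbb{R}$ be any pressure law with $p>0$ and $p'>0$. Let $\rho_\pm>0$ and $v_\pm=(v_{\pm1},v_{\pm2})\in\mathbb{R}^2$ be constants with $\rho_+=\rho_->0$, $v_{+2}=v_{-2}$ and $v_{+1}\ne v_{-1}$. Let $(\rho,v_1,v_2)\in L^\infty(\mathbb{R}^2\times[0,\infty))$ be an admissible weak solution of the two-dimensional isentropic compressible Euler system with pressure law $p$ and initial data $$(\rho^0(x),v^0(x))=\begin{cases}(\rho_-,v_-)& \text{if } x_2<0,\\ (\rho_+,v_+)&\text{if } x_2>0.\end{cases}$$ Assume that $\inf\rho>0$ (essential infimum) and that, as far as the space variables are concerned, $(\rho,v_1,v_2)$ depends only on $x_2$ (i.e. $\rho,v_1,v_2$ are functions of $(x_2,t)$ only). Then $(\rho,v_1,v_2)$ is the classical self-similar solution consisting of a single contact discontinuity, i.e. for almost every $(x,t)$, $$\rho(x,t)=\rho_+=\rho_-,\qquad v_2(x,t)=v_{+2}=v_{-2},\qquad v_1(x,t)=\begin{cases}v_{-1}&\text{if }x_2<v_{+2}\,t,\\ v_{+1}&\text{if }x_2>v_{+2}\,t.\end{cases}$$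
   Context: Space variable $x=(x_1,x_2)\in\mathbb{R}^2$, time $t\ge 0$. The isentropic compressible Euler system with pressure law $p$ for the density $\rho=\rho(x,t)>0$ and velocity $v=v(x,t)=(v_1,v_2)\in\mathbb{R}^2$ is $$\partial_t\rho+\mathrm{div}_x(\rho v)=0,\qquad \partial_t(\rho v)+\mathrm{div}_x(\rho v\otimes v)+\nabla_x[p(\rho)]=0,\qquad \rho(\cdot,0)=\rho^0,\quad v(\cdot,0)=v^0 .$$ The internal energy density $\epsilon\colon(0,\infty)\to\mathbb{R}$ is related to $p$ by $p(\rho)=\rho^2\epsilon'(\rho)$ (so it is determined up to an additive constant). A bounded admissible weak solution is a pair $(\rho,v)\in L^\infty(\mathbb{R}^2\times(0,\infty))$ satisfying the system in the sense of distributions, with the initial data included, i.e. for all test functions $\psi\in C_c^\infty(\mathbb{R}^2\times[0,\infty))$ and $\phi\in C_c^\infty(\mathbb{R}^2\times[0,\infty);\mathbb{R}^2)$, $$\int_0^\infty\!\!\int_{\mathbb{R}^2}[\rho\,\partial_t\psi+\rho v\cdot\nabla_x\psi]\,dx\,dt+\int_{\mathbb{R}^2}\rho^0\psi(x,0)\,dx=0,$$ $$\int_0^\infty\!\!\int_{\mathbb{R}^2}[\rho v\cdot\partial_t\phi+\rho v\otimes v:\nabla_x\phi+p(\rho)\,\mathrm{div}_x\phi]\,dx\,dt+\int_{\mathbb{R}^2}\rho^0v^0\cdot\phi(x,0)\,dx=0,$$ and in addition the entropy inequality: for every nonnegative $\varphi\in C_c^\infty(\mathbb{R}^2\times[0,\infty))$,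 $$\int_0^\infty\!\!\int_{\mathbb{R}^2}\Big[\Big(\rho\epsilon(\rho)+\rho\tfrac{|v|^2}{2}\Big)\partial_t\varphi+\Big(\rho\epsilon(\rho)+\rho\tfrac{|v|^2}{2}+p(\rho)\Big)v\cdot\nabla_x\varphi\Big]dx\,dt+\int_{\mathbb{R}^2}\Big(\rho^0\epsilon(\rho^0)+\rho^0\tfrac{|v^0|^2}{2}\Big)\varphi(x,0)\,dx\ge 0 .$$ *)

theory Defs
  imports "HOL-Analysis.Analysis" "HOL-Probability.Essential_Supremum"
begin

type_synonym spacetime = "(real^2) \<times> real"

definition spacetime_region :: "spacetime set" where
  "spacetime_region = UNIV \<times> {0..}"

abbreviation spacetime_measure :: "spacetime measure" where
  "spacetime_measure \<equiv> lebesgue_on spacetime_region"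

definition essentially_bounded ::
    "'a measure \<Rightarrow> ('a \<Rightarrow> 'b::{real_normed_vector,second_countable_topology}) \<Rightarrow> bool" where
  "essentially_bounded M f \<longleftrightarrow>
     f \<in> borel_measurable M \<and> (\<exists>C. AE z in M. norm (f z) \<le> C)"

definition essential_infimum :: "'a measure \<Rightarrow> ('a \<Rightarrow> real) \<Rightarrow> ereal" where
  "essential_infimum M f = - esssup M (\<lambda>z. - ereal (f z))"

fun times_differentiable ::
    "nat \<Rightarrow> ('a::euclidean_space \<Rightarrow> 'b::real_normed_vector) \<Rightarrow> bool" where
  "times_differentiable 0 f \<longleftrightarrow> continuous_on UNIV f"
| "times_differentiable (Suc k) f \<longleftrightarrow>
     (\<forall>z. f differentiable (at z)) \<and>
     (\<forall>b\<in>Basis. times_differentiable k (\<lambda>z. frechet_derivative f (at z) b))"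

text \<open>Test functions on \<open>\<real>\<^sup>2 \<times> [0,\<infinity>)\<close> are represented by smooth, compactly supported
  functions on the whole of \<open>\<real>\<^sup>2 \<times> \<real>\<close>, of which only the restriction to \<open>t \<ge> 0\<close> is ever used.
  In particular they need not vanish at \<open>t = 0\<close>.\<close>

definition test_function :: "(spacetime \<Rightarrow> 'b::real_normed_vector) \<Rightarrow> bool" where
  "test_function f \<longleftrightarrow>
     (\<forall>k. times_differentiable k f) \<and> compact (closure {z. f z \<noteq> 0})"

definition dt :: "(spacetime \<Rightarrow> 'b::real_normed_vector) \<Rightarrow> spacetime \<Rightarrow> 'b" where
  "dt f z = frechet_derivative f (at z) (0, 1)"

definition dx :: "2 \<Rightarrow> (spacetime \<Rightarrow> 'b::real_normed_vector) \<Rightarrow> spacetime \<Rightarrow> 'b" where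
  "dx j f z = frechet_derivative f (at z) (axis j 1, 0)"

definition grad_x :: "(spacetime \<Rightarrow> real) \<Rightarrow> spacetime \<Rightarrow> real^2" where
  "grad_x \<psi> z = (\<chi> j. dx j \<psi> z)"

definition div_x :: "(spacetime \<Rightarrow> real^2) \<Rightarrow> spacetime \<Rightarrow> real" where
  "div_x \<phi> z = (\<Sum>j\<in>UNIV. dx j \<phi> z $ j)"

definition pressure_law :: "(real \<Rightarrow> real) \<Rightarrow> bool" where
  "pressure_law p \<longleftrightarrow>
     (\<forall>r>0. p r > 0 \<and> p differentiable (at r) \<and> deriv p r > 0)"

definition internal_energy :: "(real \<Rightarrow> real) \<Rightarrow> (real \<Rightarrow> real) \<Rightarrow> bool" where
  "internal_energy p \<epsilon> \<longleftrightarrow>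
     (\<forall>r>0. \<epsilon> differentiable (at r) \<and> p r = r\<^sup>2 * deriv \<epsilon> r)"

definition weak_continuity_equation ::
    "(real^2 \<Rightarrow> real) \<Rightarrow> (spacetime \<Rightarrow> real) \<Rightarrow> (spacetime \<Rightarrow> real^2) \<Rightarrow> bool" where
  "weak_continuity_equation \<rho>0 \<rho> v \<longleftrightarrow>
     (\<forall>\<psi> :: spacetime \<Rightarrow> real. test_function \<psi> \<longrightarrow>
        (LINT z|spacetime_measure. \<rho> z * dt \<psi> z + (\<rho> z *\<^sub>R v z) \<bullet> grad_x \<psi> z)
        + (LINT x|lebesgue. \<rho>0 x * \<psi> (x, 0)) = 0)"

definition weak_momentum_equation ::
    "(real \<Rightarrow> real) \<Rightarrow> (real^2 \<Rightarrow> real) \<Rightarrow> (real^2 \<Rightarrow> real^2) \<Rightarrow>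
     (spacetime \<Rightarrow> real) \<Rightarrow> (spacetime \<Rightarrow> real^2) \<Rightarrow> bool" where
  "weak_momentum_equation p \<rho>0 v0 \<rho> v \<longleftrightarrow>
     (\<forall>\<phi> :: spacetime \<Rightarrow> real^2. test_function \<phi> \<longrightarrow>
        (LINT z|spacetime_measure.
            (\<rho> z *\<^sub>R v z) \<bullet> dt \<phi> z
          + (\<Sum>i\<in>UNIV. \<Sum>j\<in>UNIV. \<rho> z * v z $ i * v z $ j * dx j \<phi> z $ i)
          + p (\<rho> z) * div_x \<phi> z)
        + (LINT x|lebesgue. (\<rho>0 x *\<^sub>R v0 x) \<bullet> \<phi> (x, 0)) = 0)"

definition energy_density :: "(real \<Rightarrow> real) \<Rightarrow> real \<Rightarrow> real^2 \<Rightarrow> real" where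
  "energy_density \<epsilon> r w = r * \<epsilon> r + r * ((norm w)\<^sup>2 / 2)"

definition entropy_inequality ::
    "(real \<Rightarrow> real) \<Rightarrow> (real \<Rightarrow> real) \<Rightarrow> (real^2 \<Rightarrow> real) \<Rightarrow> (real^2 \<Rightarrow> real^2) \<Rightarrow>
     (spacetime \<Rightarrow> real) \<Rightarrow> (spacetime \<Rightarrow> real^2) \<Rightarrow> bool" where
  "entropy_inequality p \<epsilon> \<rho>0 v0 \<rho> v \<longleftrightarrow>
     (\<forall>\<phi> :: spacetime \<Rightarrow> real. test_function \<phi> \<longrightarrow> (\<forall>z\<in>spacetime_region. 0 \<le> \<phi> z) \<longrightarrow>
        (LINT z|spacetime_measure.
            energy_density \<epsilon> (\<rho> z) (v z) * dt \<phi> z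
          + ((energy_density \<epsilon> (\<rho> z) (v z) + p (\<rho> z)) *\<^sub>R v z) \<bullet> grad_x \<phi> z)
        + (LINT x|lebesgue. energy_density \<epsilon> (\<rho>0 x) (v0 x) * \<phi> (x, 0)) \<ge> 0)"

definition bounded_admissible_weak_solution ::
    "(real \<Rightarrow> real) \<Rightarrow> (real \<Rightarrow> real) \<Rightarrow> (real^2 \<Rightarrow> real) \<Rightarrow> (real^2 \<Rightarrow> real^2) \<Rightarrow>
     (spacetime \<Rightarrow> real) \<Rightarrow> (spacetime \<Rightarrow> real^2) \<Rightarrow> bool" where
  "bounded_admissible_weak_solution p \<epsilon> \<rho>0 v0 \<rho> v \<longleftrightarrow>
     essentially_bounded spacetime_measure \<rho> \<and>
     essentially_bounded spacetime_measure v \<and>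
     (AE z in spacetime_measure. \<rho> z > 0) \<and>
     weak_continuity_equation \<rho>0 \<rho> v \<and>
     weak_momentum_equation p \<rho>0 v0 \<rho> v \<and>
     entropy_inequality p \<epsilon> \<rho>0 v0 \<rho> v"

text \<open>The value on the null set \<open>x\<^sub>2 = 0\<close> is immaterial.\<close>

definition riemann_data :: "'b \<Rightarrow> 'b \<Rightarrow> real^2 \<Rightarrow> 'b" where
  "riemann_data l r x = (if x $ 2 < 0 then l else r)"

text \<open>Being an \<open>L\<^sup>\<infinity>\<close> function, \<open>f\<close> depends only on \<open>(x\<^sub>2, t)\<close> if some representative does.\<close>

definition depends_only_on_x2 :: "(spacetime \<Rightarrow> 'b) \<Rightarrow> bool" where
  "depends_only_on_x2 f \<longleftrightarrow>
     (\<exists>g :: real \<Rightarrow> real \<Rightarrow> 'b. AE (x, t) in spacetime_measure. f (x, t) = g (x $ 2) t)"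

end

theory Submission
  imports Defs "HOL-Probability.Distributions" "HOL-Computational_Algebra.Polynomial"
begin

text \<open>Since the solution depends on \<open>(x\<^sub>2, t)\<close> only, it solves a system in one space dimension, written here
  in the coordinate \<open>y = x\<^sub>2 - c t\<close> moving with the discontinuity and extended to \<open>t < 0\<close> by the stationary
  contact discontinuity. Let \<open>r\<close> be the density, \<open>u = v\<^sub>2 - c\<close>, \<open>w = v\<^sub>1\<close>, and let \<open>a\<close>, \<open>b\<close> be the initial
  values of \<open>w\<close>. The space-time fields \<open>(r, r u)\<close>, \<open>(r (w - a), r (w - a) u)\<close> and \<open>(r (w - b), r (w - b) u)\<close> are
  divergence free and parallel, so the Lipschitz potentials \<open>D1\<close>, \<open>D2\<close> of the last two are transported by \<open>u\<close>, and so is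
  their product, which vanishes for \<open>t < 0\<close>. An estimate on backward cones gives \<open>D1 D2 = 0\<close>, and
  differentiating this identity shows \<open>w \<in> {a, b}\<close> almost everywhere: no renormalisation theory is needed.
  Hence the term \<open>r (w - a) (w - b) / 2\<close> drops out of the relative energy, the entropy inequality reduces to
  the one-dimensional one relative to the constant state \<open>(\<rho>, 0)\<close>, and the same cone estimate yields
  \<open>r = \<rho>\<close> and \<open>u = 0\<close>. Finally \<open>w\<close> is transported with velocity zero and keeps its initial values.\<close>

section \<open>Smooth compactly supported functions\<close>

text \<open>The velocity \<open>u\<close> is merely bounded, so no chain rule is available for
  \<open>w\<close> itself. Nor can the relative energy be closed at once: the reference value of
  \<open>w\<close> jumps, and the squared distance to a jumping reference is not an affine
  combination of conserved densities. The product \<open>r (w - a) (w - b)\<close> is one, up to the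
  energy, and it vanishes on both sides of the jump; its price is a negative sign for
  \<open>w\<close> between \<open>a\<close> and \<open>b\<close>. This is why \<open>w\<close> has
  to be confined to two values before any energy argument. Potentials gain one derivative: being
  Lipschitz, they may be multiplied and used as factors of test functions. For \<open>t < 0\<close>,
  \<open>D1\<close> vanishes on one side of the jump and \<open>D2\<close> on the other, while
  \<open>D1 - D2\<close> is a multiple of the potential \<open>Y\<close> of \<open>(r, r u)\<close>,
  whose slope in \<open>y\<close> is at least \<open>r0\<close>; hence they vanish together only on
  a null set. Every weak law is recast as a pointwise statement on mollified fields. The extension
  to \<open>t < 0\<close> absorbs the initial integral into that statement, so that no trace at
  \<open>t = 0\<close> occurs.\<close>

lemma times_differentiable_Suc_imp:
  "times_differentiable (Suc k) f \<Longrightarrow> times_differentiable k f"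
proof (induction k arbitrary: f)
  case 0
  then show ?case
    by (auto intro!: continuous_at_imp_continuous_on differentiable_imp_continuous_within)
next
  case (Suc k)
  then show ?case by simp
qed

lemma times_differentiable_const: "times_differentiable k (\<lambda>z. c)"
  by (induction k arbitrary: c) simp_all

lemma times_differentiable_add:
  assumes "times_differentiable k f" "times_differentiable k g"
  shows "times_differentiable k (\<lambda>z. f z + g z)"
  using assms
proof (induction k arbitrary: f g)
  case 0
  then show ?case by (auto intro: continuous_intros)
next
  case (Suc k)
  have "frechet_derivative (\<lambda>z. f z + g z) (at z)
      = (\<lambda>b. frechet_derivative f (at z) b + frechet_derivative g (at z) b)" for z
    using Suc.prems
    by (intro frechet_derivative_at[symmetric] has_derivative_add)
      (auto simp flip: frechet_derivative_works)
  with Suc show ?case by (auto intro: differentiable_add)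
qed

lemma times_differentiable_scaleR:
  assumes "times_differentiable k f" "times_differentiable k g"
  shows "times_differentiable k (\<lambda>z. f z *\<^sub>R g z)"
  using assms
proof (induction k arbitrary: f g)
  case 0
  then show ?case by (auto intro: continuous_intros)
next
  case (Suc k)
  have eq: "((\<lambda>z. f z *\<^sub>R g z) has_derivative
      (\<lambda>b. f z *\<^sub>R frechet_derivative g (at z) b + frechet_derivative f (at z) b *\<^sub>R g z)) (at z)" for z
    using Suc.prems by (intro has_derivative_scaleR) (auto simp flip: frechet_derivative_works)
  have "times_differentiable k f" "times_differentiable k g"
    using Suc.prems times_differentiable_Suc_imp by blast+
  then have "times_differentiable k (\<lambda>z. f z *\<^sub>R frechet_derivative g (at z) b
      + frechet_derivative f (at z) b *\<^sub>R g z)" if "b \<in> Basis" for b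
    using Suc that by (intro times_differentiable_add Suc.IH) auto
  moreover have "frechet_derivative (\<lambda>z. f z *\<^sub>R g z) (at z)
      = (\<lambda>b. f z *\<^sub>R frechet_derivative g (at z) b + frechet_derivative f (at z) b *\<^sub>R g z)" for z
    using frechet_derivative_at[OF eq] by simp
  ultimately show ?case
    using eq by (auto simp: differentiable_def)
qed

text \<open>Smoothness is witnessed by a class of functions closed under differentiation, so that a
  single family serves all orders and no iterated derivative has to be named.\<close>

definition smooth_real :: "(real \<Rightarrow> real) \<Rightarrow> bool" where
  "smooth_real f \<longleftrightarrow> (\<exists>S. f \<in> S \<and> (\<forall>g\<in>S. \<exists>g'\<in>S. \<forall>x. (g has_real_derivative g' x) (at x)))"

lemma times_differentiable_smooth_affine:
  assumes "smooth_real f" "bounded_linear L"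
  shows "times_differentiable k (\<lambda>z. f (c + L z))"
proof -
  interpret L: bounded_linear L by fact
  obtain S where fS: "f \<in> S"
    and S: "\<And>g. g \<in> S \<Longrightarrow> \<exists>g'\<in>S. \<forall>x. (g has_real_derivative g' x) (at x)"
    using assms(1) by (auto simp: smooth_real_def)
  \<comment> \<open>The claim is proved for all of \<open>S\<close> at once, since differentiating
    \<open>f\<close> leads to another member.\<close>
  have "times_differentiable k (\<lambda>z. g (c + L z))" if "g \<in> S" for g
    using that
  proof (induction k arbitrary: g)
    case 0
    then obtain g' where "\<And>x. (g has_real_derivative g' x) (at x)" using S by blast
    then have "continuous_on UNIV g" by (auto intro: DERIV_continuous_on)
    then have "continuous_on UNIV (g \<circ> (\<lambda>z. c + L z))"
      by (intro continuous_on_compose L.continuous_on continuous_intros)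
        (auto intro: continuous_on_subset)
    then show ?case by (simp add: o_def)
  next
    case (Suc k)
    obtain g' where g': "g' \<in> S" "\<And>x. (g has_real_derivative g' x) (at x)" using S Suc by blast
    have d: "((\<lambda>z. g (c + L z)) has_derivative (\<lambda>b. L b *\<^sub>R g' (c + L z))) (at z)" for z
    proof -
      have "((\<lambda>z. c + L z) has_derivative L) (at z)"
        by (auto intro!: derivative_eq_intros L.has_derivative)
      from has_derivative_compose[OF this g'(2)[unfolded has_field_derivative_def]]
      show ?thesis by (simp add: mult.commute)
    qed
    have "times_differentiable k (\<lambda>z. L b *\<^sub>R g' (c + L z))" for b
      by (intro times_differentiable_scaleR times_differentiable_const Suc.IH g')
    moreover have "frechet_derivative (\<lambda>z. g (c + L z)) (at z) = (\<lambda>b. L b *\<^sub>R g' (c + L z))" for z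
      using frechet_derivative_at[OF d] by simp
    ultimately show ?case using d by (auto simp: differentiable_def)
  qed
  with fS show ?thesis by blast
qed

section \<open>Smooth cutoffs from exp(-1/x)\<close>

definition flat :: "real poly \<Rightarrow> real \<Rightarrow> real" where
  "flat q x = (if x > 0 then poly q (inverse x) * exp (- inverse x) else 0)"

lemma poly_times_exp_minus_tendsto_0:
  "((\<lambda>s. poly q s * exp (- s)) \<longlongrightarrow> (0::real)) at_top"
proof -
  have "((\<lambda>s::real. \<Sum>i\<le>degree q. coeff q i * (s ^ i / exp s)) \<longlongrightarrow> (\<Sum>i\<le>degree q. coeff q i * 0)) at_top"
    by (intro tendsto_intros tendsto_power_div_exp_0)
  moreover have "(\<Sum>i\<le>degree q. coeff q i * (s ^ i / exp s)) = poly q s * exp (- s)" for s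
    by (simp add: poly_altdef exp_minus sum_distrib_right divide_inverse mult.assoc)
  ultimately show ?thesis by simp
qed

text \<open>In \<open>s = 1/x\<close> the derivative is \<open>- s^2\<close> times
  \<open>d/ds\<close>, which maps \<open>q(s) exp(-s)\<close> to
  \<open>s^2 (q - q') exp(-s)\<close>; the coefficient list \<open>[:0, 0, 1:]\<close> is
  \<open>s^2\<close>. The family is therefore closed under differentiation, and
  \<open>flat 1\<close> is the classical function that is flat at 0.\<close>

lemma flat_has_derivative:
  "(flat q has_real_derivative flat ([:0, 0, 1:] * (q - pderiv q)) x) (at x)"
proof -
  consider "x > 0" | "x < 0" | "x = 0" by linarith
  then show ?thesis
  proof cases
    case 1
    have "((\<lambda>x. poly q (inverse x) * exp (- inverse x)) has_real_derivative
        poly ([:0, 0, 1:] * (q - pderiv q)) (inverse x) * exp (- inverse x)) (at x)"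
      using 1 by (auto intro!: derivative_eq_intros simp: algebra_simps power2_eq_square)
    then have "(flat q has_real_derivative
        poly ([:0, 0, 1:] * (q - pderiv q)) (inverse x) * exp (- inverse x)) (at x)"
    proof (rule has_field_derivative_transform_within_open[where S = "{0<..}"])
    qed (use 1 in \<open>auto simp: flat_def\<close>)
    with 1 show ?thesis by (simp add: flat_def[of _ x])
  next
    case 2
    have "((\<lambda>x. 0) has_real_derivative 0) (at x)" by simp
    then have "(flat q has_real_derivative 0) (at x)"
    proof (rule has_field_derivative_transform_within_open[where S = "{..<0}"])
    qed (use 2 in \<open>auto simp: flat_def\<close>)
    with 2 show ?thesis by (simp add: flat_def[of _ x])
  next
    case 3
    have r: "((\<lambda>h. flat q h / h) \<longlongrightarrow> 0) (at_right 0)"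
    proof (rule Lim_transform_eventually)
      \<comment> \<open>Division by \<open>h\<close> is a further factor \<open>s = 1/h\<close>,
        that is \<open>pCons 0 q\<close>, which the exponential still beats.\<close>
      show "((\<lambda>h. poly (pCons 0 q) (inverse h) * exp (- inverse h)) \<longlongrightarrow> (0::real)) (at_right 0)"
        by (rule filterlim_compose[OF poly_times_exp_minus_tendsto_0 filterlim_inverse_at_top_right])
      show "\<forall>\<^sub>F h in at_right 0. poly (pCons 0 q) (inverse h) * exp (- inverse h) = flat q h / h"
        by (rule eventually_at_rightI[of 0 1]) (auto simp: flat_def field_simps)
    qed
    have l: "((\<lambda>h. flat q h / h) \<longlongrightarrow> 0) (at_left 0)"
      by (rule Lim_transform_eventually[OF tendsto_const], rule eventually_at_leftI[of "-1"])
        (auto simp: flat_def)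
    have "((\<lambda>h. flat q h / h) \<longlongrightarrow> 0) (at 0)"
      using l r by (simp add: filterlim_split_at)
    then show ?thesis using 3 by (simp add: DERIV_def flat_def[of _ 0])
  qed
qed

lemma smooth_real_flat: "smooth_real (flat q)"
  unfolding smooth_real_def by (rule exI[of _ "range flat"]) (use flat_has_derivative in blast)

lemma flat_1_pos: "x > 0 \<Longrightarrow> flat 1 x > 0" and flat_nonpos: "x \<le> 0 \<Longrightarrow> flat q x = 0"
  by (auto simp: flat_def)

lemma flat_1_nonneg: "flat 1 x \<ge> 0"
  by (auto simp: flat_def)

lemma continuous_on_flat: "continuous_on A (flat q)"
  by (rule continuous_on_subset[OF DERIV_continuous_on[of UNIV]]) (auto intro: flat_has_derivative)

section \<open>Bumps and one-dimensional mollifiers\<close>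

definition bump :: "nat \<Rightarrow> real \<Rightarrow> real" where
  "bump n x = flat 1 (1 + real (Suc n) * x) * flat 1 (1 - real (Suc n) * x)"

lemma continuous_on_bump: "continuous_on A (bump n)"
  unfolding bump_def by (intro continuous_intros continuous_on_compose2[OF continuous_on_flat[of UNIV]]) auto

lemma bump_nonneg: "bump n x \<ge> 0"
  by (simp add: bump_def flat_1_nonneg)

lemma bump_outside: "\<bar>x\<bar> \<ge> 1 / real (Suc n) \<Longrightarrow> bump n x = 0"
  unfolding bump_def
  by (cases "x \<ge> 0") (auto simp: flat_nonpos field_simps)

lemma bump_pos_0: "bump n 0 > 0"
  by (simp add: bump_def flat_1_pos)

lemma integrable_continuous_bounded_support:
  fixes f :: "real \<Rightarrow> real"
  assumes "continuous_on UNIV f" "\<And>x. \<bar>x\<bar> > 1 \<Longrightarrow> f x = 0"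
  shows "integrable lborel f"
proof -
  have "integrable lborel (\<lambda>x. indicator {-1..1} x *\<^sub>R f x)"
    by (intro borel_integrable_compact continuous_on_subset[OF assms(1)]) auto
  moreover have "(\<lambda>x. indicator {-1..1} x *\<^sub>R f x) = f"
  proof
    show "indicator {-1..1} x *\<^sub>R f x = f x" for x
      using assms(2)[of x] by (cases "\<bar>x\<bar> > 1") (auto simp: indicator_def)
  qed
  ultimately show ?thesis by simp
qed

lemma integrable_bump: "integrable lborel (bump n)"
proof (rule integrable_continuous_bounded_support)
  show "bump n x = 0" if "\<bar>x\<bar> > 1" for x
    using that by (intro bump_outside order_trans[OF _ less_imp_le[OF that]]) simp
qed (rule continuous_on_bump)

lemma integral_bump_pos: "integral\<^sup>L lborel (bump n) > 0"
proof -
  have "integral\<^sup>L lborel (bump n) \<ge> 0" by (simp add: bump_nonneg)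
  moreover have "integral\<^sup>L lborel (bump n) \<noteq> 0"
  proof
    assume "integral\<^sup>L lborel (bump n) = 0"
    then have ae: "AE x in lborel. bump n x = 0"
      by (subst (asm) integral_nonneg_eq_0_iff_AE) (auto simp: bump_nonneg integrable_bump)
    \<comment> \<open>An open null set is empty, but this one contains 0.\<close>
    have "open {x. bump n x \<noteq> 0}"
      by (intro open_Collect_neq continuous_on_bump continuous_intros)
    moreover have "{x. bump n x \<noteq> 0} \<in> null_sets lborel"
      using ae AE_iff_measurable[of "{x. bump n x \<noteq> 0}" lborel "\<lambda>x. bump n x = 0"] borel_open[OF calculation]
      by (simp add: null_sets_def)
    ultimately have "{x. bump n x \<noteq> 0} = {}"
      using open_not_negligible negligible_iff_null_sets null_sets_completionI by blast
    with bump_pos_0[of n] show False by force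
  qed
  ultimately show ?thesis by linarith
qed

definition mol :: "nat \<Rightarrow> real \<Rightarrow> real" where
  "mol n x = bump n x / integral\<^sup>L lborel (bump n)"

text \<open>Product rule for \<open>mol\<close>: \<open>flat [:0, 0, 1:]\<close> is the derivative
  of \<open>flat 1\<close>.\<close>

definition mol' :: "nat \<Rightarrow> real \<Rightarrow> real" where
  "mol' n x = real (Suc n) * (flat ([:0, 0, 1:]) (1 + real (Suc n) * x) * flat 1 (1 - real (Suc n) * x)
     - flat 1 (1 + real (Suc n) * x) * flat [:0, 0, 1:] (1 - real (Suc n) * x)) / integral\<^sup>L lborel (bump n)"

lemma mol_has_derivative: "(mol n has_real_derivative mol' n x) (at x)"
proof -
  have f: "(flat 1 has_real_derivative flat [:0, 0, 1:] y) (at y)" for y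
    using flat_has_derivative[of 1 y] by simp
  have "((\<lambda>x. flat 1 (1 + real (Suc n) * x)) has_real_derivative flat [:0, 0, 1:] (1 + real (Suc n) * x) * real (Suc n)) (at x)"
    by (rule DERIV_chain2[OF f]) (auto intro!: derivative_eq_intros)
  moreover have "((\<lambda>x. flat 1 (1 - real (Suc n) * x)) has_real_derivative flat [:0, 0, 1:] (1 - real (Suc n) * x) * (- real (Suc n))) (at x)"
    by (rule DERIV_chain2[OF f]) (auto intro!: derivative_eq_intros)
  ultimately have "((\<lambda>x. flat 1 (1 + real (Suc n) * x) * flat 1 (1 - real (Suc n) * x) / integral\<^sup>L lborel (bump n))
     has_real_derivative mol' n x) (at x)"
    unfolding mol'_def by (intro DERIV_cong[OF DERIV_cdivide[OF DERIV_mult]]) (auto simp: algebra_simps)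
  moreover have "mol n = (\<lambda>x. flat 1 (1 + real (Suc n) * x) * flat 1 (1 - real (Suc n) * x) / integral\<^sup>L lborel (bump n))"
    by (simp add: mol_def bump_def fun_eq_iff)
  ultimately show ?thesis by simp
qed

lemma continuous_on_mol: "continuous_on A (mol n)"
  using integral_bump_pos[of n] unfolding mol_def by (intro continuous_intros continuous_on_bump) auto

lemma continuous_on_mol': "continuous_on A (mol' n)"
  using integral_bump_pos[of n] unfolding mol'_def
  by (intro continuous_intros continuous_on_compose2[OF continuous_on_flat[of UNIV]]) auto

lemma mol_nonneg: "mol n x \<ge> 0"
  using integral_bump_pos[of n] by (simp add: mol_def bump_nonneg)

lemma mol_outside: "\<bar>x\<bar> \<ge> 1 / real (Suc n) \<Longrightarrow> mol n x = 0"
  by (simp add: mol_def bump_outside)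

lemma mol'_outside: "\<bar>x\<bar> \<ge> 1 / real (Suc n) \<Longrightarrow> mol' n x = 0"
  unfolding mol'_def
  by (cases "x \<ge> 0") (auto simp: flat_nonpos field_simps)

lemma inverse_Suc_le_1: "1 / real (Suc n) \<le> 1"
  by simp

lemma integrable_mol: "integrable lborel (mol n)"
  unfolding mol_def by (intro integrable_divide integrable_bump)

lemma integral_mol: "integral\<^sup>L lborel (mol n) = 1"
  using integral_bump_pos[of n] by (simp add: mol_def[abs_def])

lemma times_differentiable_mol_affine:
  assumes "bounded_linear L"
  shows "times_differentiable k (\<lambda>z. mol n (c + L z))"
proof -
  have L: "bounded_linear (\<lambda>z. real (Suc n) * L z)" "bounded_linear (\<lambda>z. - (real (Suc n) * L z))"
    by (intro assms bounded_linear_const_mult bounded_linear_minus)+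
  have "times_differentiable k (\<lambda>z. inverse (integral\<^sup>L lborel (bump n)) *\<^sub>R
      (flat 1 ((1 + real (Suc n) * c) + real (Suc n) * L z) *\<^sub>R
       flat 1 ((1 - real (Suc n) * c) + - (real (Suc n) * L z))))"
    by (intro times_differentiable_scaleR times_differentiable_const
        times_differentiable_smooth_affine smooth_real_flat L)
  moreover have "mol n (c + L z) = inverse (integral\<^sup>L lborel (bump n)) *\<^sub>R
      (flat 1 ((1 + real (Suc n) * c) + real (Suc n) * L z) *\<^sub>R
       flat 1 ((1 - real (Suc n) * c) + - (real (Suc n) * L z)))" for z
    unfolding mol_def bump_def real_scaleR_def
    by (simp only: distrib_left add.assoc[symmetric] diff_conv_add_uminus minus_add_distrib divide_inverse mult_ac)
  ultimately show ?thesis by simp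
qed

section \<open>Convolution on Euclidean space\<close>

lemma integrable_bounded_support:
  fixes f :: "'a::euclidean_space \<Rightarrow> real"
  assumes [measurable]: "f \<in> borel_measurable borel"
    and bound: "\<And>z. norm z \<le> R \<Longrightarrow> \<bar>f z\<bar> \<le> C"
    and supp: "\<And>z. norm z > R \<Longrightarrow> f z = 0"
  shows "integrable lborel f"
proof (rule integrableI_bounded_set[where A = "cball 0 R" and B = C])
  show "emeasure lborel (cball 0 R :: 'a set) < \<infinity>"
    by (intro emeasure_bounded_finite) auto
qed (use bound supp in \<open>auto simp: not_le\<close>)

lemma lborel_distr_minus_left:
  fixes z :: "'a::euclidean_space"
  shows "distr lborel borel (\<lambda>s. z - s) = lborel"
  by (subst (2) lborel_affine[of "-1" z]) (auto simp: density_1)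

lemma lborel_integral_minus_left:
  fixes f :: "'a::euclidean_space \<Rightarrow> real"
  assumes "f \<in> borel_measurable borel"
  shows "(LINT s|lborel. f (z - s)) = (LINT s|lborel. f s)"
proof -
  have "(LINT s|lborel. f s) = (LINT s|distr lborel borel (\<lambda>s. z - s). f s)"
    by (simp add: lborel_distr_minus_left)
  also have "\<dots> = (LINT s|lborel. f (z - s))"
    using assms by (subst integral_distr) auto
  finally show ?thesis by simp
qed

lemma lborel_integrable_minus_left:
  fixes f :: "'a::euclidean_space \<Rightarrow> real"
  assumes [measurable]: "f \<in> borel_measurable borel" and "integrable lborel f"
  shows "integrable lborel (\<lambda>s. f (z - s))"
proof -
  have "integrable (distr lborel borel (\<lambda>s. z - s)) f \<longleftrightarrow> integrable lborel (\<lambda>s. f (z - s))"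
    by (rule integrable_distr_eq) auto
  with assms(2) show ?thesis by (simp add: lborel_distr_minus_left)
qed

lemma lborel_integrable_diff_right:
  fixes f :: "'a::euclidean_space \<Rightarrow> real"
  assumes [measurable]: "f \<in> borel_measurable borel" and "integrable lborel f"
  shows "integrable lborel (\<lambda>s. f (s - z))"
proof -
  have "integrable (distr lborel borel ((+) (- z))) f \<longleftrightarrow> integrable lborel (\<lambda>s. f (- z + s))"
    by (rule integrable_distr_eq) auto
  with assms(2) show ?thesis by (simp add: lborel_distr_plus)
qed

lemma lborel_nn_integral_diff_right:
  fixes f :: "'a::euclidean_space \<Rightarrow> ennreal"
  assumes "f \<in> borel_measurable borel"
  shows "(\<integral>\<^sup>+s. f (s - z) \<partial>lborel) = (\<integral>\<^sup>+s. f s \<partial>lborel)"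
proof -
  have "(\<integral>\<^sup>+s. f s \<partial>lborel) = (\<integral>\<^sup>+s. f s \<partial>distr lborel borel ((+) (- z)))"
    by (simp only: lborel_distr_plus)
  also have "\<dots> = (\<integral>\<^sup>+s. f (s - z) \<partial>lborel)"
    using assms by (subst nn_integral_distr) auto
  finally show ?thesis by simp
qed

text \<open>Derivatives along one fixed direction are all that integration by parts requires, and
  products and convolutions respect them on any Euclidean space.\<close>

definition has_dir_deriv :: "('a::real_vector \<Rightarrow> real) \<Rightarrow> ('a \<Rightarrow> real) \<Rightarrow> 'a \<Rightarrow> bool" where
  "has_dir_deriv f f' e \<longleftrightarrow> (\<forall>z. ((\<lambda>h. f (z + h *\<^sub>R e)) has_real_derivative f' z) (at 0))"

lemma has_dir_deriv_at:
  assumes "has_dir_deriv f f' e"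
  shows "((\<lambda>h. f (z + h *\<^sub>R e)) has_real_derivative f' (z + x *\<^sub>R e)) (at x)"
proof -
  have "((\<lambda>h. f ((z + x *\<^sub>R e) + h *\<^sub>R e)) has_real_derivative f' (z + x *\<^sub>R e)) (at 0)"
    using assms unfolding has_dir_deriv_def by blast
  then have "((\<lambda>h. f (z + (x + h) *\<^sub>R e)) has_real_derivative f' (z + x *\<^sub>R e)) (at 0)"
    by (simp add: algebra_simps)
  then show ?thesis using DERIV_shift[of "\<lambda>h. f (z + h *\<^sub>R e)" "f' (z + x *\<^sub>R e)" 0 x]
    by (simp add: add.commute)
qed

lemma has_dir_deriv_fst:
  "has_dir_deriv f f' (1, 0) \<longleftrightarrow> (\<forall>y t. ((\<lambda>y. f (y, t)) has_real_derivative f' (y, t)) (at (y::real)))"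
  (is "?L \<longleftrightarrow> ?R")
proof
  assume ?L
  show ?R
  proof (intro allI)
    fix y t
    show "((\<lambda>y. f (y, t)) has_real_derivative f' (y, t)) (at y)"
      using has_dir_deriv_at[OF \<open>?L\<close>, of "(0, t)" y] by simp
  qed
next
  assume R: ?R
  show ?L unfolding has_dir_deriv_def
  proof (intro allI)
    fix z :: "real \<times> 'a"
    have "((\<lambda>h. f (fst z + h, snd z)) has_real_derivative f' z) (at 0)"
      using R[rule_format, of "snd z" "fst z"] DERIV_shift[of "\<lambda>h. f (h, snd z)" "f' z" 0 "fst z"]
      by (simp add: add.commute)
    then show "((\<lambda>h. f (z + h *\<^sub>R (1, 0))) has_real_derivative f' z) (at 0)"
      by (cases z) simp
  qed
qed

lemma has_dir_deriv_snd:
  "has_dir_deriv f f' (0, 1) \<longleftrightarrow> (\<forall>y t. ((\<lambda>t. f (y, t)) has_real_derivative f' (y, t)) (at (t::real)))"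
  (is "?L \<longleftrightarrow> ?R")
proof
  assume ?L
  show ?R
  proof (intro allI)
    fix y t
    show "((\<lambda>t. f (y, t)) has_real_derivative f' (y, t)) (at t)"
      using has_dir_deriv_at[OF \<open>?L\<close>, of "(y, 0)" t] by simp
  qed
next
  assume R: ?R
  show ?L unfolding has_dir_deriv_def
  proof (intro allI)
    fix z :: "'a \<times> real"
    have "((\<lambda>h. f (fst z, snd z + h)) has_real_derivative f' z) (at 0)"
      using R[rule_format, of "fst z" "snd z"] DERIV_shift[of "\<lambda>h. f (fst z, h)" "f' z" 0 "snd z"]
      by (simp add: add.commute)
    then show "((\<lambda>h. f (z + h *\<^sub>R (0, 1))) has_real_derivative f' z) (at 0)"
      by (cases z) simp
  qed
qed

lemma has_dir_deriv_mult:
  assumes "has_dir_deriv f f' e" "has_dir_deriv g g' e"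
  shows "has_dir_deriv (\<lambda>z. f z * g z) (\<lambda>z. f' z * g z + f z * g' z) e"
  using assms unfolding has_dir_deriv_def
  by (auto intro!: derivative_eq_intros)

section \<open>Compactly supported kernels and convolution\<close>

definition kernel :: "real \<Rightarrow> ('a::real_normed_vector \<Rightarrow> real) \<Rightarrow> bool" where
  "kernel R k \<longleftrightarrow> continuous_on UNIV k \<and> (\<forall>z. norm z > R \<longrightarrow> k z = 0)"

lemma kernel_measurable: "kernel R k \<Longrightarrow> k \<in> borel_measurable borel"
  by (auto simp: kernel_def borel_measurable_continuous_onI)

lemma kernel_outside: "kernel R k \<Longrightarrow> norm z > R \<Longrightarrow> k z = 0"
  by (auto simp: kernel_def)

lemma kernel_bounded:
  fixes k :: "'a::euclidean_space \<Rightarrow> real"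
  assumes "kernel R k"
  obtains C where "C \<ge> 0" "\<And>z. \<bar>k z\<bar> \<le> C"
proof -
  have "bounded (k ` cball 0 R)"
    using assms continuous_on_subset[of UNIV k "cball 0 R"]
    by (intro compact_imp_bounded compact_continuous_image) (auto simp: kernel_def)
  then obtain C where C: "\<And>z. norm z \<le> R \<Longrightarrow> \<bar>k z\<bar> \<le> C"
    by (force simp: bounded_iff)
  have "\<bar>k z\<bar> \<le> max 0 C" for z
    using C[of z] kernel_outside[OF assms, of z] by (cases "norm z \<le> R") auto
  then show thesis by (intro that[of "max 0 C"]) auto
qed

lemma kernel_integrable:
  fixes k :: "'a::euclidean_space \<Rightarrow> real"
  assumes "kernel R k"
  shows "integrable lborel k"
proof -
  obtain C where "\<And>z. \<bar>k z\<bar> \<le> C" using kernel_bounded[OF assms] by blast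
  then show ?thesis
    by (intro integrable_bounded_support[of _ R C] kernel_measurable[OF assms] kernel_outside[OF assms])
qed

text \<open>The bound holds everywhere, not almost everywhere, and the function is Borel:
  convolutions, slices and compositions then carry no exceptional sets.\<close>

definition bounded_borel :: "real \<Rightarrow> ('a::euclidean_space \<Rightarrow> real) \<Rightarrow> bool" where
  "bounded_borel M F \<longleftrightarrow> F \<in> borel_measurable borel \<and> (\<forall>z. \<bar>F z\<bar> \<le> M)"

lemma bounded_borel_nonneg: "bounded_borel M F \<Longrightarrow> M \<ge> 0"
  unfolding bounded_borel_def using abs_ge_zero order_trans by blast

lemma bounded_borel_times_kernel_integrable:
  fixes F :: "'a::euclidean_space \<Rightarrow> real"
  assumes "bounded_borel M F" "kernel R k"
  shows "integrable lborel (\<lambda>s. F s * k s)"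
proof -
  obtain C where C: "C \<ge> 0" "\<And>z. \<bar>k z\<bar> \<le> C" using kernel_bounded[OF assms(2)] by blast
  note [measurable] = kernel_measurable[OF assms(2)]
  have [measurable]: "F \<in> borel_measurable borel" and M: "\<And>z. \<bar>F z\<bar> \<le> M"
    using assms(1) by (auto simp: bounded_borel_def)
  show ?thesis
  proof (rule integrable_bounded_support[of _ R "M * C"])
    show "\<bar>F z * k z\<bar> \<le> M * C" for z
      unfolding abs_mult by (intro mult_mono M C bounded_borel_nonneg[OF assms(1)]) auto
  qed (auto simp: kernel_outside[OF assms(2)])
qed

definition conv :: "('a::euclidean_space \<Rightarrow> real) \<Rightarrow> ('a \<Rightarrow> real) \<Rightarrow> 'a \<Rightarrow> real" where
  "conv F k z = (LINT s|lborel. F s * k (z - s))"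

lemma product_integral:
  fixes f :: "'a::euclidean_space \<Rightarrow> real" and g :: "'b::euclidean_space \<Rightarrow> real"
  assumes f: "integrable lborel f" and g: "integrable lborel g"
  shows "integrable lborel (\<lambda>p. f (fst p) * g (snd p))"
    and "(LINT p|lborel. f (fst p) * g (snd p)) = (LINT x|lborel. f x) * (LINT y|lborel. g y)"
proof -
  have [measurable]: "f \<in> borel_measurable lborel" "g \<in> borel_measurable lborel"
    using f g by auto
  have i: "integrable (lborel \<Otimes>\<^sub>M lborel) (\<lambda>p. f (fst p) * g (snd p))"
  proof (rule lborel_pair.Fubini_integrable)
    show "integrable lborel (\<lambda>x. LINT y|lborel. norm (f (fst (x, y)) * g (snd (x, y))))"
      using f by (simp add: abs_mult)
    show "AE x in lborel. integrable lborel (\<lambda>y. f (fst (x, y)) * g (snd (x, y)))"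
      using g by simp
  qed measurable
  then show "integrable lborel (\<lambda>p. f (fst p) * g (snd p))" by (simp only: lborel_prod)
  from lborel_pair.integral_fst'[OF i]
  show "(LINT p|lborel. f (fst p) * g (snd p)) = (LINT x|lborel. f x) * (LINT y|lborel. g y)"
    by (simp add: lborel_prod)
qed

lemma conv_integrable:
  assumes F: "bounded_borel M F" and k: "kernel R k"
  shows "integrable lborel (\<lambda>s. F s * k (z - s))"
proof (rule bounded_borel_times_kernel_integrable[OF F])
  have "k (z - s) = 0" if "norm s > norm z + R" for s
    using that norm_triangle_ineq3[of z s] by (intro kernel_outside[OF k]) linarith
  moreover have "continuous_on UNIV (\<lambda>s. k (z - s))"
    using k unfolding kernel_def
    by (intro continuous_on_compose2[of UNIV k UNIV "\<lambda>s. z - s"]) (auto intro!: continuous_intros)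
  ultimately show "kernel (norm z + R) (\<lambda>s. k (z - s))" by (auto simp: kernel_def)
qed

text \<open>Dominated convergence with majorant \<open>M * C\<close> on one ball: \<open>F\<close>
  is only bounded, so integrability comes from the common support of the \<open>g j\<close>.
  Continuity and differentiation of convolutions are both instances.\<close>

lemma conv_dominated:
  fixes F :: "'a::euclidean_space \<Rightarrow> real"
  assumes F: "bounded_borel M F"
    and [measurable]: "\<And>j. g j \<in> borel_measurable borel"
    and bound: "\<And>j s. \<bar>g j s\<bar> \<le> C"
    and supp: "\<And>j s. norm s > R \<Longrightarrow> g j s = 0"
    and lim: "\<And>s. (\<lambda>j. g j s) \<longlonglongrightarrow> G s"
  shows "(\<lambda>j. LINT s|lborel. F s * g j s) \<longlonglongrightarrow> (LINT s|lborel. F s * G s)"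
proof (rule integral_dominated_convergence[where w = "\<lambda>s. M * C * indicator (cball 0 R) s"])
  have [measurable]: "F \<in> borel_measurable borel" and M: "\<And>z. \<bar>F z\<bar> \<le> M"
    using F by (auto simp: bounded_borel_def)
  have [measurable]: "G \<in> borel_measurable borel"
    by (rule borel_measurable_LIMSEQ_real[OF lim]) auto
  have C: "C \<ge> 0" using bound[of undefined undefined] by linarith
  show "(\<lambda>s. F s * G s) \<in> borel_measurable lborel" "\<And>j. (\<lambda>s. F s * g j s) \<in> borel_measurable lborel"
    by measurable
  show "integrable lborel (\<lambda>s. M * C * indicator (cball (0::'a) R) s)"
    by (intro integrable_bounded_support[of _ R "\<bar>M * C\<bar>"])
      (auto simp: indicator_def)
  show "AE s in lborel. norm (F s * g j s) \<le> M * C * indicator (cball 0 R) s" for j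
  proof (rule AE_I2)
    fix s
    have "\<bar>F s\<bar> * \<bar>g j s\<bar> \<le> M * C"
      by (intro mult_mono M bound bounded_borel_nonneg[OF F]) auto
    then show "norm (F s * g j s) \<le> M * C * indicator (cball 0 R) s"
      using supp[of s j] by (cases "norm s \<le> R") (auto simp: abs_mult)
  qed
  show "AE s in lborel. (\<lambda>j. F s * g j s) \<longlonglongrightarrow> F s * G s"
    by (intro AE_I2 tendsto_intros lim)
qed

lemma continuous_on_conv:
  fixes F :: "'a::euclidean_space \<Rightarrow> real"
  assumes F: "bounded_borel M F" and k: "kernel R k"
  shows "continuous_on UNIV (conv F k)"
proof (rule continuous_at_imp_continuous_on, rule ballI)
  fix z
  note [measurable] = kernel_measurable[OF k]
  obtain C where C: "\<And>z. \<bar>k z\<bar> \<le> C" using kernel_bounded[OF k] by blast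
  show "isCont (conv F k) z"
    unfolding continuous_at_sequentially comp_def conv_def
  proof (intro allI impI)
    fix x :: "nat \<Rightarrow> 'a"
    assume x: "x \<longlonglongrightarrow> z"
    then obtain B where B: "\<And>j. norm (x j) \<le> B"
      using Bseq_def convergentI convergent_imp_Bseq by metis
    show "(\<lambda>j. LINT s|lborel. F s * k (x j - s)) \<longlonglongrightarrow> (LINT s|lborel. F s * k (z - s))"
    proof (rule conv_dominated[OF F, where C = C and R = "B + R"])
      show "k (x j - s) = 0" if "norm s > B + R" for j s
        using that B[of j] norm_triangle_ineq3[of "x j" s] by (intro kernel_outside[OF k]) linarith
      show "(\<lambda>j. k (x j - s)) \<longlonglongrightarrow> k (z - s)" for s
        using k by (intro continuous_on_tendsto_compose[of UNIV k] tendsto_intros x)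
          (auto simp: kernel_def)
    qed (use C in auto)
  qed
qed

lemma kernel_diff_quotient_bound:
  fixes k :: "'a::euclidean_space \<Rightarrow> real"
  assumes "has_dir_deriv k k' e" "\<And>z. \<bar>k' z\<bar> \<le> C"
  shows "\<bar>k (z + h *\<^sub>R e) - k z\<bar> \<le> C * \<bar>h\<bar>"
proof -
  have "norm (k (z + h *\<^sub>R e) - k (z + 0 *\<^sub>R e)) \<le> C * norm (h - 0)"
  proof (rule field_differentiable_bound[where S = UNIV and f' = "\<lambda>h. k' (z + h *\<^sub>R e)"])
    show "((\<lambda>h. k (z + h *\<^sub>R e)) has_real_derivative k' (z + x *\<^sub>R e)) (at x within UNIV)" for x
      using has_dir_deriv_at[OF assms(1)] by simp
  qed (use assms(2) in auto)
  then show ?thesis by simp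
qed

text \<open>The derivative falls on the kernel alone, so \<open>F\<close> may be any bounded Borel
  function. The difference quotients of \<open>k\<close> are bounded by a bound of \<open>k'\<close>
  through the mean value theorem, and their supports stay in one ball because the steps are
  bounded.\<close>

lemma has_dir_deriv_conv:
  fixes F :: "'a::euclidean_space \<Rightarrow> real"
  assumes F: "bounded_borel M F" and k: "kernel R k" and k': "kernel R k'"
    and d: "has_dir_deriv k k' e"
  shows "has_dir_deriv (conv F k) (conv F k') e"
  unfolding has_dir_deriv_def DERIV_def
proof
  fix z
  note [measurable] = kernel_measurable[OF k]
  obtain C where C: "\<And>z. \<bar>k' z\<bar> \<le> C" using kernel_bounded[OF k'] by blast
  note int = conv_integrable[OF F k]
  show "(\<lambda>h. (conv F k (z + (0 + h) *\<^sub>R e) - conv F k (z + 0 *\<^sub>R e)) / h) \<midarrow>0\<rightarrow> conv F k' z"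
    unfolding tendsto_at_iff_sequentially comp_def
  proof (intro allI impI)
    fix x :: "nat \<Rightarrow> real"
    assume nz: "\<forall>i. x i \<in> UNIV - {0}" and x: "x \<longlonglongrightarrow> 0"
    then obtain B where B: "\<And>j. \<bar>x j\<bar> \<le> B"
      using Bseq_def convergentI convergent_imp_Bseq by (metis real_norm_def)
    have B0: "B \<ge> 0" using B[of 0] by linarith
    have "(conv F k (z + x j *\<^sub>R e) - conv F k z) / x j
        = (LINT s|lborel. F s * ((k ((z - s) + x j *\<^sub>R e) - k (z - s)) / x j))" for j
    proof -
      have "conv F k (z + x j *\<^sub>R e) - conv F k z
        = (LINT s|lborel. F s * k (z + x j *\<^sub>R e - s) - F s * k (z - s))"
        unfolding conv_def by (intro Bochner_Integration.integral_diff[symmetric] int)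
      then have "(conv F k (z + x j *\<^sub>R e) - conv F k z) / x j
        = (LINT s|lborel. (F s * k (z + x j *\<^sub>R e - s) - F s * k (z - s)) / x j)"
        by simp
      also have "\<dots> = (LINT s|lborel. F s * ((k ((z - s) + x j *\<^sub>R e) - k (z - s)) / x j))"
        by (intro Bochner_Integration.integral_cong) (auto simp: field_simps)
      finally show ?thesis .
    qed
    moreover have "(\<lambda>j. LINT s|lborel. F s * ((k ((z - s) + x j *\<^sub>R e) - k (z - s)) / x j))
        \<longlonglongrightarrow> (LINT s|lborel. F s * k' (z - s))"
    proof (rule conv_dominated[OF F, where C = C and R = "norm z + B * norm e + R"])
      show "\<bar>(k ((z - s) + x j *\<^sub>R e) - k (z - s)) / x j\<bar> \<le> C" for j s
        using kernel_diff_quotient_bound[OF d C, of "z - s" "x j"] nz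
        by (simp add: abs_divide divide_le_eq)
      show "(k ((z - s) + x j *\<^sub>R e) - k (z - s)) / x j = 0"
        if s: "norm s > norm z + B * norm e + R" for j s
      proof -
        have 1: "norm (x j *\<^sub>R e) \<le> B * norm e" using B[of j] by (simp add: mult_right_mono)
        have 2: "0 \<le> B * norm e" using B0 by simp
        have "norm s - norm z \<le> norm (z - s)" using norm_triangle_ineq3[of z s] by linarith
        moreover have "norm (z - s) - norm (x j *\<^sub>R e) \<le> norm ((z - s) + x j *\<^sub>R e)"
          using norm_triangle_ineq4[of "(z - s) + x j *\<^sub>R e" "x j *\<^sub>R e"] by simp
        ultimately show ?thesis
          using s 1 2 kernel_outside[OF k, of "z - s"] kernel_outside[OF k, of "(z - s) + x j *\<^sub>R e"]
          by auto
      qed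
      have "((\<lambda>h. (k ((z - s) + (0 + h) *\<^sub>R e) - k ((z - s) + 0 *\<^sub>R e)) / h) \<longlongrightarrow> k' (z - s)) (at 0)" for s
        using d unfolding has_dir_deriv_def DERIV_def by blast
      then show "(\<lambda>j. (k ((z - s) + x j *\<^sub>R e) - k (z - s)) / x j) \<longlonglongrightarrow> k' (z - s)" for s
        using nz x unfolding tendsto_at_iff_sequentially comp_def by force
    qed auto
    ultimately show "(\<lambda>j. (conv F k (z + (0 + x j) *\<^sub>R e) - conv F k (z + 0 *\<^sub>R e)) / x j) \<longlonglongrightarrow> conv F k' z"
      by (simp only: conv_def[of F k'] add_0 scaleR_zero_left add_0_right)
  qed
qed

text \<open>Convolving \<open>f\<close> with the constant 1 gives a constant function; its
  derivative 0 is also the convolution of 1 with \<open>f'\<close>, that is the integral of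
  \<open>f'\<close>.\<close>

lemma integral_dir_deriv_eq_0:
  fixes f :: "'a::euclidean_space \<Rightarrow> real"
  assumes k: "kernel R f" and k': "kernel R f'" and d: "has_dir_deriv f f' e"
  shows "(LINT s|lborel. f' s) = 0"
proof -
  have "bounded_borel 1 (\<lambda>_::'a. 1)" by (simp add: bounded_borel_def)
  from has_dir_deriv_conv[OF this k k' d]
  have "((\<lambda>h. conv (\<lambda>_. 1) f (0 + h *\<^sub>R e)) has_real_derivative conv (\<lambda>_. 1) f' 0) (at 0)"
    unfolding has_dir_deriv_def by blast
  then have "((\<lambda>h. LINT s|lborel. f s) has_real_derivative (LINT s|lborel. f' s)) (at 0)"
    by (simp add: conv_def lborel_integral_minus_left kernel_measurable[OF k] 
      lborel_integral_minus_left[of f' 0, simplified] kernel_measurable[OF k'])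
  moreover have "((\<lambda>h::real. LINT s|lborel. f s) has_real_derivative 0) (at 0)" by simp
  ultimately show ?thesis by (rule DERIV_unique)
qed

section \<open>Almost everywhere convergence of mollifications\<close>

text \<open>An integrable weight: it turns the plane into a finite measure space, so that merely
  bounded functions have finite distances in the mean.\<close>

definition wt :: "real \<times> real \<Rightarrow> real" where
  "wt z = exp (- \<bar>fst z\<bar>) * exp (- \<bar>snd z\<bar>)"

lemma wt_pos: "wt z > 0"
  by (simp add: wt_def)

lemma wt_measurable [measurable]: "wt \<in> borel_measurable borel"
  unfolding wt_def by (intro borel_measurable_continuous_onI continuous_intros)

lemma integrable_exp_minus_abs: "integrable lborel (\<lambda>x::real. exp (- \<bar>x\<bar>))"
proof -
  have g: "integrable lborel (\<lambda>x::real. exp (- x) * indicator {0..} x)"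
  proof (rule integrableI_nonneg)
    show "(\<integral>\<^sup>+x. ennreal (exp (- x) * indicator {0..} x) \<partial>lborel) < \<infinity>"
      using nn_intergal_power_times_exp_Ici[of 0] by (simp add: ennreal_mult' ennreal_indicator)
  qed auto
  then have "integrable lborel (\<lambda>x::real. exp (- (0 + (- 1) * x)) * indicator {0..} (0 + (- 1) * x))"
    by (rule lborel_integrable_real_affine) simp
  from Bochner_Integration.integrable_add[OF g this]
  show ?thesis
    by (rule Bochner_Integration.integrable_bound) (auto simp: indicator_def)
qed

lemma integrable_wt: "integrable lborel wt"
  using product_integral(1)[OF integrable_exp_minus_abs integrable_exp_minus_abs] by (simp add: wt_def[abs_def])

text \<open>Each coordinate moves by at most 1 and costs a factor \<open>e\<close>, whence
  \<open>exp 2\<close>. This makes small translations bounded in the weighted space.\<close>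

lemma wt_shift: "norm s \<le> 1 \<Longrightarrow> wt (z + s) \<le> exp 2 * wt z"
proof -
  assume s: "norm s \<le> 1"
  have "\<bar>fst s\<bar> \<le> 1" "\<bar>snd s\<bar> \<le> 1"
    using s norm_fst_le[of "fst s" "snd s"] norm_snd_le[of "snd s" "fst s"]
    unfolding prod.collapse real_norm_def by linarith+
  then have "- \<bar>fst (z + s)\<bar> + - \<bar>snd (z + s)\<bar> \<le> 2 + (- \<bar>fst z\<bar> + - \<bar>snd z\<bar>)"
    unfolding fst_add snd_add by linarith
  then show ?thesis unfolding wt_def by (simp flip: exp_add)
qed

lemma wt_bounded_integrable:
  assumes "f \<in> borel_measurable borel" "\<And>z. \<bar>f z\<bar> \<le> C"
  shows "integrable lborel (\<lambda>z. wt z * f z)"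
proof (rule Bochner_Integration.integrable_bound[where f = "\<lambda>z. C * wt z"])
  have "C \<ge> 0" using assms(2)[of undefined] by linarith
  then show "AE z in lborel. norm (wt z * f z) \<le> norm (C * wt z)"
    using wt_pos assms(2)
    by (intro AE_I2) (simp add: abs_mult mult.commute[of C] mult_left_mono less_imp_le)
qed (use assms integrable_wt in auto)

lemma bounded_borel_diff_right: "bounded_borel M F \<Longrightarrow> bounded_borel M (\<lambda>z. F (z - s))"
  by (auto simp: bounded_borel_def)

lemma wt_diff_integrable:
  assumes "bounded_borel M f" "bounded_borel M g"
  shows "integrable lborel (\<lambda>z. wt z * \<bar>f z - g z\<bar>)"
proof (rule wt_bounded_integrable)
  show "(\<lambda>z. \<bar>f z - g z\<bar>) \<in> borel_measurable borel"
    using assms by (auto simp: bounded_borel_def)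
  show "\<bar>\<bar>f z - g z\<bar>\<bar> \<le> M + M" for z
  proof -
    have "\<bar>f z\<bar> \<le> M" "\<bar>g z\<bar> \<le> M" using assms unfolding bounded_borel_def by blast+
    then show ?thesis by linarith
  qed
qed

lemma wt_dominated:
  assumes [measurable]: "\<And>n. g n \<in> borel_measurable borel"
    and b: "\<And>n z. \<bar>g n z\<bar> \<le> C"
    and lim: "AE z in lborel. (\<lambda>n. g n z) \<longlonglongrightarrow> 0"
  shows "(\<lambda>n. LINT z|lborel. wt z * g n z) \<longlonglongrightarrow> 0"
proof -
  have C: "C \<ge> 0" using b[of 0 undefined] by linarith
  have "(\<lambda>n. LINT z|lborel. wt z * g n z) \<longlonglongrightarrow> (LINT z::real\<times>real|lborel. 0)"
  proof (rule integral_dominated_convergence[where w = "\<lambda>z. C * wt z"])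
    show "AE z in lborel. (\<lambda>n. wt z * g n z) \<longlonglongrightarrow> 0"
      using lim by eventually_elim (auto intro: tendsto_mult_right_zero)
    show "AE z in lborel. norm (wt z * g n z) \<le> C * wt z" for n
      using wt_pos b[of n] by (intro AE_I2) (simp add: abs_mult mult.commute[of C] mult_left_mono less_imp_le)
  qed (use integrable_wt in auto)
  then show ?thesis by simp
qed

text \<open>Measurable functions are almost everywhere limits of continuous ones; truncation at the
  level \<open>M\<close> leaves the limit unchanged and supplies the majorant.\<close>

lemma continuous_approx_wt:
  assumes F: "bounded_borel M F" and "\<delta> > 0"
  obtains g where "continuous_on UNIV g" "\<And>z. \<bar>g z\<bar> \<le> M" "(LINT z|lborel. wt z * \<bar>F z - g z\<bar>) < \<delta>"
proof -
  have [measurable]: "F \<in> borel_measurable borel" and M: "\<And>z. \<bar>F z\<bar> \<le> M"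
    using F by (auto simp: bounded_borel_def)
  have "F measurable_on UNIV"
    by (rule lebesgue_measurable_imp_measurable_on) (auto intro: measurable_completion)
  then obtain N g where N: "negligible N" and g: "\<And>n. continuous_on UNIV (g n)"
    and lim: "\<And>x. x \<notin> N \<Longrightarrow> (\<lambda>n. g n x) \<longlonglongrightarrow> F x"
    by (auto simp: measurable_on_def)
  define h where "h = (\<lambda>n::nat. \<lambda>z. max (- M) (min M (g n z)))"
  have h: "continuous_on UNIV (h n)" for n
    unfolding h_def by (intro continuous_intros g)
  have hM: "\<bar>h n z\<bar> \<le> M" for n z
    using bounded_borel_nonneg[OF F] by (auto simp: h_def)
  have [measurable]: "h n \<in> borel_measurable borel" for n
    by (intro borel_measurable_continuous_onI h)
  have "(\<lambda>n. LINT z|lborel. wt z * \<bar>F z - h n z\<bar>) \<longlonglongrightarrow> 0"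
  proof (rule wt_dominated[where C = "M + M"])
    show "\<bar>\<bar>F z - h n z\<bar>\<bar> \<le> M + M" for n z
      using M[of z] hM[of n z] by linarith
    have "AE z in lebesgue. z \<notin> N"
      using N by (auto simp: negligible_iff_null_sets intro: AE_not_in)
    then have "AE z in lborel. z \<notin> N" by (simp add: AE_completion_iff)
    then show "AE z in lborel. (\<lambda>n. \<bar>F z - h n z\<bar>) \<longlonglongrightarrow> 0"
    proof eventually_elim
      case (elim z)
      have "(\<lambda>n. \<bar>F z - h n z\<bar>) \<longlonglongrightarrow> \<bar>F z - max (- M) (min M (F z))\<bar>"
        unfolding h_def by (intro tendsto_intros lim elim)
      moreover have "max (- M) (min M (F z)) = F z" using M[of z] by (auto simp: max_def min_def)
      ultimately show ?case by simp
    qed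
  qed auto
  then have "\<forall>\<^sub>F n in sequentially. (LINT z|lborel. wt z * \<bar>F z - h n z\<bar>) < \<delta>"
    using order_tendstoD(2) \<open>\<delta> > 0\<close> by blast
  then obtain n where "(LINT z|lborel. wt z * \<bar>F z - h n z\<bar>) < \<delta>"
    by (auto simp: eventually_sequentially)
  with h hM show thesis by (rule that)
qed

text \<open>A three-term argument: for a continuous \<open>g\<close> dominated convergence applies,
  and \<open>F\<close> is exchanged for \<open>g\<close> before and after the shift.\<close>

lemma translation_continuous_wt:
  assumes F: "bounded_borel M F" and "\<delta> > 0"
  shows "\<exists>d>0. \<forall>s. norm s < d \<longrightarrow> (LINT z|lborel. wt z * \<bar>F (z - s) - F z\<bar>) < \<delta>"
proof -
  have [measurable]: "F \<in> borel_measurable borel" and M: "\<And>z. \<bar>F z\<bar> \<le> M"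
    using F by (auto simp: bounded_borel_def)
  \<comment> \<open>The shifted error costs \<open>exp 2 * \<eta>\<close> by \<open>wt_shift\<close>
    and the unshifted one \<open>\<eta>\<close>; together they fill one half of
    \<open>\<delta>\<close>.\<close>
  define \<eta> where "\<eta> = \<delta> / (2 * (exp 2 + 1))"
  have "\<eta> > 0" using \<open>\<delta> > 0\<close> by (simp add: \<eta>_def add_pos_pos)
  obtain g where g: "continuous_on UNIV g" and gM: "\<And>z. \<bar>g z\<bar> \<le> M"
    and gF: "(LINT z|lborel. wt z * \<bar>F z - g z\<bar>) < \<eta>"
    using continuous_approx_wt[OF F \<open>\<eta> > 0\<close>] by blast
  have [measurable]: "g \<in> borel_measurable borel"
    by (intro borel_measurable_continuous_onI g)
  have gb: "bounded_borel M g" using gM by (auto simp: bounded_borel_def)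
  have g0: "((\<lambda>s. LINT z|lborel. wt z * \<bar>g (z - s) - g z\<bar>) \<longlongrightarrow> 0) (at 0)"
    unfolding tendsto_at_iff_sequentially comp_def
  proof (intro allI impI)
    fix s :: "nat \<Rightarrow> real \<times> real"
    assume s: "s \<longlonglongrightarrow> 0"
    show "(\<lambda>n. LINT z|lborel. wt z * \<bar>g (z - s n) - g z\<bar>) \<longlonglongrightarrow> 0"
    proof (rule wt_dominated[where C = "M + M"])
      show "\<bar>\<bar>g (z - s n) - g z\<bar>\<bar> \<le> M + M" for n z
        using gM[of z] gM[of "z - s n"] by linarith
      have "(\<lambda>n. \<bar>g (z - s n) - g z\<bar>) \<longlonglongrightarrow> \<bar>g (z - 0) - g z\<bar>" for z
        by (intro tendsto_intros continuous_on_tendsto_compose[OF g] s) auto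
      then show "AE z in lborel. (\<lambda>n. \<bar>g (z - s n) - g z\<bar>) \<longlonglongrightarrow> 0" by simp
    qed auto
  qed
  have "\<forall>\<^sub>F s in at 0. (LINT z|lborel. wt z * \<bar>g (z - s) - g z\<bar>) < \<delta> / 2"
    using order_tendstoD(2)[OF g0, of "\<delta> / 2"] \<open>\<delta> > 0\<close> by simp
  then obtain d where d: "d > 0"
    "\<And>s. s \<noteq> 0 \<Longrightarrow> norm s < d \<Longrightarrow> (LINT z|lborel. wt z * \<bar>g (z - s) - g z\<bar>) < \<delta> / 2"
    by (auto simp: eventually_at dist_norm)
  have "(LINT z|lborel. wt z * \<bar>F (z - s) - F z\<bar>) < \<delta>" if s: "norm s < min d 1" for s
  proof -
    have g': "(LINT z|lborel. wt z * \<bar>g (z - s) - g z\<bar>) < \<delta> / 2"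
      using d(2)[of s] s \<open>\<delta> > 0\<close> by (cases "s = 0") auto
    have i1: "integrable lborel (\<lambda>z. wt z * \<bar>F (z - s) - g (z - s)\<bar>)"
      and i2: "integrable lborel (\<lambda>z. wt z * \<bar>g (z - s) - g z\<bar>)"
      and i3: "integrable lborel (\<lambda>z. wt z * \<bar>F z - g z\<bar>)"
      and i4: "integrable lborel (\<lambda>z. wt z * \<bar>F (z - s) - F z\<bar>)"
      by (intro wt_diff_integrable[of M] bounded_borel_diff_right F gb)+
    have "(LINT z|lborel. wt z * \<bar>F (z - s) - g (z - s)\<bar>) \<le> exp 2 * (LINT z|lborel. wt z * \<bar>F z - g z\<bar>)"
    proof -
      have "(LINT z|lborel. wt z * \<bar>F (z - s) - g (z - s)\<bar>)
          \<le> (LINT z|lborel. (\<lambda>z. exp 2 * (wt z * \<bar>F z - g z\<bar>)) (z - s))"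
      proof (rule integral_mono[OF i1])
        show "integrable lborel (\<lambda>z. (\<lambda>z. exp 2 * (wt z * \<bar>F z - g z\<bar>)) (z - s))"
          by (rule lborel_integrable_diff_right) (use i3 in auto)
        show "wt z * \<bar>F (z - s) - g (z - s)\<bar> \<le> exp 2 * (wt (z - s) * \<bar>F (z - s) - g (z - s)\<bar>)" for z
          using wt_shift[of s "z - s"] s by (simp add: mult.assoc[symmetric] mult_right_mono)
      qed
      also have "\<dots> = (LINT z|distr lborel borel ((+) (- s)). exp 2 * (wt z * \<bar>F z - g z\<bar>))"
        by (subst integral_distr) auto
      also have "\<dots> = exp 2 * (LINT z|lborel. wt z * \<bar>F z - g z\<bar>)"
        by (simp add: lborel_distr_plus)
      finally show ?thesis .
    qed
    moreover have "(LINT z|lborel. wt z * \<bar>F (z - s) - F z\<bar>)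
      \<le> (LINT z|lborel. wt z * \<bar>F (z - s) - g (z - s)\<bar> + wt z * \<bar>g (z - s) - g z\<bar> + wt z * \<bar>F z - g z\<bar>)"
    proof (rule integral_mono[OF i4])
      show "integrable lborel (\<lambda>z. wt z * \<bar>F (z - s) - g (z - s)\<bar> + wt z * \<bar>g (z - s) - g z\<bar> + wt z * \<bar>F z - g z\<bar>)"
        by (intro Bochner_Integration.integrable_add i1 i2 i3)
      show "wt z * \<bar>F (z - s) - F z\<bar>
        \<le> wt z * \<bar>F (z - s) - g (z - s)\<bar> + wt z * \<bar>g (z - s) - g z\<bar> + wt z * \<bar>F z - g z\<bar>" for z
        unfolding distrib_left[symmetric] using wt_pos[of z] by (intro mult_left_mono) auto
    qed
    moreover have "\<dots> = (LINT z|lborel. wt z * \<bar>F (z - s) - g (z - s)\<bar>)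
        + (LINT z|lborel. wt z * \<bar>g (z - s) - g z\<bar>) + (LINT z|lborel. wt z * \<bar>F z - g z\<bar>)"
      by (simp add: i1 i2 i3)
    moreover have "exp 2 * (LINT z|lborel. wt z * \<bar>F z - g z\<bar>) \<le> exp 2 * \<eta>"
      using gF by simp
    moreover have "exp 2 * \<eta> + \<eta> = \<delta> / 2"
    proof -
      have "exp 2 + 1 > (0::real)" by (simp add: add_pos_pos)
      then have "(exp 2 + 1) * \<eta> = \<delta> / 2"
        unfolding \<eta>_def by (subst times_divide_eq_right, subst mult.commute[of 2], subst mult_divide_mult_cancel_left) auto
      then show ?thesis by (simp add: distrib_right)
    qed
    ultimately show ?thesis using g' gF by linarith
  qed
  then show ?thesis using d(1) by (intro exI[of _ "min d 1"]) auto
qed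

section \<open>Mollification in the plane\<close>

definition mollifier :: "nat \<Rightarrow> real \<times> real \<Rightarrow> real" where
  "mollifier n z = mol n (fst z) * mol n (snd z)"
definition mollifier_y :: "nat \<Rightarrow> real \<times> real \<Rightarrow> real" where
  "mollifier_y n z = mol' n (fst z) * mol n (snd z)"
definition mollifier_t :: "nat \<Rightarrow> real \<times> real \<Rightarrow> real" where
  "mollifier_t n z = mol n (fst z) * mol' n (snd z)"

lemma norm_Pair_gt:
  assumes "norm (z :: real \<times> real) > 2 * e"
  shows "\<bar>fst z\<bar> \<ge> e \<or> \<bar>snd z\<bar> \<ge> e"
  using assms norm_Pair_le[of "fst z" "snd z"] unfolding prod.collapse real_norm_def by linarith

text \<open>The support is a square of half side \<open>1 / (n + 1)\<close>, contained in the ball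
  of twice that radius.\<close>

lemma mollifier_kernels:
  "kernel (2 / real (Suc n)) (mollifier n)" "kernel (2 / real (Suc n)) (mollifier_y n)"
  "kernel (2 / real (Suc n)) (mollifier_t n)"
proof -
  have c: "continuous_on UNIV (\<lambda>z::real\<times>real. mol n (fst z))" "continuous_on UNIV (\<lambda>z::real\<times>real. mol n (snd z))"
    "continuous_on UNIV (\<lambda>z::real\<times>real. mol' n (fst z))" "continuous_on UNIV (\<lambda>z::real\<times>real. mol' n (snd z))"
    by (auto intro!: continuous_on_compose2[OF continuous_on_mol[of UNIV]]
       continuous_on_compose2[OF continuous_on_mol'[of UNIV]] continuous_intros)
  have o: "\<bar>fst z\<bar> \<ge> 1 / real (Suc n) \<or> \<bar>snd z\<bar> \<ge> 1 / real (Suc n)"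
    if "norm z > 2 / real (Suc n)" for z :: "real \<times> real"
    using norm_Pair_gt[of "1 / real (Suc n)" z] that by simp
  show "kernel (2 / real (Suc n)) (mollifier n)" "kernel (2 / real (Suc n)) (mollifier_y n)"
    "kernel (2 / real (Suc n)) (mollifier_t n)"
    unfolding kernel_def mollifier_def mollifier_y_def mollifier_t_def
    using c o by (auto intro!: continuous_intros dest!: o simp: mol_outside mol'_outside simp del: of_nat_Suc)
qed

lemma mollifier_measurable [measurable]:
  "mollifier n \<in> borel_measurable borel" "mollifier_y n \<in> borel_measurable borel"
  "mollifier_t n \<in> borel_measurable borel"
  using mollifier_kernels kernel_measurable by blast+

lemma mollifier_dir_deriv:
  "has_dir_deriv (mollifier n) (mollifier_y n) (1, 0)"
  "has_dir_deriv (mollifier n) (mollifier_t n) (0, 1)"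
  unfolding has_dir_deriv_fst has_dir_deriv_snd mollifier_def mollifier_y_def mollifier_t_def
  by (auto intro: DERIV_cmult DERIV_cmult_right mol_has_derivative)

lemma mollifier_nonneg: "mollifier n z \<ge> 0"
  by (simp add: mollifier_def mol_nonneg)

lemma integral_mollifier: "(LINT z|lborel. mollifier n z) = 1"
  using product_integral(2)[OF integrable_mol[of n] integrable_mol[of n]] by (simp add: mollifier_def integral_mol)

lemma conv_mollifier_diff_le:
  assumes F: "bounded_borel M F"
  shows "\<bar>conv F (mollifier n) z - F z\<bar> \<le> (LINT s|lborel. \<bar>F (z - s) - F z\<bar> * mollifier n s)"
    and "integrable lborel (\<lambda>s. \<bar>F (z - s) - F z\<bar> * mollifier n s)"
proof -
  have [measurable]: "F \<in> borel_measurable borel" and M: "\<And>z. \<bar>F z\<bar> \<le> M"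
    using F by (auto simp: bounded_borel_def)
  have "conv F (mollifier n) z = (LINT s|lborel. (\<lambda>s. F (z - s) * mollifier n s) (z - s))"
    unfolding conv_def by simp
  also have "\<dots> = (LINT s|lborel. F (z - s) * mollifier n s)"
    by (rule lborel_integral_minus_left) measurable
  finally have e: "conv F (mollifier n) z = (LINT s|lborel. F (z - s) * mollifier n s)" .
  have "bounded_borel M (\<lambda>s. F (z - s))" unfolding bounded_borel_def using M by auto
  note i = bounded_borel_times_kernel_integrable[OF this mollifier_kernels(1)[of n]]
  have "conv F (mollifier n) z - F z = (LINT s|lborel. F (z - s) * mollifier n s - F z * mollifier n s)"
    using i kernel_integrable[OF mollifier_kernels(1)] by (simp add: e integral_mollifier)
  also have "\<bar>\<dots>\<bar> \<le> (LINT s|lborel. \<bar>F (z - s) * mollifier n s - F z * mollifier n s\<bar>)"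
    by (rule integral_abs_bound)
  also have "\<dots> = (LINT s|lborel. \<bar>F (z - s) - F z\<bar> * mollifier n s)"
    by (intro Bochner_Integration.integral_cong)
      (auto simp: abs_mult mollifier_nonneg simp flip: left_diff_distrib)
  finally show "\<bar>conv F (mollifier n) z - F z\<bar> \<le> (LINT s|lborel. \<bar>F (z - s) - F z\<bar> * mollifier n s)" .
  have "bounded_borel (2 * M) (\<lambda>s. \<bar>F (z - s) - F z\<bar>)" unfolding bounded_borel_def
  proof (intro conjI allI)
    show "\<bar>\<bar>F (z - s) - F z\<bar>\<bar> \<le> 2 * M" for s using M[of "z - s"] M[of z] by linarith
  qed measurable
  then show "integrable lborel (\<lambda>s. \<bar>F (z - s) - F z\<bar> * mollifier n s)"
    by (rule bounded_borel_times_kernel_integrable[OF _ mollifier_kernels(1)])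
qed

lemma conv_bounded_borel:
  assumes F: "bounded_borel M F"
  shows "bounded_borel M (conv F (mollifier n))"
proof -
  have M: "\<And>z. \<bar>F z\<bar> \<le> M" using F by (auto simp: bounded_borel_def)
  have "\<bar>conv F (mollifier n) z\<bar> \<le> M" for z
  proof -
    have i: "integrable lborel (\<lambda>s. mollifier n (z - s))"
      by (intro lborel_integrable_minus_left kernel_integrable[OF mollifier_kernels(1)[of n]]) measurable
    have "\<bar>conv F (mollifier n) z\<bar> \<le> (LINT s|lborel. \<bar>F s * mollifier n (z - s)\<bar>)"
      unfolding conv_def by (rule integral_abs_bound)
    also have "\<dots> \<le> (LINT s|lborel. M * mollifier n (z - s))"
      using M i bounded_borel_nonneg[OF F]
      by (intro integral_mono_AE' AE_I2) (auto simp: abs_mult mollifier_nonneg mult_right_mono)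
    also have "\<dots> = M"
      by (simp add: lborel_integral_minus_left integral_mollifier)
    finally show ?thesis .
  qed
  moreover have "conv F (mollifier n) \<in> borel_measurable borel"
    by (intro borel_measurable_continuous_onI continuous_on_conv[OF F mollifier_kernels(1)])
  ultimately show ?thesis by (simp add: bounded_borel_def)
qed

text \<open>After Fubini the error is an average over \<open>s\<close> of the weighted translation
  errors of \<open>F\<close>, and only shifts \<open>s\<close> of norm at most
  \<open>2 / (n + 1)\<close> are charged.\<close>

lemma conv_mollifier_L1:
  assumes F: "bounded_borel M F"
  shows "(\<lambda>n. LINT z|lborel. wt z * \<bar>conv F (mollifier n) z - F z\<bar>) \<longlonglongrightarrow> 0"
proof (rule LIMSEQ_I)
  fix r :: real assume "r > 0"
  have [measurable]: "F \<in> borel_measurable borel" and M: "\<And>z. \<bar>F z\<bar> \<le> M"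
    using F by (auto simp: bounded_borel_def)
  have [measurable]: "conv F (mollifier n) \<in> borel_measurable borel" for n
    using conv_bounded_borel[OF F] by (auto simp: bounded_borel_def)
  obtain d where d: "d > 0" "\<And>s. norm s < d \<Longrightarrow> (LINT z|lborel. wt z * \<bar>F (z - s) - F z\<bar>) < r / 2"
    using translation_continuous_wt[OF F, of "r / 2"] \<open>r > 0\<close> by auto
  obtain N where N: "2 / real (Suc N) < d"
    using reals_Archimedean[of "d / 2"] d(1) by (auto simp: field_simps)
  show "\<exists>no. \<forall>n\<ge>no. norm ((LINT z|lborel. wt z * \<bar>conv F (mollifier n) z - F z\<bar>) - 0) < r"
  proof (intro exI allI impI)
    fix n assume "n \<ge> N"
    then have "2 / real (Suc n) \<le> 2 / real (Suc N)" by (intro divide_left_mono) auto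
    with N have n: "2 / real (Suc n) < d" by linarith
    have wi: "integrable lborel (\<lambda>z. wt z * \<bar>F (z - s) - F z\<bar>)" for s
      by (intro wt_diff_integrable[of M] bounded_borel_diff_right F)
    have "ennreal (LINT z|lborel. wt z * \<bar>conv F (mollifier n) z - F z\<bar>)
        \<le> (\<integral>\<^sup>+z. ennreal (wt z * \<bar>conv F (mollifier n) z - F z\<bar>) \<partial>lborel)"
      by (cases "integrable lborel (\<lambda>z. wt z * \<bar>conv F (mollifier n) z - F z\<bar>)")
        (auto simp: nn_integral_eq_integral less_imp_le[OF wt_pos] not_integrable_integral_eq)
    also have "\<dots> \<le> (\<integral>\<^sup>+z. (\<integral>\<^sup>+s. ennreal (wt z * \<bar>F (z - s) - F z\<bar> * mollifier n s) \<partial>lborel) \<partial>lborel)"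
    proof (rule nn_integral_mono)
      fix z
      have "wt z * \<bar>conv F (mollifier n) z - F z\<bar> \<le> (LINT s|lborel. wt z * (\<bar>F (z - s) - F z\<bar> * mollifier n s))"
        using conv_mollifier_diff_le(1)[OF F, of n z] wt_pos[of z] by simp
      moreover have "ennreal (LINT s|lborel. wt z * (\<bar>F (z - s) - F z\<bar> * mollifier n s))
        = (\<integral>\<^sup>+s. ennreal (wt z * (\<bar>F (z - s) - F z\<bar> * mollifier n s)) \<partial>lborel)"
        using conv_mollifier_diff_le(2)[OF F, of z n] wt_pos[of z] 
        by (intro nn_integral_eq_integral[symmetric]) (auto simp: mollifier_nonneg)
      ultimately show "ennreal (wt z * \<bar>conv F (mollifier n) z - F z\<bar>)
          \<le> (\<integral>\<^sup>+s. ennreal (wt z * \<bar>F (z - s) - F z\<bar> * mollifier n s) \<partial>lborel)"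
        by (metis (no_types, lifting) ennreal_leI mult.assoc nn_integral_cong)
    qed
    also have "\<dots> = (\<integral>\<^sup>+s. (\<integral>\<^sup>+z. ennreal (wt z * \<bar>F (z - s) - F z\<bar> * mollifier n s) \<partial>lborel) \<partial>lborel)"
      by (rule lborel_pair.Fubini') measurable
    also have "\<dots> \<le> (\<integral>\<^sup>+s. ennreal (r / 2 * mollifier n s) \<partial>lborel)"
    proof (rule nn_integral_mono)
      fix s :: "real \<times> real"
      show "(\<integral>\<^sup>+z. ennreal (wt z * \<bar>F (z - s) - F z\<bar> * mollifier n s) \<partial>lborel) \<le> ennreal (r / 2 * mollifier n s)"
      proof (cases "norm s < d")
        case True
        have "(\<integral>\<^sup>+z. ennreal (wt z * \<bar>F (z - s) - F z\<bar> * mollifier n s) \<partial>lborel)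
            = ennreal (LINT z|lborel. wt z * \<bar>F (z - s) - F z\<bar> * mollifier n s)"
          using wi by (intro nn_integral_eq_integral) (auto simp: mollifier_nonneg less_imp_le[OF wt_pos])
        also have "\<dots> \<le> ennreal (r / 2 * mollifier n s)"
          using mult_right_mono[OF less_imp_le[OF d(2)[OF True]] mollifier_nonneg[of n s]]
          by (auto intro!: ennreal_leI)
        finally show ?thesis .
      next
        case False
        then have "mollifier n s = 0"
          using n by (intro kernel_outside[OF mollifier_kernels(1)]) linarith
        then show ?thesis by simp
      qed
    qed
    also have "\<dots> = ennreal (r / 2)"
      using kernel_integrable[OF mollifier_kernels(1)[of n]] \<open>r > 0\<close>
      by (subst nn_integral_eq_integral) (auto simp: mollifier_nonneg integral_mollifier)
    finally have "(LINT z|lborel. wt z * \<bar>conv F (mollifier n) z - F z\<bar>) \<le> r / 2"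
      using \<open>r > 0\<close> by simp
    moreover have "(LINT z|lborel. wt z * \<bar>conv F (mollifier n) z - F z\<bar>) \<ge> 0"
      by (simp add: less_imp_le[OF wt_pos])
    ultimately show "norm ((LINT z|lborel. wt z * \<bar>conv F (mollifier n) z - F z\<bar>) - 0) < r"
      using \<open>r > 0\<close> by simp
  qed
qed

text \<open>The errors of all fields are summed before a subsequence is extracted, so that one
  subsequence serves the whole family; the weight is positive and can be divided out at each
  point.\<close>

lemma conv_mollifier_AE_subseq:
  assumes I: "finite I" and F: "\<And>i. i \<in> I \<Longrightarrow> bounded_borel M (F i)"
  obtains r :: "nat \<Rightarrow> nat" where "strict_mono r"
    "AE z in lborel. \<forall>i\<in>I. (\<lambda>n. conv (F i) (mollifier (r n)) z) \<longlonglongrightarrow> F i z"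
proof -
  define u where "u = (\<lambda>n z. \<Sum>i\<in>I. wt z * \<bar>conv (F i) (mollifier n) z - F i z\<bar>)"
  have int: "integrable lborel (\<lambda>z. wt z * \<bar>conv (F i) (mollifier n) z - F i z\<bar>)" if "i \<in> I" for i n
    by (intro wt_diff_integrable[of M] conv_bounded_borel F that)
  have u0: "u n z \<ge> 0" for n z
    unfolding u_def by (intro sum_nonneg) (simp add: less_imp_le[OF wt_pos])
  have "(\<lambda>n. \<Sum>i\<in>I. LINT z|lborel. wt z * \<bar>conv (F i) (mollifier n) z - F i z\<bar>) \<longlonglongrightarrow> (\<Sum>i\<in>I. 0)"
    by (intro tendsto_sum conv_mollifier_L1[OF F])
  then have "(\<lambda>n. LINT z|lborel. norm (u n z)) \<longlonglongrightarrow> 0"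
    using u0 int by (simp add: u_def)
  moreover have "integrable lborel (u n)" for n
    unfolding u_def using int by (intro Bochner_Integration.integrable_sum)
  ultimately obtain r :: "nat \<Rightarrow> nat" where r: "strict_mono r"
    and ae: "AE z in lborel. (\<lambda>n. u (r n) z) \<longlonglongrightarrow> 0"
    using tendsto_L1_AE_subseq[of lborel u] by blast
  from ae have "AE z in lborel. \<forall>i\<in>I. (\<lambda>n. conv (F i) (mollifier (r n)) z) \<longlonglongrightarrow> F i z"
  proof eventually_elim
    case (elim z)
    show ?case
    proof
      fix i assume i: "i \<in> I"
      have "(\<lambda>n. \<bar>conv (F i) (mollifier (r n)) z - F i z\<bar>) \<longlonglongrightarrow> 0"
      proof (rule tendsto_sandwich[OF _ _ tendsto_const])
        show "(\<lambda>n. u (r n) z / wt z) \<longlonglongrightarrow> 0"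
          using tendsto_divide[OF elim tendsto_const[of "wt z"]] wt_pos[of z] by simp
        have "wt z * \<bar>conv (F i) (mollifier (r n)) z - F i z\<bar> \<le> u (r n) z" for n
          unfolding u_def using wt_pos[of z] by (intro member_le_sum[OF i _ I]) simp
        then show "\<forall>\<^sub>F n in sequentially. \<bar>conv (F i) (mollifier (r n)) z - F i z\<bar> \<le> u (r n) z / wt z"
          using wt_pos[of z] by (simp add: field_simps)
      qed simp
      then show "(\<lambda>n. conv (F i) (mollifier (r n)) z) \<longlonglongrightarrow> F i z"
        by (simp add: LIM_zero_iff tendsto_rabs_zero_iff)
    qed
  qed
  with r show thesis by (rule that)
qed

section \<open>Weak divergence inequalities and the cone argument\<close>

definition C1 :: "(real \<times> real \<Rightarrow> real) \<Rightarrow> (real \<times> real \<Rightarrow> real) \<Rightarrow> (real \<times> real \<Rightarrow> real) \<Rightarrow> bool" where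
  "C1 f fy ft \<longleftrightarrow> continuous_on UNIV f \<and> continuous_on UNIV fy \<and> continuous_on UNIV ft \<and>
     has_dir_deriv f fy (1, 0) \<and> has_dir_deriv f ft (0, 1)"

lemma C1_mult:
  assumes "C1 f fy ft" "C1 g gy gt"
  shows "C1 (\<lambda>z. f z * g z) (\<lambda>z. fy z * g z + f z * gy z) (\<lambda>z. ft z * g z + f z * gt z)"
  using assms unfolding C1_def by (auto intro!: continuous_intros has_dir_deriv_mult)

lemma C1_conv:
  assumes "bounded_borel M F"
  shows "C1 (conv F (mollifier n)) (conv F (mollifier_y n)) (conv F (mollifier_t n))"
  unfolding C1_def
  using assms mollifier_kernels mollifier_dir_deriv
  by (blast intro: continuous_on_conv has_dir_deriv_conv)

lemma has_dir_deriv_outside: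
  fixes f :: "'a::euclidean_space \<Rightarrow> real"
  assumes d: "has_dir_deriv f f' e" and f: "\<And>z. norm z > R \<Longrightarrow> f z = 0" and z: "norm z > R"
  shows "f' z = 0"
proof -
  have d': "((\<lambda>h. f (z + h *\<^sub>R e)) has_real_derivative f' z) (at 0)"
    using d unfolding has_dir_deriv_def by blast
  have o: "open ((\<lambda>h. norm (z + h *\<^sub>R e)) -` {R<..})"
    by (intro open_vimage continuous_intros)
  have "((\<lambda>h. 0) has_real_derivative f' z) (at 0)"
    by (rule has_field_derivative_transform_within_open[OF d' o]) (use z f in auto)
  then show ?thesis using DERIV_unique[OF _ DERIV_const[of 0]] by blast
qed

lemma C1_kernels:
  assumes "C1 \<phi> \<phi>y \<phi>t" "\<And>z. norm z > R \<Longrightarrow> \<phi> z = 0"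
  shows "kernel R \<phi>" "kernel R \<phi>y" "kernel R \<phi>t"
  using assms has_dir_deriv_outside[of \<phi> _ _ R] unfolding C1_def kernel_def by blast+

lemma kernel_add: "kernel R f \<Longrightarrow> kernel R g \<Longrightarrow> kernel R (\<lambda>z. f z + g z)"
  unfolding kernel_def by (simp add: continuous_on_add)

lemma kernel_times:
  assumes "continuous_on UNIV f" "kernel R k"
  shows "kernel R (\<lambda>z. f z * k z)"
  using assms unfolding kernel_def by (auto intro!: continuous_intros)

lemma integral_by_parts_C1:
  assumes f: "C1 f fy ft" and \<phi>: "C1 \<phi> \<phi>y \<phi>t" "\<And>z. norm z > R \<Longrightarrow> \<phi> z = 0"
  shows "(LINT z|lborel. f z * \<phi>y z) = - (LINT z|lborel. fy z * \<phi> z)"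
    and "(LINT z|lborel. f z * \<phi>t z) = - (LINT z|lborel. ft z * \<phi> z)"
    and "integrable lborel (\<lambda>z. f z * \<phi>y z)" "integrable lborel (\<lambda>z. fy z * \<phi> z)"
    and "integrable lborel (\<lambda>z. f z * \<phi>t z)" "integrable lborel (\<lambda>z. ft z * \<phi> z)"
proof -
  note ker = C1_kernels[OF \<phi>]
  have k: "kernel R (\<lambda>z. f z * \<phi>y z)" "kernel R (\<lambda>z. fy z * \<phi> z)"
    "kernel R (\<lambda>z. f z * \<phi>t z)" "kernel R (\<lambda>z. ft z * \<phi> z)" "kernel R (\<lambda>z. f z * \<phi> z)"
    using f ker by (auto simp: C1_def intro!: kernel_times)
  note i = kernel_integrable[OF k(1)] kernel_integrable[OF k(2)] kernel_integrable[OF k(3)] kernel_integrable[OF k(4)]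
  show "integrable lborel (\<lambda>z. f z * \<phi>y z)" "integrable lborel (\<lambda>z. fy z * \<phi> z)"
    "integrable lborel (\<lambda>z. f z * \<phi>t z)" "integrable lborel (\<lambda>z. ft z * \<phi> z)"
    by (rule i)+
  have d: "has_dir_deriv (\<lambda>z. f z * \<phi> z) (\<lambda>z. fy z * \<phi> z + f z * \<phi>y z) (1, 0)"
    "has_dir_deriv (\<lambda>z. f z * \<phi> z) (\<lambda>z. ft z * \<phi> z + f z * \<phi>t z) (0, 1)"
    using f \<phi>(1) unfolding C1_def by (auto intro!: has_dir_deriv_mult)
  have "kernel R (\<lambda>z. fy z * \<phi> z + f z * \<phi>y z)" "kernel R (\<lambda>z. ft z * \<phi> z + f z * \<phi>t z)"
    by (intro kernel_add k)+
  from integral_dir_deriv_eq_0[OF k(5) this(1) d(1)] integral_dir_deriv_eq_0[OF k(5) this(2) d(2)]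
  show "(LINT z|lborel. f z * \<phi>y z) = - (LINT z|lborel. fy z * \<phi> z)"
    "(LINT z|lborel. f z * \<phi>t z) = - (LINT z|lborel. ft z * \<phi> z)"
    by (simp_all add: i)
qed

text \<open>The mollification of \<open>F_t + G_y\<close>, with the derivatives carried by the
  kernel; \<open>F\<close> is the density and \<open>G\<close> the flux.\<close>

abbreviation mollified_div ::
    "nat \<Rightarrow> (real \<times> real \<Rightarrow> real) \<Rightarrow> (real \<times> real \<Rightarrow> real) \<Rightarrow> real \<times> real \<Rightarrow> real" where
  "mollified_div n F G z \<equiv> conv F (mollifier_t n) z + conv G (mollifier_y n) z"

lemma conv_weak_divergence:
  assumes F: "bounded_borel M F" and G: "bounded_borel M G"
    and \<phi>: "C1 \<phi> \<phi>y \<phi>t" "\<And>z. norm z > R \<Longrightarrow> \<phi> z = 0"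
  shows "(LINT z|lborel. conv F (mollifier n) z * \<phi>t z + conv G (mollifier n) z * \<phi>y z)
     = - (LINT z|lborel. mollified_div n F G z * \<phi> z)"
  using integral_by_parts_C1[OF C1_conv[OF F, of n] \<phi>] integral_by_parts_C1[OF C1_conv[OF G, of n] \<phi>]
  by (simp add: distrib_right)

lemma weak_divergence_subseq:
  assumes F: "bounded_borel M F" and G: "bounded_borel M G"
    and \<phi>: "C1 \<phi> \<phi>y \<phi>t" "\<And>z. norm z > R \<Longrightarrow> \<phi> z = 0"
  obtains r :: "nat \<Rightarrow> nat" where "strict_mono r"
    "(\<lambda>n. - (LINT z|lborel. mollified_div (r n) F G z * \<phi> z))
      \<longlonglongrightarrow> (LINT z|lborel. F z * \<phi>t z + G z * \<phi>y z)"
proof -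
  note ker = C1_kernels[OF \<phi>]
  obtain r where r: "strict_mono r" and ae: "AE z in lborel. \<forall>H\<in>{F, G}. (\<lambda>n. conv H (mollifier (r n)) z) \<longlonglongrightarrow> H z"
    using conv_mollifier_AE_subseq[of "{F, G}" M "\<lambda>H. H"] F G by auto
  have [measurable]: "F \<in> borel_measurable borel" "G \<in> borel_measurable borel"
    "\<phi>t \<in> borel_measurable borel" "\<phi>y \<in> borel_measurable borel"
    "conv F (mollifier n) \<in> borel_measurable borel" "conv G (mollifier n) \<in> borel_measurable borel" for n
    using F G kernel_measurable[OF ker(2)] kernel_measurable[OF ker(3)] conv_bounded_borel[OF F] conv_bounded_borel[OF G]
    by (auto simp: bounded_borel_def)
  have "(\<lambda>n. LINT z|lborel. conv F (mollifier (r n)) z * \<phi>t z + conv G (mollifier (r n)) z * \<phi>y z)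
      \<longlonglongrightarrow> (LINT z|lborel. F z * \<phi>t z + G z * \<phi>y z)"
  proof (rule integral_dominated_convergence[where w = "\<lambda>z. M * \<bar>\<phi>t z\<bar> + M * \<bar>\<phi>y z\<bar>"])
    show "integrable lborel (\<lambda>z. M * \<bar>\<phi>t z\<bar> + M * \<bar>\<phi>y z\<bar>)"
      using kernel_integrable[OF ker(2)] kernel_integrable[OF ker(3)] by simp
    show "AE z in lborel. (\<lambda>n. conv F (mollifier (r n)) z * \<phi>t z + conv G (mollifier (r n)) z * \<phi>y z)
        \<longlonglongrightarrow> F z * \<phi>t z + G z * \<phi>y z"
      using ae by eventually_elim (auto intro!: tendsto_intros)
    show "AE z in lborel. norm (conv F (mollifier (r n)) z * \<phi>t z + conv G (mollifier (r n)) z * \<phi>y z)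
        \<le> M * \<bar>\<phi>t z\<bar> + M * \<bar>\<phi>y z\<bar>" for n
    proof (rule AE_I2)
      fix z
      have "\<bar>conv F (mollifier (r n)) z\<bar> \<le> M" "\<bar>conv G (mollifier (r n)) z\<bar> \<le> M"
        using conv_bounded_borel[OF F] conv_bounded_borel[OF G] unfolding bounded_borel_def by blast+
      then have "\<bar>conv F (mollifier (r n)) z * \<phi>t z\<bar> \<le> M * \<bar>\<phi>t z\<bar>" "\<bar>conv G (mollifier (r n)) z * \<phi>y z\<bar> \<le> M * \<bar>\<phi>y z\<bar>"
        by (auto simp: abs_mult intro!: mult_right_mono)
      then show "norm (conv F (mollifier (r n)) z * \<phi>t z + conv G (mollifier (r n)) z * \<phi>y z)
        \<le> M * \<bar>\<phi>t z\<bar> + M * \<bar>\<phi>y z\<bar>" unfolding real_norm_def by linarith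
    qed
  qed measurable
  then show thesis
    using that[OF r] conv_weak_divergence[OF F G \<phi>] by simp
qed

text \<open>Mollified fields satisfy the inequality classically, so integration by parts is
  legitimate against every \<open>C1\<close> test function, and the limit along a subsequence
  returns the weak form. The passage from smooth to \<open>C1\<close> tests matters because the cone
  functions below are not smooth.\<close>

lemma weak_inequality_C1:
  assumes F: "bounded_borel M F" and G: "bounded_borel M G"
    and le: "\<And>n z. mollified_div n F G z \<le> 0"
    and \<phi>: "C1 \<phi> \<phi>y \<phi>t" "\<And>z. norm z > R \<Longrightarrow> \<phi> z = 0" and nonneg: "\<And>z. \<phi> z \<ge> 0"
  shows "(LINT z|lborel. F z * \<phi>t z + G z * \<phi>y z) \<ge> 0"
proof -
  obtain r where "(\<lambda>n. - (LINT z|lborel. mollified_div (r n) F G z * \<phi> z))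
      \<longlonglongrightarrow> (LINT z|lborel. F z * \<phi>t z + G z * \<phi>y z)"
    using weak_divergence_subseq[OF F G \<phi>] by blast
  moreover have "- (LINT z|lborel. mollified_div (r n) F G z * \<phi> z) \<ge> 0" for n
  proof -
    have "(LINT z|lborel. - (mollified_div (r n) F G z * \<phi> z)) \<ge> 0"
      using le nonneg by (intro Bochner_Integration.integral_nonneg) (auto simp: mult_nonpos_nonneg)
    then show ?thesis by simp
  qed
  ultimately show ?thesis by (intro LIMSEQ_le_const) auto
qed

lemma weak_equation_C1:
  assumes F: "bounded_borel M F" and G: "bounded_borel M G"
    and eq: "\<And>n z. mollified_div n F G z = 0"
    and \<phi>: "C1 \<phi> \<phi>y \<phi>t" "\<And>z. norm z > R \<Longrightarrow> \<phi> z = 0"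
  shows "(LINT z|lborel. F z * \<phi>t z + G z * \<phi>y z) = 0"
proof -
  obtain r where "(\<lambda>n. - (LINT z|lborel. mollified_div (r n) F G z * \<phi> z))
      \<longlonglongrightarrow> (LINT z|lborel. F z * \<phi>t z + G z * \<phi>y z)"
    using weak_divergence_subseq[OF F G \<phi>] by blast
  then show ?thesis by (simp add: eq LIMSEQ_const_iff)
qed

section \<open>Backward cones and finite speed of propagation\<close>

definition sq_pos :: "real \<Rightarrow> real" where
  "sq_pos x = (max 0 x)\<^sup>2"

lemma sq_pos_deriv: "(sq_pos has_real_derivative 2 * max 0 x) (at x)"
proof -
  consider "x > 0" | "x < 0" | "x = 0" by linarith
  then show ?thesis
  proof cases
    case 1
    have "((\<lambda>x. x\<^sup>2) has_real_derivative 2 * max 0 x) (at x)"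
      using 1 by (auto intro!: derivative_eq_intros)
    then show ?thesis
      by (rule has_field_derivative_transform_within_open[where S = "{0<..}"])
        (use 1 in \<open>auto simp: sq_pos_def\<close>)
  next
    case 2
    have "((\<lambda>x. 0) has_real_derivative 2 * max 0 x) (at x)"
      using 2 by (auto intro!: derivative_eq_intros)
    then show ?thesis
      by (rule has_field_derivative_transform_within_open[where S = "{..<0}"])
        (use 2 in \<open>auto simp: sq_pos_def\<close>)
  next
    case 3
    have "((\<lambda>h. max 0 h * (if h > 0 then 1 else 0)) \<longlongrightarrow> 0) (at (0::real))"
    proof (rule tendsto_sandwich[OF _ _ tendsto_const])
      show "((\<lambda>h::real. max 0 h) \<longlongrightarrow> 0) (at 0)"
        by (rule tendsto_eq_intros | simp)+
    qed (auto simp: max_def)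
    moreover have "(sq_pos (0 + h) - sq_pos 0) / h = max 0 h * (if h > 0 then 1 else 0)" for h
      by (auto simp: sq_pos_def max_def power2_eq_square)
    ultimately show ?thesis using 3 by (simp add: DERIV_def)
  qed
qed

lemma sq_pos_nonneg: "sq_pos x \<ge> 0"
  by (simp add: sq_pos_def)

lemma continuous_sq_pos: "continuous_on A f \<Longrightarrow> continuous_on A (\<lambda>x. sq_pos (f x))"
  unfolding sq_pos_def by (intro continuous_intros)

text \<open>The first factor cuts off the past \<open>t < -1\<close>, where the fields of interest vanish; the second
  one is supported in a backward cone of slope \<open>1/K\<close> and is decreasing along all directions of speed
  less than \<open>K\<close>.\<close>

definition cone_test :: "real \<Rightarrow> real \<Rightarrow> real \<times> real \<Rightarrow> real" where
  "cone_test S K z = sq_pos (1 - sq_pos (- snd z)) * sq_pos (S - K * snd z - sqrt (1 + (fst z)\<^sup>2))"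

definition cone_test_y :: "real \<Rightarrow> real \<Rightarrow> real \<times> real \<Rightarrow> real" where
  "cone_test_y S K z = sq_pos (1 - sq_pos (- snd z)) *
     (2 * max 0 (S - K * snd z - sqrt (1 + (fst z)\<^sup>2)) * - (fst z / sqrt (1 + (fst z)\<^sup>2)))"

definition cone_test_t :: "real \<Rightarrow> real \<Rightarrow> real \<times> real \<Rightarrow> real" where
  "cone_test_t S K z =
     2 * max 0 (1 - sq_pos (- snd z)) * (2 * max 0 (- snd z)) * sq_pos (S - K * snd z - sqrt (1 + (fst z)\<^sup>2))
     + sq_pos (1 - sq_pos (- snd z)) * (2 * max 0 (S - K * snd z - sqrt (1 + (fst z)\<^sup>2)) * - K)"

lemma one_plus_square_pos: "1 + (y::real)\<^sup>2 > 0"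
  by (simp add: add_pos_nonneg)

lemma C1_cone_test: "C1 (cone_test S K) (cone_test_y S K) (cone_test_t S K)"
proof -
  have nz: "sqrt (1 + y\<^sup>2) \<noteq> 0" for y :: real
    using one_plus_square_pos[of y] by simp
  have y: "((\<lambda>y. sq_pos (S - K * t - sqrt (1 + y\<^sup>2))) has_real_derivative
      2 * max 0 (S - K * t - sqrt (1 + y\<^sup>2)) * - (y / sqrt (1 + y\<^sup>2))) (at y)" for y t
  proof (rule DERIV_chain2[OF sq_pos_deriv])
    have "((\<lambda>y. 1 + y\<^sup>2) has_real_derivative 2 * y) (at y)"
      by (auto intro!: derivative_eq_intros)
    from DERIV_chain2[where f = sqrt, OF DERIV_real_sqrt[OF one_plus_square_pos[of y]] this]
    have d: "((\<lambda>y. sqrt (1 + y\<^sup>2)) has_real_derivative y / sqrt (1 + y\<^sup>2)) (at y)"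
      by (rule DERIV_cong) (simp only: divide_inverse, simp)
    show "((\<lambda>y. S - K * t - sqrt (1 + y\<^sup>2)) has_real_derivative - (y / sqrt (1 + y\<^sup>2))) (at y)"
      using DERIV_diff[OF DERIV_const[of "S - K * t"] d] by simp
  qed
  have t: "((\<lambda>t. sq_pos (S - K * t - c)) has_real_derivative 2 * max 0 (S - K * t - c) * - K) (at t)" for t c
    by (rule DERIV_chain2[OF sq_pos_deriv]) (auto intro!: derivative_eq_intros)
  have t': "((\<lambda>t. sq_pos (- t)) has_real_derivative 2 * max 0 (- t) * (- 1)) (at t)" for t
    by (rule DERIV_chain2[OF sq_pos_deriv]) (auto intro!: derivative_eq_intros)
  have "((\<lambda>t. 1 - sq_pos (- t)) has_real_derivative 2 * max 0 (- t)) (at t)" for t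
    using DERIV_diff[OF DERIV_const[of 1] t'[of t]] by simp
  from DERIV_chain2[OF sq_pos_deriv this]
  have t'': "((\<lambda>t. sq_pos (1 - sq_pos (- t))) has_real_derivative
      2 * max 0 (1 - sq_pos (- t)) * (2 * max 0 (- t))) (at t)" for t .
  have "has_dir_deriv (cone_test S K) (cone_test_y S K) (1, 0)"
    unfolding has_dir_deriv_fst cone_test_def cone_test_y_def fst_conv snd_conv
    by (intro allI DERIV_cmult y)
  moreover have "has_dir_deriv (cone_test S K) (cone_test_t S K) (0, 1)"
    unfolding has_dir_deriv_snd cone_test_def cone_test_t_def fst_conv snd_conv
    by (intro allI DERIV_cong[OF DERIV_mult[OF t'' t]]) (simp only: mult_ac)
  moreover have "continuous_on UNIV (cone_test S K)" "continuous_on UNIV (cone_test_y S K)"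
    "continuous_on UNIV (cone_test_t S K)"
    unfolding cone_test_def cone_test_y_def cone_test_t_def
    using nz by (auto intro!: continuous_intros continuous_sq_pos)
  ultimately show ?thesis by (simp add: C1_def)
qed

text \<open>On the support the cut-off gives \<open>t > -1\<close>, hence \<open>|y| < S + K\<close>
  and \<open>|t| \<le> S + 1\<close>; the radius is the sum of these bounds.\<close>

lemma cone_test_outside:
  assumes "S \<ge> 0" "K \<ge> 1" "norm z > 2 * S + K + 1"
  shows "cone_test S K z = 0"
proof (rule ccontr)
  obtain y t where z: "z = (y, t)" by fastforce
  assume "cone_test S K z \<noteq> 0"
  then have 1: "1 - sq_pos (- t) > 0" and 2: "S - K * t - sqrt (1 + y\<^sup>2) > 0"
    by (auto simp: z cone_test_def sq_pos_def max_def not_le split: if_splits)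
  have t: "t > - 1"
  proof (rule ccontr)
    assume "\<not> t > - 1"
    then have "(- t) * (- t) \<ge> 1" using mult_mono[of 1 "- t" 1 "- t"] by simp
    with 1 \<open>\<not> t > - 1\<close> show False by (auto simp: sq_pos_def power2_eq_square max_def split: if_splits)
  qed
  have s: "\<bar>y\<bar> \<le> sqrt (1 + y\<^sup>2)" by (rule real_le_rsqrt) simp
  have "K * t > - K" using t assms(2) mult_strict_left_mono[of "- 1" t K] by simp
  then have y: "\<bar>y\<bar> < S + K" using s 2 by linarith
  have "K * t < S" using s 2 by linarith
  then have "t \<le> S"
    using assms(1,2) mult_right_mono[of 1 K t] by (cases "t \<ge> 0") auto
  then have "\<bar>t\<bar> \<le> S + 1" using t assms(1) by linarith
  with y have "norm z < 2 * S + K + 1"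
    using norm_Pair_le[of y t] by (simp add: z)
  with assms(3) show False by linarith
qed

text \<open>The test function decreases in time faster than the flux can compensate: the integrand
  is at most \<open>- m * h\<close>, where \<open>m\<close> is positive inside the cone, whereas its
  integral is nonnegative by assumption. The two signs force \<open>h = 0\<close> in each cone, and
  the cones exhaust the plane as \<open>S\<close> grows.\<close>

lemma cone_vanishing:
  fixes h q :: "real \<times> real \<Rightarrow> real"
  assumes [measurable]: "h \<in> borel_measurable borel" "q \<in> borel_measurable borel"
    and loc: "\<And>R. \<exists>C. \<forall>z. norm z \<le> R \<longrightarrow> \<bar>h z\<bar> \<le> C \<and> \<bar>q z\<bar> \<le> C"
    and nonneg: "AE z in lborel. h z \<ge> 0"
    and speed: "AE z in lborel. \<bar>q z\<bar> \<le> K * h z"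
    and past: "AE z in lborel. snd z < 0 \<longrightarrow> h z = 0"
    and weak: "\<And>\<phi> \<phi>y \<phi>t R. C1 \<phi> \<phi>y \<phi>t \<Longrightarrow> (\<And>z. norm z > R \<Longrightarrow> \<phi> z = 0) \<Longrightarrow> (\<And>z. \<phi> z \<ge> 0) \<Longrightarrow>
        (LINT z|lborel. h z * \<phi>t z + q z * \<phi>y z) \<ge> 0"
  shows "AE z in lborel. h z = 0"
proof -
  \<comment> \<open>One unit above the speed, so that \<open>K' * h - |q|\<close> keeps a full
    \<open>h\<close>. The maximum secures \<open>K' \<ge> 1\<close>, as required by
    \<open>cone_test_outside\<close>.\<close>
  define K' where "K' = max 0 K + 1"
  have K': "K' \<ge> 1" "K \<le> K' - 1" by (auto simp: K'_def)
  have S: "AE z in lborel. K' * snd z + sqrt (1 + (fst z)\<^sup>2) < real S \<longrightarrow> h z = 0" for S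
  proof -
    define R where "R = 2 * real S + K' + 1"
    have outside: "norm z > R \<Longrightarrow> cone_test (real S) K' z = 0" for z
      using K' by (auto simp: R_def intro!: cone_test_outside)
    note ker = C1_kernels[OF C1_cone_test outside]
    have [measurable]: "cone_test_t S K' \<in> borel_measurable borel" "cone_test_y S K' \<in> borel_measurable borel"
      using ker kernel_measurable by blast+
    define I where "I = (\<lambda>z. h z * cone_test_t S K' z + q z * cone_test_y S K' z)"
    have I0: "(LINT z|lborel. I z) \<ge> 0"
      unfolding I_def
      by (rule weak[OF C1_cone_test outside]) (auto simp: cone_test_def sq_pos_nonneg)
    have int: "integrable lborel I"
    proof -
      obtain C where C: "\<And>z. norm z \<le> R \<Longrightarrow> \<bar>h z\<bar> \<le> C \<and> \<bar>q z\<bar> \<le> C"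
        using loc[of R] by blast
      obtain A where A: "\<And>z. \<bar>cone_test_t S K' z\<bar> \<le> A"
        using kernel_bounded[OF ker(3)] by blast
      obtain B where B: "\<And>z. \<bar>cone_test_y S K' z\<bar> \<le> B"
        using kernel_bounded[OF ker(2)] by blast
      show ?thesis unfolding I_def
      proof (rule integrable_bounded_support[of _ R "C * A + C * B"])
        fix z :: "real \<times> real"
        assume z: "norm z \<le> R"
        have "\<bar>h z * cone_test_t S K' z\<bar> \<le> C * A" "\<bar>q z * cone_test_y S K' z\<bar> \<le> C * B"
          using C[OF z] A[of z] B[of z] by (auto simp: abs_mult intro!: mult_mono)
        then show "\<bar>h z * cone_test_t S K' z + q z * cone_test_y S K' z\<bar> \<le> C * A + C * B" by linarith
      qed (auto simp: kernel_outside[OF ker(2)] kernel_outside[OF ker(3)])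
    qed
    have I_le: "AE z in lborel. 2 * max 0 (S - K' * snd z - sqrt (1 + (fst z)\<^sup>2)) * h z \<le> - I z"
      using nonneg speed past
    proof eventually_elim
      case (elim z)
      define m where "m = 2 * max 0 (S - K' * snd z - sqrt (1 + (fst z)\<^sup>2))"
      define e where "e = fst z / sqrt (1 + (fst z)\<^sup>2)"
      have "m \<ge> 0" by (simp add: m_def)
      have "\<bar>fst z\<bar> \<le> sqrt (1 + (fst z)\<^sup>2)" by (rule real_le_rsqrt) simp
      then have e: "\<bar>e\<bar> \<le> 1"
        using one_plus_square_pos[of "fst z"] by (simp add: e_def abs_divide divide_le_eq)
      show ?case
      proof (cases "snd z < 0")
        case True
        with elim have "h z = 0" by blast
        with elim(2) have "q z = 0" by simp
        with \<open>h z = 0\<close> show ?thesis by (simp add: I_def)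
      next
        case False
        \<comment> \<open>For \<open>t \<ge> 0\<close> the cut-off of the past is identically 1, so
          only the cone factor is differentiated.\<close>
        then have "sq_pos (- snd z) = 0" "sq_pos (1 - sq_pos (- snd z)) = 1" "max 0 (- snd z) = 0"
          by (auto simp: sq_pos_def)
        then have "cone_test_t S K' z = m * - K'" "cone_test_y S K' z = m * - e"
          unfolding cone_test_t_def cone_test_y_def m_def e_def by (simp_all only: mult_zero_left mult_zero_right mult_1 add_0)
        then have I: "- I z = m * (K' * h z + q z * e)"
          by (simp add: I_def algebra_simps)
        have "\<bar>q z * e\<bar> \<le> \<bar>q z\<bar> * 1"
          unfolding abs_mult using e by (intro mult_left_mono) auto
        moreover have "K * h z \<le> (K' - 1) * h z"
          using elim(1) K'(2) by (intro mult_right_mono)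
        ultimately have "h z \<le> K' * h z + q z * e"
          using elim(2) by (simp add: left_diff_distrib)
        with \<open>m \<ge> 0\<close> show ?thesis unfolding I m_def[symmetric] by (rule mult_left_mono[rotated])
      qed
    qed
    have "AE z in lborel. 0 \<le> - I z"
      using I_le nonneg
    proof eventually_elim
      case (elim z)
      have "0 \<le> 2 * max 0 (S - K' * snd z - sqrt (1 + (fst z)\<^sup>2)) * h z"
        using elim(2) by simp
      then show ?case using elim(1) by linarith
    qed
    moreover from this have "(LINT z|lborel. - I z) \<ge> 0" by (rule integral_nonneg_AE)
    with I0 have "(LINT z|lborel. - I z) = 0" by simp
    ultimately have "AE z in lborel. - I z = 0"
      using integral_nonneg_eq_0_iff_AE[of lborel "\<lambda>z. - I z"] int by simp
    with I_le nonneg show ?thesis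
    proof eventually_elim
      case (elim z)
      show ?case
      proof
        assume "K' * snd z + sqrt (1 + (fst z)\<^sup>2) < real S"
        then have "max 0 (S - K' * snd z - sqrt (1 + (fst z)\<^sup>2)) > 0" by simp
        moreover have "2 * max 0 (S - K' * snd z - sqrt (1 + (fst z)\<^sup>2)) * h z \<le> 0"
          using elim by linarith
        ultimately show "h z = 0"
          using elim by (simp only: mult_le_0_iff) auto
      qed
    qed
  qed
  have "AE z in lborel. \<forall>S. K' * snd z + sqrt (1 + (fst z)\<^sup>2) < real S \<longrightarrow> h z = 0"
    unfolding AE_all_countable using S by blast
  then show ?thesis
    by eventually_elim (use reals_Archimedean2 in blast)
qed

section \<open>Lipschitz potentials of conserved fields\<close>

lemma conv_eq_0:
  assumes "kernel R k" "\<And>s. norm (z - s) \<le> R \<Longrightarrow> F s = 0"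
  shows "conv F k z = 0"
proof -
  have "F s * k (z - s) = 0" for s
    using assms(2)[of s] kernel_outside[OF assms(1), of "z - s"] by (cases "norm (z - s) \<le> R") auto
  then show ?thesis by (simp only: conv_def Bochner_Integration.integral_zero)
qed

lemma conv_mollifier_const:
  assumes "\<And>s. norm (z - s) \<le> 2 / real (Suc n) \<Longrightarrow> F s = c"
  shows "conv F (mollifier n) z = c"
proof -
  have "F s * mollifier n (z - s) = c * mollifier n (z - s)" for s
    using assms[of s] kernel_outside[OF mollifier_kernels(1), of n "z - s"]
    by (cases "norm (z - s) \<le> 2 / real (Suc n)") auto
  then have "conv F (mollifier n) z = (LINT s|lborel. c * mollifier n (z - s))"
    by (simp only: conv_def)
  also have "\<dots> = c"
    by (simp add: lborel_integral_minus_left integral_mollifier)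
  finally show ?thesis .
qed

lemma conv_lincomb:
  assumes "bounded_borel M F" "bounded_borel N G" "kernel R k"
  shows "conv (\<lambda>z. F z - c * G z) k z = conv F k z - c * conv G k z"
  using conv_integrable[OF assms(1,3)] conv_integrable[OF assms(2,3)]
  by (simp add: conv_def left_diff_distrib mult.assoc)

lemma bounded_borel_mult:
  "bounded_borel M F \<Longrightarrow> bounded_borel N G \<Longrightarrow> bounded_borel (M * N) (\<lambda>z. F z * G z)"
  using bounded_borel_nonneg[of M F]
  unfolding bounded_borel_def by (auto simp: abs_mult intro!: mult_mono)

lemma bounded_borel_const: "bounded_borel \<bar>c\<bar> (\<lambda>z. c)"
  by (simp add: bounded_borel_def)

lemma bounded_borel_diff:
  "bounded_borel M F \<Longrightarrow> bounded_borel N G \<Longrightarrow> bounded_borel (M + N) (\<lambda>z. F z - G z)"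
  unfolding bounded_borel_def by (auto intro!: order_trans[OF abs_triangle_ineq4] add_mono)

lemma bounded_borel_mono: "bounded_borel M F \<Longrightarrow> M \<le> N \<Longrightarrow> bounded_borel N F"
  unfolding bounded_borel_def using order_trans by blast

lemma C1_diff_cmult:
  assumes "C1 f fy ft" "C1 g gy gt"
  shows "C1 (\<lambda>z. f z - c * g z) (\<lambda>z. fy z - c * gy z) (\<lambda>z. ft z - c * gt z)"
  using assms unfolding C1_def has_dir_deriv_def
  by (auto intro!: continuous_intros derivative_eq_intros)

lemma dir_deriv_bounded_lipschitz:
  assumes "has_dir_deriv f fy (1, 0)" "has_dir_deriv f ft (0, 1)"
    and "\<And>z. \<bar>fy z\<bar> \<le> M" "\<And>z. \<bar>ft z\<bar> \<le> M"
  shows "\<bar>f z - f z'\<bar> \<le> M * (\<bar>fst z - fst z'\<bar> + \<bar>snd z - snd (z' :: real \<times> real)\<bar>)"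
proof -
  have 1: "\<bar>f ((fst z', snd z) + (fst z - fst z') *\<^sub>R (1, 0)) - f (fst z', snd z)\<bar> \<le> M * \<bar>fst z - fst z'\<bar>"
    by (rule kernel_diff_quotient_bound[OF assms(1,3)])
  have 2: "\<bar>f (z' + (snd z - snd z') *\<^sub>R (0, 1)) - f z'\<bar> \<le> M * \<bar>snd z - snd z'\<bar>"
    by (rule kernel_diff_quotient_bound[OF assms(2,4)])
  have "(fst z', snd z) + (fst z - fst z') *\<^sub>R (1, 0) = z" "z' + (snd z - snd z') *\<^sub>R (0, 1) = (fst z', snd z)"
    by (simp_all add: prod_eq_iff)
  with 1 2 show ?thesis by (simp add: distrib_left)
qed

lemma dir_deriv_bounded_continuous:
  assumes "has_dir_deriv f fy (1, 0)" "has_dir_deriv f ft (0, 1)"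
    and "\<And>z. \<bar>fy z\<bar> \<le> M" "\<And>z. \<bar>ft z\<bar> \<le> M"
  shows "continuous_on UNIV (f :: real \<times> real \<Rightarrow> real)"
proof (rule continuous_at_imp_continuous_on, rule ballI)
  fix z
  have "((\<lambda>x. f x - f z) \<longlongrightarrow> 0) (at z)"
  proof (rule Lim_null_comparison)
    show "\<forall>\<^sub>F x in at z. norm (f x - f z) \<le> M * (\<bar>fst x - fst z\<bar> + \<bar>snd x - snd z\<bar>)"
      using dir_deriv_bounded_lipschitz[OF assms] by simp
    have "((\<lambda>x. M * (\<bar>fst x - fst z\<bar> + \<bar>snd x - snd z\<bar>)) \<longlongrightarrow> M * (\<bar>fst z - fst z\<bar> + \<bar>snd z - snd z\<bar>)) (at z)"
      by (intro tendsto_intros)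
    then show "((\<lambda>x. M * (\<bar>fst x - fst z\<bar> + \<bar>snd x - snd z\<bar>)) \<longlongrightarrow> 0) (at z)" by simp
  qed
  then show "isCont f z" by (simp add: isCont_def LIM_zero_iff)
qed

text \<open>For \<open>x < c\<close> the interval is empty and the integral is 0 by convention,
  which agrees with the true antiderivative because \<open>f\<close> vanishes there. The margin 1
  beyond \<open>c\<close> makes the two descriptions overlap, so the point \<open>c\<close> is
  covered too.\<close>

lemma integral_from_past_has_derivative:
  fixes f :: "real \<Rightarrow> real"
  assumes cont: "continuous_on UNIV f" and past: "\<And>x. x < c + 1 \<Longrightarrow> f x = 0"
  shows "((\<lambda>x. integral {c..x} f) has_real_derivative f x) (at x)"
proof (cases "x > c")
  case True
  have "((\<lambda>x. integral {c..x} f) has_real_derivative f x) (at x within {c..x + 1})"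
    using True by (intro integral_has_real_derivative continuous_on_subset[OF cont]) auto
  moreover have "at x within {c..x + 1} = at x"
    using True by (intro at_within_Icc_at) auto
  ultimately show ?thesis by simp
next
  case False
  have "((\<lambda>x. 0) has_real_derivative f x) (at x)"
    using past[of x] False by simp
  then show ?thesis
  proof (rule has_field_derivative_transform_within_open[where S = "{..<c + 1}"])
    show "0 = integral {c..x'} f" if "x' \<in> {..<c + 1}" for x'
      using that past integral_cong[of "{c..x'}" f "\<lambda>_. 0"] by simp
  qed (use False in auto)
qed

lemma continuous_on_slice: "continuous_on UNIV g \<Longrightarrow> continuous_on S (\<lambda>t. g (y, t))"
  by (rule continuous_on_compose2[of UNIV g]) (auto intro!: continuous_intros)

text \<open>A divergence free pair \<open>(F, G)\<close> has the form \<open>(P_y, - P_t)\<close>.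
  The time derivative is built into the integral; in \<open>y\<close>, differentiation under the
  integral and \<open>G_y = - F_t\<close> turn the value of \<open>F\<close> at time -3 into its
  value at time \<open>t\<close>. The base time is -3 because the mollified \<open>G\<close>
  vanishes for \<open>t < -2\<close>.\<close>

lemma potential_C1:
  fixes F G :: "real \<times> real \<Rightarrow> real"
  assumes F: "bounded_borel M F" and G: "bounded_borel M G"
    and eq: "\<And>z. mollified_div n F G z = 0"
    and past: "\<And>z. snd z < 0 \<Longrightarrow> G z = 0"
    and A: "\<And>y. (A has_real_derivative conv F (mollifier n) (y, - 3)) (at y)"
  shows "C1 (\<lambda>z. A (fst z) - integral {- 3..snd z} (\<lambda>\<tau>. conv G (mollifier n) (fst z, \<tau>)))
    (conv F (mollifier n)) (\<lambda>z. - conv G (mollifier n) z)"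
proof -
  note CF = C1_conv[OF F, of n] and CG = C1_conv[OF G, of n]
  have le2: "2 / real (Suc n) \<le> 2" by (simp add: divide_le_eq)
  have past_G: "conv G k z = 0" if "kernel (2 / real (Suc n)) k" "snd z < - 2" for k z
  proof (rule conv_eq_0[OF that(1)])
    fix s assume "norm (z - s) \<le> 2 / real (Suc n)"
    then have "norm (z - s) \<le> 2" using le2 by linarith
    moreover have "\<bar>snd (z - s)\<bar> \<le> norm (z - s)"
      using norm_snd_le[of "snd (z - s)" "fst (z - s)"] unfolding prod.collapse real_norm_def .
    ultimately show "G s = 0" using that(2) by (intro past) (simp add: snd_diff)
  qed
  have contG: "continuous_on S (\<lambda>\<tau>. conv G (mollifier n) (y, \<tau>))" for y S
    using CG by (auto simp: C1_def intro: continuous_on_slice)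
  have conty: "continuous_on S (\<lambda>\<tau>. conv G (mollifier_y n) (y, \<tau>))" for y S
    using CG by (auto simp: C1_def intro: continuous_on_slice)
  have dt: "has_dir_deriv (\<lambda>z. A (fst z) - integral {- 3..snd z} (\<lambda>\<tau>. conv G (mollifier n) (fst z, \<tau>)))
      (\<lambda>z. - conv G (mollifier n) z) (0, 1)"
    unfolding has_dir_deriv_snd fst_conv snd_conv
  proof (intro allI)
    fix y t
    have "((\<lambda>t. integral {- 3..t} (\<lambda>\<tau>. conv G (mollifier n) (y, \<tau>))) has_real_derivative
        conv G (mollifier n) (y, t)) (at t)"
      by (intro integral_from_past_has_derivative contG past_G mollifier_kernels) simp
    from DERIV_diff[OF DERIV_const this]
    show "((\<lambda>t. A y - integral {- 3..t} (\<lambda>\<tau>. conv G (mollifier n) (y, \<tau>))) has_real_derivative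
        - conv G (mollifier n) (y, t)) (at t)" by simp
  qed
  have dy: "has_dir_deriv (\<lambda>z. A (fst z) - integral {- 3..snd z} (\<lambda>\<tau>. conv G (mollifier n) (fst z, \<tau>)))
      (conv F (mollifier n)) (1, 0)"
    unfolding has_dir_deriv_fst fst_conv snd_conv
  proof (intro allI)
    fix y t
    have dF: "((\<lambda>t. conv F (mollifier n) (y, t)) has_real_derivative - conv G (mollifier_y n) (y, \<tau>)) (at \<tau>)" for \<tau>
    proof -
      have "((\<lambda>t. conv F (mollifier n) (y, t)) has_real_derivative conv F (mollifier_t n) (y, \<tau>)) (at \<tau>)"
        using CF unfolding C1_def has_dir_deriv_snd by blast
      moreover have "conv F (mollifier_t n) (y, \<tau>) = - conv G (mollifier_y n) (y, \<tau>)"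
        using eq[of "(y, \<tau>)"] by linarith
      ultimately show ?thesis by simp
    qed
    have "((\<lambda>y. integral (cbox (- 3) t) (\<lambda>\<tau>. conv G (mollifier n) (y, \<tau>))) has_real_derivative
        integral (cbox (- 3) t) (\<lambda>\<tau>. conv G (mollifier_y n) (y, \<tau>))) (at y within UNIV)"
    proof (rule leibniz_rule_field_derivative)
      show "((\<lambda>x. conv G (mollifier n) (x, \<tau>)) has_real_derivative conv G (mollifier_y n) (x, \<tau>)) (at x within UNIV)"
        for x \<tau> using CG unfolding C1_def has_dir_deriv_fst by blast
      show "(\<lambda>\<tau>. conv G (mollifier n) (x, \<tau>)) integrable_on cbox (- 3) t" for x
        by (intro integrable_continuous contG)
      show "continuous_on (UNIV \<times> cbox (- 3) t) (\<lambda>(x, \<tau>). conv G (mollifier_y n) (x, \<tau>))"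
        using CG continuous_on_subset unfolding C1_def by (auto simp: case_prod_eta)
    qed auto
    from DERIV_diff[OF A this[unfolded cbox_interval]]
    have d: "((\<lambda>y. A y - integral {- 3..t} (\<lambda>\<tau>. conv G (mollifier n) (y, \<tau>))) has_real_derivative
        conv F (mollifier n) (y, - 3) - integral {- 3..t} (\<lambda>\<tau>. conv G (mollifier_y n) (y, \<tau>))) (at y)" .
    have "conv F (mollifier n) (y, - 3) - integral {- 3..t} (\<lambda>\<tau>. conv G (mollifier_y n) (y, \<tau>))
        = conv F (mollifier n) (y, t)"
    proof (cases "t \<ge> - 3")
      case True
      have "((\<lambda>\<tau>. - conv G (mollifier_y n) (y, \<tau>)) has_integral
          conv F (mollifier n) (y, t) - conv F (mollifier n) (y, - 3)) {- 3..t}"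
        using True dF by (intro fundamental_theorem_of_calculus)
          (auto intro: has_field_derivative_at_within simp flip: has_real_derivative_iff_has_vector_derivative)
      from integral_unique[OF this] show ?thesis by simp
    next
      \<comment> \<open>For \<open>t < -3\<close> the integral is empty, and the identity holds
        because the mollified \<open>F\<close> is constant in time before -2.\<close>
      case False
      have "((\<lambda>\<tau>. - conv G (mollifier_y n) (y, \<tau>)) has_integral
          conv F (mollifier n) (y, - 3) - conv F (mollifier n) (y, t)) {t..- 3}"
        using False dF by (intro fundamental_theorem_of_calculus)
          (auto intro: has_field_derivative_at_within simp flip: has_real_derivative_iff_has_vector_derivative)
      from integral_unique[OF this]
      have "conv F (mollifier n) (y, - 3) - conv F (mollifier n) (y, t)
          = integral {t..- 3} (\<lambda>\<tau>. - conv G (mollifier_y n) (y, \<tau>))" by simp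
      also have "\<dots> = integral {t..- 3} (\<lambda>\<tau>. 0)"
        by (intro integral_cong) (auto intro!: past_G mollifier_kernels)
      finally show ?thesis using False by simp
    qed
    with d show "((\<lambda>y. A y - integral {- 3..t} (\<lambda>\<tau>. conv G (mollifier n) (y, \<tau>))) has_real_derivative
        conv F (mollifier n) (y, t)) (at y)" by simp
  qed
  have b: "\<bar>conv F (mollifier n) z\<bar> \<le> M" "\<bar>- conv G (mollifier n) z\<bar> \<le> M" for z
    using conv_bounded_borel[OF F] conv_bounded_borel[OF G] unfolding bounded_borel_def abs_minus_cancel by blast+
  show ?thesis
    unfolding C1_def
    \<comment> \<open>Joint continuity is read off from the bounded partial derivatives rather than
      from the formula.\<close>
    using dir_deriv_bounded_continuous[OF dy dt b] dt dy CF CG by (auto simp: C1_def intro!: continuous_intros)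
qed

lemma indicator_integral_eq:
  fixes f :: "real \<Rightarrow> real"
  assumes "continuous_on {c..x} f"
  shows "integral {c..x} f = (LINT s|lborel. indicator {c..x} s * f s)"
  using set_borel_integral_eq_integral(2)[OF borel_integrable_atLeastAtMost'[OF assms]]
  by (simp add: set_lebesgue_integral_def)

lemma indicator_integral_tendsto:
  fixes f :: "nat \<Rightarrow> real \<Rightarrow> real"
  assumes f: "\<And>n. continuous_on UNIV (f n)" and [measurable]: "g \<in> borel_measurable borel"
    and b: "\<And>n x. \<bar>f n x\<bar> \<le> M" and lim: "AE x in lborel. (\<lambda>n. f n x) \<longlonglongrightarrow> g x"
  shows "(\<lambda>n. integral {c..x} (f n)) \<longlonglongrightarrow> (LINT s|lborel. indicator {c..x} s * g s)"
proof -
  have [measurable]: "f n \<in> borel_measurable borel" for n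
    by (intro borel_measurable_continuous_onI f)
  have "(\<lambda>n. LINT s|lborel. indicator {c..x} s * f n s) \<longlonglongrightarrow> (LINT s|lborel. indicator {c..x} s * g s)"
  proof (rule integral_dominated_convergence[where w = "\<lambda>s. indicator {c..x} s * M"])
    show "integrable lborel (\<lambda>s. indicator {c..x} s * M)"
      by (intro integrable_mult_left integrable_real_indicator) (auto simp: emeasure_lborel_Icc_eq)
    show "AE s in lborel. (\<lambda>n. indicator {c..x} s * f n s) \<longlonglongrightarrow> indicator {c..x} s * g s"
      using lim by eventually_elim (auto intro!: tendsto_intros)
    show "AE s in lborel. norm (indicator {c..x} s * f n s) \<le> indicator {c..x} s * M" for n
      using b by (auto simp: indicator_def)
  qed measurable
  then show ?thesis
    using indicator_integral_eq continuous_on_subset[OF f] by simp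
qed

text \<open>Limit of the time integrals of the mollified fluxes. As a Lebesgue integral it makes
  sense for every merely bounded Borel \<open>G\<close>.\<close>

definition time_integral :: "(real \<times> real \<Rightarrow> real) \<Rightarrow> real \<times> real \<Rightarrow> real" where
  "time_integral G z = (LINT \<tau>|lborel. indicator {- 3..snd z} \<tau> * G (fst z, \<tau>))"

lemma time_integral_measurable:
  assumes [measurable]: "G \<in> borel_measurable borel"
  shows "time_integral G \<in> borel_measurable borel"
proof -
  have [measurable]: "G \<in> borel_measurable (borel \<Otimes>\<^sub>M borel)"
    using assms by (simp add: borel_prod)
  have "(\<lambda>z. LINT \<tau>|lborel. indicator {x. - 3 \<le> x \<and> x \<le> snd z} \<tau> * G (fst z, \<tau>)) \<in> borel_measurable (borel \<Otimes>\<^sub>M borel)"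
    by measurable
  then show ?thesis
    by (simp add: borel_prod time_integral_def[abs_def] atLeastAtMost_def atLeast_def atMost_def Int_def)
qed

lemma time_integral_bound:
  assumes G: "bounded_borel M G"
  shows "\<bar>time_integral G z\<bar> \<le> M * (\<bar>snd z\<bar> + 3)"
proof -
  have [measurable]: "G \<in> borel_measurable (borel \<Otimes>\<^sub>M borel)" and M: "\<And>z. \<bar>G z\<bar> \<le> M"
    using G by (auto simp: bounded_borel_def borel_prod)
  have i: "integrable lborel (\<lambda>\<tau>. indicator {- 3..snd z} \<tau> * M)"
    by (intro integrable_mult_left integrable_real_indicator) (auto simp: emeasure_lborel_Icc_eq)
  have "\<bar>time_integral G z\<bar> \<le> (LINT \<tau>|lborel. \<bar>indicator {- 3..snd z} \<tau> * G (fst z, \<tau>)\<bar>)"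
    unfolding time_integral_def by (rule integral_abs_bound)
  also have "\<dots> \<le> (LINT \<tau>|lborel. indicator {- 3..snd z} \<tau> * M)"
    using M bounded_borel_nonneg[OF G] by (intro integral_mono_AE' i AE_I2) (auto simp: indicator_def abs_mult)
  also have "\<dots> = measure lborel {- 3..snd z} * M" by simp
  also have "\<dots> \<le> (\<bar>snd z\<bar> + 3) * M"
    using bounded_borel_nonneg[OF G] by (intro mult_right_mono) (auto simp: measure_def emeasure_lborel_Icc_eq)
  finally show ?thesis by (simp add: mult.commute)
qed

lemma time_integral_past:
  assumes "\<And>z. snd z < 0 \<Longrightarrow> G z = 0" "snd z < 0"
  shows "time_integral G z = 0"
proof -
  have "indicator {- 3..snd z} \<tau> * G (fst z, \<tau>) = 0" for \<tau>
    using assms by (auto simp: indicator_def)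
  then show ?thesis by (simp only: time_integral_def Bochner_Integration.integral_zero)
qed

text \<open>For almost every \<open>y\<close> the fields converge at almost every time by Fubini,
  which yields convergence of the time integrals for every \<open>t\<close>; the exceptional set
  lies in \<open>y\<close> alone.\<close>

lemma time_integral_tendsto:
  assumes G: "bounded_borel M G"
    and lim: "AE z in lborel. (\<lambda>n. conv G (mollifier (r n)) z) \<longlonglongrightarrow> G z"
  shows "AE y in lborel. \<forall>t. (\<lambda>n. integral {- 3..t} (\<lambda>\<tau>. conv G (mollifier (r n)) (y, \<tau>)))
      \<longlonglongrightarrow> time_integral G (y, t)"
proof -
  have "AE y in lborel. AE \<tau> in lborel. (\<lambda>n. conv G (mollifier (r n)) (y, \<tau>)) \<longlonglongrightarrow> G (y, \<tau>)"
    by (rule lborel_pair.AE_pair) (use lim in \<open>simp only: lborel_prod\<close>)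
  then show ?thesis
  proof eventually_elim
    case (elim y)
    have [measurable]: "G \<in> borel_measurable (borel \<Otimes>\<^sub>M borel)"
      using G by (auto simp: bounded_borel_def borel_prod)
    show ?case unfolding time_integral_def fst_conv snd_conv
    proof (intro allI indicator_integral_tendsto[where M = M] elim)
      show "continuous_on UNIV (\<lambda>\<tau>. conv G (mollifier (r n)) (y, \<tau>))" for n
        using C1_conv[OF G, of "r n"] by (auto simp: C1_def intro: continuous_on_slice)
      show "\<bar>conv G (mollifier (r n)) (y, \<tau>)\<bar> \<le> M" for n \<tau>
        using conv_bounded_borel[OF G] unfolding bounded_borel_def by blast
    qed measurable
  qed
qed

lemma AE_plane_from_fst:
  fixes P :: "real \<times> real \<Rightarrow> bool"
  assumes ae: "AE y in lborel. \<forall>t. P (y, t)"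
  shows "AE z in lborel. P z"
proof -
  obtain N where N: "{y. \<not> (\<forall>t. P (y, t))} \<subseteq> N" "N \<in> null_sets lborel"
    using ae by (auto simp: eventually_ae_filter)
  have "N \<times> (UNIV :: real set) \<in> null_sets (lborel \<Otimes>\<^sub>M lborel)"
    using N(2) by (auto simp: null_sets_def lborel.emeasure_pair_measure_Times)
  then have "AE z in lborel. z \<notin> N \<times> (UNIV :: real set)"
    unfolding lborel_prod by (rule AE_not_in)
  then show ?thesis
    by eventually_elim (use N(1) in fastforce)
qed

text \<open>Uniform in the sequence index on each ball, the form needed for dominated convergence on
  a fixed support. A single function is treated as a constant sequence.\<close>

definition locally_bounded :: "(nat \<Rightarrow> 'a::real_normed_vector \<Rightarrow> real) \<Rightarrow> bool" where
  "locally_bounded f \<longleftrightarrow> (\<forall>R. \<exists>C. \<forall>n z. norm z \<le> R \<longrightarrow> \<bar>f n z\<bar> \<le> C)"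

lemma locally_bounded_mult:
  assumes "locally_bounded f" "locally_bounded g"
  shows "locally_bounded (\<lambda>n z. f n z * g n z)"
  unfolding locally_bounded_def
proof
  fix R
  obtain C D where C: "\<And>n z. norm z \<le> R \<Longrightarrow> \<bar>f n z\<bar> \<le> C" and D: "\<And>n z. norm z \<le> R \<Longrightarrow> \<bar>g n z\<bar> \<le> D"
    using assms unfolding locally_bounded_def by metis
  have "\<bar>f n z * g n z\<bar> \<le> \<bar>C\<bar> * \<bar>D\<bar>" if "norm z \<le> R" for n z
    unfolding abs_mult using C[OF that, of n] D[OF that, of n] by (intro mult_mono) auto
  then show "\<exists>C. \<forall>n z. norm z \<le> R \<longrightarrow> \<bar>f n z * g n z\<bar> \<le> C" by blast
qed

lemma locally_bounded_add:
  assumes "locally_bounded f" "locally_bounded g"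
  shows "locally_bounded (\<lambda>n z. f n z + g n z)"
  unfolding locally_bounded_def
proof
  fix R
  obtain C D where C: "\<And>n z. norm z \<le> R \<Longrightarrow> \<bar>f n z\<bar> \<le> C" and D: "\<And>n z. norm z \<le> R \<Longrightarrow> \<bar>g n z\<bar> \<le> D"
    using assms unfolding locally_bounded_def by metis
  have "\<bar>f n z + g n z\<bar> \<le> C + D" if "norm z \<le> R" for n z
    using C[OF that, of n] D[OF that, of n] by linarith
  then show "\<exists>C. \<forall>n z. norm z \<le> R \<longrightarrow> \<bar>f n z + g n z\<bar> \<le> C" by blast
qed

lemma locally_bounded_bounded: "(\<And>n. bounded_borel M (f n)) \<Longrightarrow> locally_bounded f"
  unfolding locally_bounded_def bounded_borel_def by blast

lemma locally_bounded_kernel: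
  assumes "kernel R (k :: 'a::euclidean_space \<Rightarrow> real)"
  shows "locally_bounded (\<lambda>_. k)"
  using kernel_bounded[OF assms] unfolding locally_bounded_def by metis

lemma locally_bounded_uminus: "locally_bounded f \<Longrightarrow> locally_bounded (\<lambda>n z. - f n z)"
  by (simp add: locally_bounded_def)

lemma locally_bounded_const: "locally_bounded (\<lambda>_ _. c)"
  unfolding locally_bounded_def by blast

lemma locally_bounded_diff:
  "locally_bounded f \<Longrightarrow> locally_bounded g \<Longrightarrow> locally_bounded (\<lambda>n z. f n z - g n z)"
  using locally_bounded_add[of f "\<lambda>n z. - g n z"] locally_bounded_uminus[of g] by simp

lemma locally_bounded_dominated:
  fixes f :: "nat \<Rightarrow> 'a::euclidean_space \<Rightarrow> real"
  assumes lb: "locally_bounded f" and [measurable]: "\<And>n. f n \<in> borel_measurable borel" "g \<in> borel_measurable borel"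
    and supp: "\<And>n z. norm z > R \<Longrightarrow> f n z = 0"
    and lim: "AE z in lborel. (\<lambda>n. f n z) \<longlonglongrightarrow> g z"
  shows "(\<lambda>n. LINT z|lborel. f n z) \<longlonglongrightarrow> (LINT z|lborel. g z)"
proof -
  obtain C where C: "\<And>n z. norm z \<le> R \<Longrightarrow> \<bar>f n z\<bar> \<le> C"
    using lb unfolding locally_bounded_def by metis
  show ?thesis
  proof (rule integral_dominated_convergence[where w = "\<lambda>z. indicator (cball 0 R) z * C"])
    show "integrable lborel (\<lambda>z::'a. indicator (cball 0 R) z * C)"
      by (intro integrable_mult_left integrable_real_indicator emeasure_bounded_finite) auto
    show "AE z in lborel. norm (f n z) \<le> indicator (cball 0 R) z * C" for n
      using C supp by (auto simp: indicator_def not_le)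
  qed (use lim in auto)
qed

lemma C1_reflect:
  assumes "C1 f fy ft"
  shows "C1 (\<lambda>s. f (z - s)) (\<lambda>s. - fy (z - s)) (\<lambda>s. - ft (z - s))"
proof -
  have d: "has_dir_deriv (\<lambda>s. g (z - s)) (\<lambda>s. - g' (z - s)) e"
    if "has_dir_deriv g g' e" for g g' :: "real \<times> real \<Rightarrow> real" and e
    unfolding has_dir_deriv_def
  proof
    fix s
    have "((\<lambda>h. g ((z - s) + h *\<^sub>R e)) has_real_derivative g' (z - s)) (at (- 0))"
      using that[unfolded has_dir_deriv_def, rule_format, of "z - s"] by (simp only: minus_zero)
    then show "((\<lambda>h. g (z - (s + h *\<^sub>R e))) has_real_derivative - g' (z - s)) (at 0)"
      unfolding DERIV_mirror by (simp add: algebra_simps)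
  qed
  have c: "continuous_on UNIV (\<lambda>s. g (z - s))" if "continuous_on UNIV g" for g :: "real \<times> real \<Rightarrow> real"
    by (rule continuous_on_compose2[OF that]) (auto intro!: continuous_intros)
  show ?thesis using assms unfolding C1_def by (auto intro!: c d continuous_on_minus)
qed

text \<open>Bounded partial derivatives spread a bound at the single point \<open>zb\<close> to
  every ball; potentials grow at most linearly.\<close>

lemma locally_bounded_C1:
  assumes "\<And>n. C1 (f n) (fy n) (ft n)" "\<And>n. bounded_borel M (fy n)" "\<And>n. bounded_borel M (ft n)"
    and "\<And>n. \<bar>f n zb\<bar> \<le> C"
  shows "locally_bounded f"
  unfolding locally_bounded_def
proof
  fix R
  have "\<bar>f n z\<bar> \<le> C + M * (2 * (R + norm zb))" if z: "norm z \<le> R" for n z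
  proof -
    have "\<bar>f n z - f n zb\<bar> \<le> M * (\<bar>fst z - fst zb\<bar> + \<bar>snd z - snd zb\<bar>)"
      using assms(1)[of n] assms(2,3)[of n] unfolding C1_def bounded_borel_def
      by (intro dir_deriv_bounded_lipschitz) blast+
    also have "\<dots> \<le> M * (2 * (R + norm zb))"
    proof (intro mult_left_mono)
      have "norm (z - zb) \<le> R + norm zb" using z norm_triangle_ineq4[of z zb] by linarith
      moreover have "\<bar>fst (z - zb)\<bar> \<le> norm (z - zb)" "\<bar>snd (z - zb)\<bar> \<le> norm (z - zb)"
        using norm_fst_le[of "fst (z - zb)" "snd (z - zb)"] norm_snd_le[of "snd (z - zb)" "fst (z - zb)"]
        unfolding prod.collapse real_norm_def .
      ultimately show "\<bar>fst z - fst zb\<bar> + \<bar>snd z - snd zb\<bar> \<le> 2 * (R + norm zb)"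
        unfolding fst_diff snd_diff by (smt (verit))
    qed (rule bounded_borel_nonneg[OF assms(2)])
    finally show ?thesis using assms(4)[of n] by linarith
  qed
  then show "\<exists>C. \<forall>n z. norm z \<le> R \<longrightarrow> \<bar>f n z\<bar> \<le> C" by blast
qed

text \<open>A flow in one space dimension with density \<open>r\<close>, velocity \<open>u\<close> and passively transported velocity
  component \<open>w\<close>, in coordinates \<open>(y, t)\<close> moving with the contact discontinuity. The initial data are
  encoded by extending the fields to \<open>t < 0\<close> by the stationary discontinuity, and the
  conservation laws hold for the mollified fields.\<close>

locale contact_flow =
  fixes r u w :: "real \<times> real \<Rightarrow> real" and \<rho> r0 B a b :: real
  assumes bounds: "bounded_borel B r" "bounded_borel B u" "bounded_borel B w"
    and r0: "r0 > 0" "\<And>z. r0 \<le> r z"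
    and past: "\<And>z. snd z < 0 \<Longrightarrow> r z = \<rho>" "\<And>z. snd z < 0 \<Longrightarrow> u z = 0"
      "\<And>z. snd z < 0 \<Longrightarrow> w z = (if fst z < 0 then a else b)"
    and ab: "a \<noteq> b"
    and mass: "\<And>n z. mollified_div n r (\<lambda>z. r z * u z) z = 0"
    and transport: "\<And>n z. mollified_div n (\<lambda>z. r z * w z) (\<lambda>z. r z * w z * u z) z = 0"
begin

definition "m z = r z * u z"
definition "F1 z = r z * w z - a * r z"
definition "G1 z = r z * w z * u z - a * (r z * u z)"
definition "F2 z = F1 z - (b - a) * r z"
definition "G2 z = G1 z - (b - a) * m z"

text \<open>The defining forms are linear in conserved pairs and inherit their conservation laws;
  the product forms show that each flux is \<open>u\<close> times its density, which is what makes
  the potentials transported.\<close>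

lemma G1_eq: "G1 z = F1 z * u z" and F2_eq: "F2 z = r z * w z - b * r z" and G2_eq: "G2 z = F2 z * u z"
  by (simp_all add: G1_def F1_def F2_def G2_def m_def algebra_simps)

lemma past_values:
  assumes "snd z < 0"
  shows "m z = 0" "G1 z = 0" "F1 z = (if fst z < 0 then 0 else \<rho> * (b - a))"
  using past[OF assms] by (auto simp: m_def G1_eq F1_def algebra_simps)

lemma bounded_ex: "\<exists>M. bounded_borel M r \<and> bounded_borel M m \<and> bounded_borel M F1 \<and> bounded_borel M G1
    \<and> bounded_borel M F2 \<and> bounded_borel M G2"
proof -
  have m: "bounded_borel (B * B) m"
    unfolding m_def[abs_def] by (intro bounded_borel_mult bounds)
  have F1: "bounded_borel (B * B + \<bar>a\<bar> * B) F1"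
    unfolding F1_def[abs_def] by (intro bounded_borel_diff bounded_borel_mult bounds bounded_borel_const)
  have F2: "bounded_borel (B * B + \<bar>b\<bar> * B) F2"
    unfolding F2_eq[abs_def] by (intro bounded_borel_diff bounded_borel_mult bounds bounded_borel_const)
  have G1: "bounded_borel ((B * B + \<bar>a\<bar> * B) * B) G1"
    unfolding G1_eq[abs_def] by (intro bounded_borel_mult F1 bounds)
  have G2: "bounded_borel ((B * B + \<bar>b\<bar> * B) * B) G2"
    unfolding G2_eq[abs_def] by (intro bounded_borel_mult F2 bounds)
  define M where "M = Max {B, B * B, B * B + \<bar>a\<bar> * B, B * B + \<bar>b\<bar> * B, (B * B + \<bar>a\<bar> * B) * B, (B * B + \<bar>b\<bar> * B) * B}"
  have "x \<le> M" if "x \<in> {B, B * B, B * B + \<bar>a\<bar> * B, B * B + \<bar>b\<bar> * B, (B * B + \<bar>a\<bar> * B) * B, (B * B + \<bar>b\<bar> * B) * B}" for x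
    unfolding M_def using that by (intro Max_ge) auto
  then show ?thesis
    by (intro exI[of _ M] conjI bounded_borel_mono[OF bounds(1)] bounded_borel_mono[OF m]
      bounded_borel_mono[OF F1] bounded_borel_mono[OF F2] bounded_borel_mono[OF G1] bounded_borel_mono[OF G2]) simp_all
qed

text \<open>One bound for all fields, so that a common subsequence can be extracted for the whole
  family.\<close>

definition "M = (SOME M. bounded_borel M r \<and> bounded_borel M m \<and> bounded_borel M F1 \<and> bounded_borel M G1
    \<and> bounded_borel M F2 \<and> bounded_borel M G2)"

lemma bounded:
  "bounded_borel M r" "bounded_borel M m" "bounded_borel M F1" "bounded_borel M G1"
  "bounded_borel M F2" "bounded_borel M G2"
  using someI_ex[OF bounded_ex] unfolding M_def by blast+

lemma measurable_fields [measurable]: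
  "r \<in> borel_measurable borel" "m \<in> borel_measurable borel" "u \<in> borel_measurable borel" "w \<in> borel_measurable borel"
  "F1 \<in> borel_measurable borel" "G1 \<in> borel_measurable borel"
  "F2 \<in> borel_measurable borel" "G2 \<in> borel_measurable borel"
  using bounded bounds by (auto simp: bounded_borel_def)

lemma mass_m: "mollified_div n r m z = 0"
  using mass[of n z] by (simp add: m_def[abs_def])

lemma conservation_1: "mollified_div n F1 G1 z = 0"
proof -
  have b: "bounded_borel (B * B) (\<lambda>z. r z * w z)" "bounded_borel (B * B * B) (\<lambda>z. r z * w z * u z)"
    "bounded_borel (B * B) (\<lambda>z. r z * u z)"
    by (intro bounded_borel_mult bounds)+
  have "conv F1 (mollifier_t n) z = conv (\<lambda>z. r z * w z) (mollifier_t n) z - a * conv r (mollifier_t n) z"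
    unfolding F1_def[abs_def]
    by (rule conv_lincomb[OF b(1) bounds(1) mollifier_kernels(3)])
  moreover have "conv G1 (mollifier_y n) z
      = conv (\<lambda>z. r z * w z * u z) (mollifier_y n) z - a * conv (\<lambda>z. r z * u z) (mollifier_y n) z"
    unfolding G1_def[abs_def]
    by (rule conv_lincomb[OF b(2,3) mollifier_kernels(2)])
  ultimately have "mollified_div n F1 G1 z
     = mollified_div n (\<lambda>z. r z * w z) (\<lambda>z. r z * w z * u z) z
       - a * mollified_div n r (\<lambda>z. r z * u z) z"
    by (simp add: algebra_simps)
  then show ?thesis by (simp add: mass transport)
qed

lemma conv_F2: "conv F2 (mollifier n) z = conv F1 (mollifier n) z - (b - a) * conv r (mollifier n) z"
  unfolding F2_def[abs_def] by (rule conv_lincomb[OF bounded(3,1) mollifier_kernels(1)])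

lemma conv_G2: "conv G2 (mollifier n) z = conv G1 (mollifier n) z - (b - a) * conv m (mollifier n) z"
  unfolding G2_def[abs_def] by (rule conv_lincomb[OF bounded(4,2) mollifier_kernels(1)])

lemma near_past:
  fixes s :: "real \<times> real"
  assumes "norm ((y, t) - s) \<le> 2 / real (Suc n)"
  shows "\<bar>y - fst s\<bar> \<le> 2 / real (Suc n)" "\<bar>t - snd s\<bar> \<le> 2"
proof -
  have "\<bar>fst ((y, t) - s)\<bar> \<le> norm ((y, t) - s)" "\<bar>snd ((y, t) - s)\<bar> \<le> norm ((y, t) - s)"
    using norm_fst_le[of "fst ((y, t) - s)" "snd ((y, t) - s)"] norm_snd_le[of "snd ((y, t) - s)" "fst ((y, t) - s)"]
    unfolding prod.collapse real_norm_def .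
  moreover have "2 / real (Suc n) \<le> 2" by (simp add: divide_le_eq)
  ultimately show "\<bar>y - fst s\<bar> \<le> 2 / real (Suc n)" "\<bar>t - snd s\<bar> \<le> 2"
    using assms unfolding fst_diff snd_diff fst_conv snd_conv by linarith+
qed

text \<open>\<open>Y\<close>, \<open>D1\<close>, \<open>D2\<close> are potentials of \<open>(r, m)\<close>, \<open>(F1, G1)\<close>, \<open>(F2, G2)\<close>, normalised at time \<open>-3\<close>;
  since mollifiers have radius at most 2, the mollified fields are still stationary at that time.\<close>

definition "Yn n z = \<rho> * fst z - integral {- 3..snd z} (\<lambda>\<tau>. conv m (mollifier n) (fst z, \<tau>))"
definition "Y z = \<rho> * fst z - time_integral m z"
definition "A1n n y = integral {- 3..y} (\<lambda>s. conv F1 (mollifier n) (s, - 3))"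
definition "D1n n z = A1n n (fst z) - integral {- 3..snd z} (\<lambda>\<tau>. conv G1 (mollifier n) (fst z, \<tau>))"
definition "D1 z = \<rho> * (b - a) * max 0 (fst z) - time_integral G1 z"
definition "D2n n z = D1n n z - (b - a) * Yn n z"
definition "D2 z = D1 z - (b - a) * Y z"

lemma C1_Yn: "C1 (Yn n) (conv r (mollifier n)) (\<lambda>z. - conv m (mollifier n) z)"
  unfolding Yn_def[abs_def]
proof (rule potential_C1[where A = "\<lambda>y. \<rho> * y", OF bounded(1,2) mass_m past_values(1)])
  fix y
  have "conv r (mollifier n) (y, - 3) = \<rho>"
    by (rule conv_mollifier_const) (use near_past(2) in \<open>force intro: past(1)\<close>)
  then show "((*) \<rho> has_real_derivative conv r (mollifier n) (y, - 3)) (at y)"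
    by (auto intro!: derivative_eq_intros)
qed

lemma F1_past_const:
  assumes "\<bar>y\<bar> > 2 / real (Suc n)"
  shows "conv F1 (mollifier n) (y, - 3) = (if y < 0 then 0 else \<rho> * (b - a))"
proof (rule conv_mollifier_const)
  fix s :: "real \<times> real"
  assume s: "norm ((y, - 3) - s) \<le> 2 / real (Suc n)"
  then have "snd s < 0" using near_past(2)[OF s] by linarith
  moreover have "fst s < 0 \<longleftrightarrow> y < 0" using near_past(1)[OF s] assms by linarith
  ultimately show "F1 s = (if y < 0 then 0 else \<rho> * (b - a))" by (simp add: past_values)
qed

lemma C1_D1n: "C1 (D1n n) (conv F1 (mollifier n)) (\<lambda>z. - conv G1 (mollifier n) z)"
  unfolding D1n_def[abs_def]
proof (rule potential_C1[where A = "A1n n", OF bounded(3,4) conservation_1 past_values(2)])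
  fix y
  show "(A1n n has_real_derivative conv F1 (mollifier n) (y, - 3)) (at y)"
    unfolding A1n_def[abs_def]
  proof (rule integral_from_past_has_derivative)
    have "continuous_on UNIV (conv F1 (mollifier n))" using C1_conv[OF bounded(3)] by (simp add: C1_def)
    then show "continuous_on UNIV (\<lambda>s. conv F1 (mollifier n) (s, - 3))"
      by (rule continuous_on_compose2) (auto intro!: continuous_intros)
    \<comment> \<open>The lower limit -3 of the integral in \<open>A1n\<close> is a position: in the
      past \<open>F1\<close> vanishes for \<open>y < 0\<close>, hence its mollification for
      \<open>y < -2\<close>.\<close>
    show "conv F1 (mollifier n) (x, - 3) = 0" if "x < - 3 + 1" for x
    proof -
      have "2 / real (Suc n) \<le> 2" by (simp add: divide_le_eq)
      then show ?thesis using that F1_past_const[of n x] by simp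
    qed
  qed
qed

lemma C1_D2n: "C1 (D2n n) (conv F2 (mollifier n)) (\<lambda>z. - conv G2 (mollifier n) z)"
proof -
  have "C1 (D2n n) (\<lambda>z. conv F1 (mollifier n) z - (b - a) * conv r (mollifier n) z)
      (\<lambda>z. - conv G1 (mollifier n) z - (b - a) * - conv m (mollifier n) z)"
    unfolding D2n_def[abs_def] by (rule C1_diff_cmult[OF C1_D1n C1_Yn])
  moreover have "(\<lambda>z. conv F1 (mollifier n) z - (b - a) * conv r (mollifier n) z) = conv F2 (mollifier n)"
    "(\<lambda>z. - conv G1 (mollifier n) z - (b - a) * - conv m (mollifier n) z) = (\<lambda>z. - conv G2 (mollifier n) z)"
    by (simp_all add: fun_eq_iff conv_F2 conv_G2)
  ultimately show ?thesis by simp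
qed

text \<open>Away from \<open>y = 0\<close> the mollified step is eventually equal to the step, whose
  antiderivative is the kink \<open>max 0 y\<close>.\<close>

lemma A1n_tendsto:
  assumes "strict_mono k"
  shows "(\<lambda>n. A1n (k n) y) \<longlonglongrightarrow> \<rho> * (b - a) * max 0 y"
proof -
  define g :: "real \<Rightarrow> real" where "g s = (if s < 0 then 0 else \<rho> * (b - a))" for s
  have "(\<lambda>n. A1n (k n) y) \<longlonglongrightarrow> (LINT s|lborel. indicator {- 3..y} s * g s)"
    unfolding A1n_def
  proof (rule indicator_integral_tendsto[where M = M])
    show "continuous_on UNIV (\<lambda>s. conv F1 (mollifier (k n)) (s, - 3))" for n
    proof -
      have "continuous_on UNIV (conv F1 (mollifier (k n)))" using C1_conv[OF bounded(3)] by (simp add: C1_def)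
      then show ?thesis by (rule continuous_on_compose2) (auto intro!: continuous_intros)
    qed
    show "g \<in> borel_measurable borel" unfolding g_def by measurable
    show "\<bar>conv F1 (mollifier (k n)) (s, - 3)\<bar> \<le> M" for n s
      using conv_bounded_borel[OF bounded(3)] unfolding bounded_borel_def by blast
    have "AE s in lborel. s \<noteq> (0::real)" by (rule AE_lborel_singleton)
    then show "AE s in lborel. (\<lambda>n. conv F1 (mollifier (k n)) (s, - 3)) \<longlonglongrightarrow> g s"
    proof eventually_elim
      case (elim s)
      have "(\<lambda>n. 2 * inverse (real (Suc n))) \<longlonglongrightarrow> 2 * 0"
        by (intro tendsto_intros LIMSEQ_inverse_real_of_nat)
      then have "\<forall>\<^sub>F n in sequentially. 2 / real (Suc n) < \<bar>s\<bar>"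
        using order_tendstoD(2)[of _ 0 sequentially "\<bar>s\<bar>"] elim by (simp add: divide_inverse)
      then have "\<forall>\<^sub>F n in sequentially. 2 / real (Suc (k n)) < \<bar>s\<bar>"
        using filterlim_subseq[OF assms] unfolding filterlim_iff by blast
      then have "\<forall>\<^sub>F n in sequentially. conv F1 (mollifier (k n)) (s, - 3) = g s"
        by eventually_elim (simp only: F1_past_const g_def)
      then show ?case by (rule tendsto_eventually)
    qed
  qed
  moreover have "(LINT s|lborel. indicator {- 3..y} s * g s) = (LINT s|lborel. indicator {0..y} s * (\<rho> * (b - a)))"
    by (intro Bochner_Integration.integral_cong) (auto simp: g_def indicator_def)
  moreover have "\<dots> = \<rho> * (b - a) * max 0 y"
    by (cases "0 \<le> y") (simp_all add: measure_def emeasure_lborel_Icc_eq)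
  ultimately show ?thesis by (simp only:)
qed

text \<open>Convergence of \<open>Y\<close> is kept in the stronger form, for all \<open>t\<close>
  off a null set of \<open>y\<close>, because its monotonicity on every time slice is used
  later.\<close>

lemma approximation:
  obtains k :: "nat \<Rightarrow> nat" where
    "AE z in lborel. (\<lambda>n. conv r (mollifier (k n)) z) \<longlonglongrightarrow> r z"
    "AE z in lborel. (\<lambda>n. conv m (mollifier (k n)) z) \<longlonglongrightarrow> m z"
    "AE z in lborel. (\<lambda>n. conv F1 (mollifier (k n)) z) \<longlonglongrightarrow> F1 z"
    "AE z in lborel. (\<lambda>n. conv G1 (mollifier (k n)) z) \<longlonglongrightarrow> G1 z"
    "AE z in lborel. (\<lambda>n. conv F2 (mollifier (k n)) z) \<longlonglongrightarrow> F2 z"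
    "AE z in lborel. (\<lambda>n. conv G2 (mollifier (k n)) z) \<longlonglongrightarrow> G2 z"
    "AE z in lborel. (\<lambda>n. D1n (k n) z) \<longlonglongrightarrow> D1 z"
    "AE z in lborel. (\<lambda>n. D2n (k n) z) \<longlonglongrightarrow> D2 z"
    "AE y in lborel. \<forall>t. (\<lambda>n. Yn (k n) (y, t)) \<longlonglongrightarrow> Y (y, t)"
proof -
  have "\<And>f. f \<in> {r, m, F1, G1, F2, G2} \<Longrightarrow> bounded_borel M f" using bounded by blast
  then obtain k :: "nat \<Rightarrow> nat" where k: "strict_mono k"
    and ae: "AE z in lborel. \<forall>f\<in>{r, m, F1, G1, F2, G2}. (\<lambda>n. conv f (mollifier (k n)) z) \<longlonglongrightarrow> f z"
    using conv_mollifier_AE_subseq[of "{r, m, F1, G1, F2, G2}" M "\<lambda>f. f"] by blast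
  have lim: "AE z in lborel. (\<lambda>n. conv f (mollifier (k n)) z) \<longlonglongrightarrow> f z" if "f \<in> {r, m, F1, G1, F2, G2}" for f
    using ae by eventually_elim (use that in blast)
  have lm: "AE z in lborel. (\<lambda>n. conv m (mollifier (k n)) z) \<longlonglongrightarrow> m z"
    and lG: "AE z in lborel. (\<lambda>n. conv G1 (mollifier (k n)) z) \<longlonglongrightarrow> G1 z"
    by (rule lim; simp)+
  have Y: "AE y in lborel. \<forall>t. (\<lambda>n. Yn (k n) (y, t)) \<longlonglongrightarrow> Y (y, t)"
    using time_integral_tendsto[OF bounded(2) lm]
    by eventually_elim (auto simp: Yn_def Y_def intro!: tendsto_intros)
  have D: "AE y in lborel. \<forall>t. (\<lambda>n. D1n (k n) (y, t)) \<longlonglongrightarrow> D1 (y, t)"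
    using time_integral_tendsto[OF bounded(4) lG]
    by eventually_elim (auto simp: D1n_def D1_def intro!: tendsto_intros A1n_tendsto[OF k])
  have "AE y in lborel. \<forall>t. (\<lambda>n. D2n (k n) (y, t)) \<longlonglongrightarrow> D2 (y, t)"
    using Y D by eventually_elim (auto simp: D2n_def D2_def intro!: tendsto_intros)
  note D2 = AE_plane_from_fst[OF this] and D1 = AE_plane_from_fst[OF D]
  show thesis
    by (rule that[OF lim lim lim lim lim lim D1 D2 Y]) simp_all
qed

lemma potentials_measurable [measurable]:
  "D1 \<in> borel_measurable borel" "D2 \<in> borel_measurable borel" "Y \<in> borel_measurable borel"
proof -
  note [measurable] = time_integral_measurable[OF measurable_fields(2)] time_integral_measurable[OF measurable_fields(6)]
  have [measurable]: "fst \<in> borel_measurable (borel :: (real \<times> real) measure)"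
    by (intro borel_measurable_continuous_onI continuous_intros)
  show [measurable]: "D1 \<in> borel_measurable borel" "Y \<in> borel_measurable borel"
    unfolding D1_def[abs_def] Y_def[abs_def] by measurable
  show "D2 \<in> borel_measurable borel"
    unfolding D2_def[abs_def] by measurable
qed

lemma approximations_measurable [measurable]:
  "D1n n \<in> borel_measurable borel" "D2n n \<in> borel_measurable borel"
  using C1_D1n C1_D2n by (auto simp: C1_def intro!: borel_measurable_continuous_onI)

lemma conv_measurable [measurable]: "bounded_borel N f \<Longrightarrow> conv f (mollifier n) \<in> borel_measurable borel"
  using conv_bounded_borel by (auto simp: bounded_borel_def)

lemma bounded_borel_uminus: "bounded_borel N f \<Longrightarrow> bounded_borel N (\<lambda>z. - f z)"
  by (auto simp: bounded_borel_def)

lemma locally_bounded_D1n: "locally_bounded (\<lambda>n. D1n (k n))"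
  by (rule locally_bounded_C1[where zb = "(- 3, - 3)" and C = 0, OF C1_D1n])
    (auto intro!: conv_bounded_borel bounded_borel_uminus bounded simp: D1n_def A1n_def)

lemma locally_bounded_D2n: "locally_bounded (\<lambda>n. D2n (k n))"
  by (rule locally_bounded_C1[where zb = "(- 3, - 3)" and C = "\<bar>(b - a) * (\<rho> * 3)\<bar>", OF C1_D2n])
    (auto intro!: conv_bounded_borel bounded_borel_uminus bounded simp: D1n_def A1n_def D2n_def Yn_def)

lemma locally_bounded_potentials: "locally_bounded (\<lambda>_::nat. D1)" "locally_bounded (\<lambda>_::nat. D2)"
proof -
  have n: "\<bar>fst z\<bar> \<le> norm z" "\<bar>snd z\<bar> \<le> norm z" for z :: "real \<times> real"
    using norm_fst_le[of "fst z" "snd z"] norm_snd_le[of "snd z" "fst z"] unfolding prod.collapse real_norm_def .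
  have ti: "locally_bounded (\<lambda>_::nat. time_integral G)" if "bounded_borel N G" for N G
    unfolding locally_bounded_def
  proof
    fix R
    have "\<bar>time_integral G z\<bar> \<le> N * (R + 3)" if "norm z \<le> R" for z
      using n[of z] that bounded_borel_nonneg[OF \<open>bounded_borel N G\<close>]
      by (intro order_trans[OF time_integral_bound[OF \<open>bounded_borel N G\<close>]] mult_left_mono) auto
    then show "\<exists>C. \<forall>(i::nat) z. norm z \<le> R \<longrightarrow> \<bar>time_integral G z\<bar> \<le> C" by blast
  qed
  have f: "locally_bounded (\<lambda>(_::nat) z::real\<times>real. fst z)"
    unfolding locally_bounded_def using n order_trans by blast
  have f': "locally_bounded (\<lambda>(_::nat) z::real\<times>real. max 0 (fst z))"
    unfolding locally_bounded_def
  proof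
    fix R
    have "\<bar>max 0 (fst z)\<bar> \<le> R" if "norm z \<le> R" for z :: "real \<times> real"
      using n(1)[of z] that by linarith
    then show "\<exists>C. \<forall>(i::nat) z::real\<times>real. norm z \<le> R \<longrightarrow> \<bar>max 0 (fst z)\<bar> \<le> C" by blast
  qed
  show D1: "locally_bounded (\<lambda>_::nat. D1)"
    unfolding D1_def[abs_def]
    by (intro locally_bounded_diff locally_bounded_mult locally_bounded_const f' ti[OF bounded(4)])
  have "locally_bounded (\<lambda>_::nat. Y)"
    unfolding Y_def[abs_def]
    by (intro locally_bounded_diff locally_bounded_mult locally_bounded_const f ti[OF bounded(2)])
  with D1 show "locally_bounded (\<lambda>_::nat. D2)"
    unfolding D2_def[abs_def] by (intro locally_bounded_diff locally_bounded_mult locally_bounded_const)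
qed

text \<open>In the past \<open>D1\<close> is \<open>\<rho> (b - a) max 0 y\<close> and
  \<open>D2\<close> is \<open>\<rho> (b - a) max 0 (- y)\<close>: the kinks live on opposite sides
  of the jump.\<close>

lemma potentials_past: "snd z < 0 \<Longrightarrow> D1 z * D2 z = 0"
  by (cases "fst z < 0")
    (simp_all add: D1_def D2_def Y_def time_integral_past[OF past_values(1)] time_integral_past[OF past_values(2)]
      max_def algebra_simps)

end

section \<open>Transport of the product of potentials\<close>

context contact_flow
begin

text \<open>The mass law is tested with \<open>P^2 * \<phi>\<close>, where \<open>P\<close> is the
  product of the mollified potentials, a \<open>C1\<close> function with locally bounded gradient.
  In the limit the terms with derivatives of \<open>P\<close> assemble to
  \<open>2 P \<phi> (r P_t + m P_y)\<close>, which vanishes since both fluxes are \<open>u\<close>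
  times their densities and \<open>m = r u\<close>. The square makes the transported density
  nonnegative.\<close>

lemma transport_square:
  assumes \<phi>: "C1 \<phi> \<phi>y \<phi>t" "\<And>z. norm z > R \<Longrightarrow> \<phi> z = 0"
  shows "(LINT z|lborel. (r z * (D1 z * D2 z)\<^sup>2) * \<phi>t z + (m z * (D1 z * D2 z)\<^sup>2) * \<phi>y z) = 0"
proof -
  obtain k :: "nat \<Rightarrow> nat" where
    lim: "AE z in lborel. (\<lambda>n. conv F1 (mollifier (k n)) z) \<longlonglongrightarrow> F1 z"
      "AE z in lborel. (\<lambda>n. conv G1 (mollifier (k n)) z) \<longlonglongrightarrow> G1 z"
      "AE z in lborel. (\<lambda>n. conv F2 (mollifier (k n)) z) \<longlonglongrightarrow> F2 z"
      "AE z in lborel. (\<lambda>n. conv G2 (mollifier (k n)) z) \<longlonglongrightarrow> G2 z"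
      "AE z in lborel. (\<lambda>n. D1n (k n) z) \<longlonglongrightarrow> D1 z"
      "AE z in lborel. (\<lambda>n. D2n (k n) z) \<longlonglongrightarrow> D2 z"
    by (rule approximation)
  note ker = C1_kernels[OF \<phi>]
  note [measurable] = kernel_measurable[OF ker(1)] kernel_measurable[OF ker(2)] kernel_measurable[OF ker(3)]
    conv_measurable[OF bounded(3)] conv_measurable[OF bounded(4)] conv_measurable[OF bounded(5)] conv_measurable[OF bounded(6)]
  define P where "P n z = D1n n z * D2n n z" for n z
  define Py where "Py n z = conv F1 (mollifier n) z * D2n n z + D1n n z * conv F2 (mollifier n) z" for n z
  define Pt where "Pt n z = - conv G1 (mollifier n) z * D2n n z + D1n n z * - conv G2 (mollifier n) z" for n z
  define Sy where "Sy n z = (Py n z * P n z + P n z * Py n z) * \<phi> z + (P n z * P n z) * \<phi>y z" for n z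
  define St where "St n z = (Pt n z * P n z + P n z * Pt n z) * \<phi> z + (P n z * P n z) * \<phi>t z" for n z
  have P: "C1 (P n) (Py n) (Pt n)" for n
    unfolding P_def[abs_def] Py_def[abs_def] Pt_def[abs_def] by (rule C1_mult[OF C1_D1n C1_D2n])
  have S: "C1 (\<lambda>z. (P n z * P n z) * \<phi> z) (Sy n) (St n)" for n
    unfolding Sy_def[abs_def] St_def[abs_def] by (intro C1_mult P \<phi>(1))
  have zero: "(LINT z|lborel. r z * St n z + m z * Sy n z) = 0" for n
    by (rule weak_equation_C1[where R = R, OF bounded(1,2) mass_m S]) (simp add: \<phi>(2))
  have [measurable]: "P n \<in> borel_measurable borel" "Py n \<in> borel_measurable borel" "Pt n \<in> borel_measurable borel" for n
    unfolding P_def[abs_def] Py_def[abs_def] Pt_def[abs_def] by measurable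
  have lb: "locally_bounded (\<lambda>n. P (k n))" "locally_bounded (\<lambda>n. Py (k n))" "locally_bounded (\<lambda>n. Pt (k n))"
    unfolding P_def[abs_def] Py_def[abs_def] Pt_def[abs_def]
    by (intro locally_bounded_add locally_bounded_mult locally_bounded_uminus locally_bounded_D1n locally_bounded_D2n
      locally_bounded_bounded[OF conv_bounded_borel[OF bounded(3)]] locally_bounded_bounded[OF conv_bounded_borel[OF bounded(4)]]
      locally_bounded_bounded[OF conv_bounded_borel[OF bounded(5)]] locally_bounded_bounded[OF conv_bounded_borel[OF bounded(6)]])+
  have "(\<lambda>n. LINT z|lborel. r z * St (k n) z + m z * Sy (k n) z)
      \<longlonglongrightarrow> (LINT z|lborel. (r z * (D1 z * D2 z)\<^sup>2) * \<phi>t z + (m z * (D1 z * D2 z)\<^sup>2) * \<phi>y z)"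
  proof (rule locally_bounded_dominated)
    show "locally_bounded (\<lambda>n z. r z * St (k n) z + m z * Sy (k n) z)"
      unfolding St_def Sy_def
      by (intro locally_bounded_add locally_bounded_mult lb locally_bounded_kernel[OF ker(1)]
        locally_bounded_kernel[OF ker(2)] locally_bounded_kernel[OF ker(3)]
        locally_bounded_bounded[OF bounded(1)] locally_bounded_bounded[OF bounded(2)])
    show "(\<lambda>z. r z * St (k n) z + m z * Sy (k n) z) \<in> borel_measurable borel" for n
      unfolding St_def Sy_def by measurable
    show "(\<lambda>z. r z * (D1 z * D2 z)\<^sup>2 * \<phi>t z + m z * (D1 z * D2 z)\<^sup>2 * \<phi>y z) \<in> borel_measurable borel"
      by measurable
    show "r z * St (k n) z + m z * Sy (k n) z = 0" if "norm z > R" for n z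
      using that kernel_outside[OF ker(1)] kernel_outside[OF ker(2)] kernel_outside[OF ker(3)]
      by (simp add: St_def Sy_def)
    show "AE z in lborel. (\<lambda>n. r z * St (k n) z + m z * Sy (k n) z)
        \<longlonglongrightarrow> r z * (D1 z * D2 z)\<^sup>2 * \<phi>t z + m z * (D1 z * D2 z)\<^sup>2 * \<phi>y z"
      using lim
    proof eventually_elim
      case (elim z)
      define Q where "Q = D1 z * D2 z"
      define Qy where "Qy = F1 z * D2 z + D1 z * F2 z"
      define Qt where "Qt = - G1 z * D2 z + D1 z * - G2 z"
      have "(\<lambda>n. P (k n) z) \<longlonglongrightarrow> Q" "(\<lambda>n. Py (k n) z) \<longlonglongrightarrow> Qy" "(\<lambda>n. Pt (k n) z) \<longlonglongrightarrow> Qt"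
        unfolding P_def Py_def Pt_def Q_def Qy_def Qt_def by (intro tendsto_intros elim)+
      then have "(\<lambda>n. r z * St (k n) z + m z * Sy (k n) z) \<longlonglongrightarrow>
          r z * ((Qt * Q + Q * Qt) * \<phi> z + Q * Q * \<phi>t z) + m z * ((Qy * Q + Q * Qy) * \<phi> z + Q * Q * \<phi>y z)"
        unfolding St_def Sy_def by (intro tendsto_intros)
      moreover have "r z * Qt + m z * Qy = 0"
        by (simp add: Qt_def Qy_def m_def G1_eq G2_eq algebra_simps)
      then have "2 * Q * \<phi> z * (r z * Qt + m z * Qy) = 0" by simp
      then have "r z * ((Qt * Q + Q * Qt) * \<phi> z + Q * Q * \<phi>t z) + m z * ((Qy * Q + Q * Qy) * \<phi> z + Q * Q * \<phi>y z)
          = r z * Q\<^sup>2 * \<phi>t z + m z * Q\<^sup>2 * \<phi>y z"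
        by (simp add: power2_eq_square algebra_simps)
      ultimately show ?case by (simp add: Q_def)
    qed
  qed
  then show ?thesis by (simp add: zero LIMSEQ_const_iff)
qed

text \<open>For \<open>h = r (D1 D2)^2\<close> the flux is \<open>u * h\<close>, so the bound of
  \<open>u\<close> is an admissible speed; positivity of \<open>r\<close> then removes the
  weight.\<close>

lemma product_vanishes: "AE z in lborel. D1 z * D2 z = 0"
proof -
  have "AE z in lborel. r z * (D1 z * D2 z)\<^sup>2 = 0"
  proof (rule cone_vanishing[where q = "\<lambda>z. m z * (D1 z * D2 z)\<^sup>2" and K = B])
    show "\<exists>C. \<forall>z. norm z \<le> R \<longrightarrow> \<bar>r z * (D1 z * D2 z)\<^sup>2\<bar> \<le> C \<and> \<bar>m z * (D1 z * D2 z)\<^sup>2\<bar> \<le> C" for R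
    proof -
      have "locally_bounded (\<lambda>_::nat. \<lambda>z. f z * (D1 z * D2 z)\<^sup>2)" if "bounded_borel M f" for f
        unfolding power2_eq_square
        by (intro locally_bounded_mult locally_bounded_potentials locally_bounded_bounded[OF that])
      from this[OF bounded(1)] this[OF bounded(2)]
      obtain C C' where "\<And>z. norm z \<le> R \<Longrightarrow> \<bar>r z * (D1 z * D2 z)\<^sup>2\<bar> \<le> C"
        "\<And>z. norm z \<le> R \<Longrightarrow> \<bar>m z * (D1 z * D2 z)\<^sup>2\<bar> \<le> C'"
        unfolding locally_bounded_def by metis
      then show ?thesis by (intro exI[of _ "max C C'"]) fastforce
    qed
    have r: "r z \<ge> 0" for z using r0 less_imp_le order_trans by blast
    then show "AE z in lborel. r z * (D1 z * D2 z)\<^sup>2 \<ge> 0" by simp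
    have "\<bar>m z * (D1 z * D2 z)\<^sup>2\<bar> \<le> B * (r z * (D1 z * D2 z)\<^sup>2)" for z
    proof -
      have "\<bar>u z\<bar> \<le> B" using bounds(2) unfolding bounded_borel_def by blast
      then have "\<bar>u z\<bar> * (r z * (D1 z * D2 z)\<^sup>2) \<le> B * (r z * (D1 z * D2 z)\<^sup>2)"
        using r by (intro mult_right_mono) auto
      then show ?thesis using r[of z] by (simp add: m_def abs_mult mult_ac)
    qed
    then show "AE z in lborel. \<bar>m z * (D1 z * D2 z)\<^sup>2\<bar> \<le> B * (r z * (D1 z * D2 z)\<^sup>2)" by blast
    show "AE z in lborel. snd z < 0 \<longrightarrow> r z * (D1 z * D2 z)\<^sup>2 = 0"
      by (intro AE_I2 impI) (simp only: potentials_past, simp)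
  next
    fix \<phi> \<phi>y \<phi>t R
    assume "C1 \<phi> \<phi>y \<phi>t" "\<And>z. norm z > R \<Longrightarrow> \<phi> z = 0"
    from transport_square[OF this]
    show "(LINT z|lborel. r z * (D1 z * D2 z)\<^sup>2 * \<phi>t z + m z * (D1 z * D2 z)\<^sup>2 * \<phi>y z) \<ge> 0" by simp
  qed measurable
  then show ?thesis
  proof eventually_elim
    case (elim z)
    moreover have "r z > 0" using r0(1) r0(2)[of z] by linarith
    ultimately show ?case by simp
  qed
qed

text \<open>\<open>E\<close> is the \<open>y\<close>-derivative of the product \<open>D1 D2\<close>.\<close>

definition "E z = F1 z * D2 z + D1 z * F2 z"

lemma E_measurable [measurable]: "E \<in> borel_measurable borel"
  unfolding E_def[abs_def] by measurable

lemma E_locally_bounded: "locally_bounded (\<lambda>_::nat. E)"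
  unfolding E_def[abs_def]
  by (intro locally_bounded_add locally_bounded_mult locally_bounded_potentials)
    (rule locally_bounded_bounded, rule bounded)+

text \<open>Integration by parts against the mollified product of potentials, whose limit is zero by
  \<open>product_vanishes\<close>.\<close>

lemma integral_E_eq_0:
  assumes \<phi>: "C1 \<phi> \<phi>y \<phi>t" "\<And>z. norm z > R \<Longrightarrow> \<phi> z = 0"
  shows "(LINT z|lborel. E z * \<phi> z) = 0"
proof -
  obtain k :: "nat \<Rightarrow> nat" where
    lim: "AE z in lborel. (\<lambda>n. conv F1 (mollifier (k n)) z) \<longlonglongrightarrow> F1 z"
      "AE z in lborel. (\<lambda>n. conv F2 (mollifier (k n)) z) \<longlonglongrightarrow> F2 z"
      "AE z in lborel. (\<lambda>n. D1n (k n) z) \<longlonglongrightarrow> D1 z"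
      "AE z in lborel. (\<lambda>n. D2n (k n) z) \<longlonglongrightarrow> D2 z"
    by (rule approximation)
  note ker = C1_kernels[OF \<phi>]
  note [measurable] = kernel_measurable[OF ker(1)] kernel_measurable[OF ker(2)]
    conv_measurable[OF bounded(3)] conv_measurable[OF bounded(5)]
  define Py where "Py n z = conv F1 (mollifier n) z * D2n n z + D1n n z * conv F2 (mollifier n) z" for n z
  have parts: "(LINT z|lborel. D1n n z * D2n n z * \<phi>y z) = - (LINT z|lborel. Py n z * \<phi> z)" for n
    unfolding Py_def by (rule integral_by_parts_C1(1)[OF C1_mult[OF C1_D1n C1_D2n] \<phi>])
  have "(\<lambda>n. LINT z|lborel. D1n (k n) z * D2n (k n) z * \<phi>y z) \<longlonglongrightarrow> (LINT z|lborel. D1 z * D2 z * \<phi>y z)"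
  proof (rule locally_bounded_dominated[where R = R])
    show "locally_bounded (\<lambda>n z. D1n (k n) z * D2n (k n) z * \<phi>y z)"
      by (intro locally_bounded_mult locally_bounded_D1n locally_bounded_D2n locally_bounded_kernel[OF ker(2)])
    show "AE z in lborel. (\<lambda>n. D1n (k n) z * D2n (k n) z * \<phi>y z) \<longlonglongrightarrow> D1 z * D2 z * \<phi>y z"
      using lim by eventually_elim (intro tendsto_intros)
  qed (simp_all add: kernel_outside[OF ker(2)])
  moreover have "(LINT z|lborel. D1 z * D2 z * \<phi>y z) = 0"
    using product_vanishes by (intro integral_eq_zero_AE) (auto elim: eventually_mono)
  moreover have "(\<lambda>n. LINT z|lborel. Py (k n) z * \<phi> z) \<longlonglongrightarrow> (LINT z|lborel. E z * \<phi> z)"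
  proof (rule locally_bounded_dominated[where R = R])
    show "locally_bounded (\<lambda>n z. Py (k n) z * \<phi> z)"
      unfolding Py_def
      by (intro locally_bounded_mult locally_bounded_add locally_bounded_D1n locally_bounded_D2n
        locally_bounded_kernel[OF ker(1)] locally_bounded_bounded[OF conv_bounded_borel[OF bounded(3)]]
        locally_bounded_bounded[OF conv_bounded_borel[OF bounded(5)]])
    show "AE z in lborel. (\<lambda>n. Py (k n) z * \<phi> z) \<longlonglongrightarrow> E z * \<phi> z"
      using lim unfolding Py_def E_def by eventually_elim (intro tendsto_intros)
  qed (simp_all add: kernel_outside[OF ker(1)] Py_def)
  ultimately have "(\<lambda>n. LINT z|lborel. Py (k n) z * \<phi> z) \<longlonglongrightarrow> 0"
    unfolding parts using tendsto_minus[of "\<lambda>n. - (LINT z|lborel. Py (k n) z * \<phi> z)" 0] by simp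
  with \<open>(\<lambda>n. LINT z|lborel. Py (k n) z * \<phi> z) \<longlonglongrightarrow> (LINT z|lborel. E z * \<phi> z)\<close>
  show ?thesis using LIMSEQ_unique by blast
qed

text \<open>\<open>E\<close> is only locally bounded, so it is localised by a cone function before
  being mollified. For \<open>t \<ge> 0\<close> that function is positive throughout its cone, which
  allows it to be divided out; for \<open>t < 0\<close> the velocity \<open>w\<close> is given
  explicitly.\<close>

lemma E_vanishes: "AE z in lborel. snd z \<ge> 0 \<longrightarrow> E z = 0"
proof -
  have S: "AE z in lborel. E z * cone_test (real S) 1 z = 0" for S
  proof -
    define R where "R = 2 * real S + 1 + 1"
    have outside: "norm z > R \<Longrightarrow> cone_test (real S) 1 z = 0" for z
      by (auto simp: R_def intro!: cone_test_outside)
    note ker = C1_kernels[OF C1_cone_test outside]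
    note [measurable] = kernel_measurable[OF ker(1)]
    have "locally_bounded (\<lambda>_::nat. \<lambda>z. E z * cone_test (real S) 1 z)"
      by (intro locally_bounded_mult E_locally_bounded locally_bounded_kernel[OF ker(1)])
    then obtain C where C: "\<And>z. norm z \<le> R \<Longrightarrow> \<bar>E z * cone_test (real S) 1 z\<bar> \<le> C"
      unfolding locally_bounded_def by metis
    have "\<bar>E z * cone_test (real S) 1 z\<bar> \<le> \<bar>C\<bar>" for z
      using C[of z] outside[of z] by (cases "norm z \<le> R") auto
    then have bb: "bounded_borel \<bar>C\<bar> (\<lambda>z. E z * cone_test (real S) 1 z)"
      unfolding bounded_borel_def by simp
    have zero: "conv (\<lambda>z. E z * cone_test (real S) 1 z) (mollifier n) z = 0" for n z
    proof -
      \<comment> \<open>The convolution at \<open>z\<close> is \<open>E\<close> tested with the cone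
        function times the reflected mollifier.\<close>
      have "C1 (mollifier n) (mollifier_y n) (mollifier_t n)"
        using mollifier_kernels[of n] mollifier_dir_deriv[of n] unfolding C1_def kernel_def by blast
      note C1_mult[OF C1_cone_test C1_reflect[OF this]]
      from integral_E_eq_0[OF this, of R S 1 z] outside
      show ?thesis by (simp add: conv_def mult.assoc)
    qed
    obtain k :: "nat \<Rightarrow> nat" where
      "AE z in lborel. \<forall>i\<in>{()}. (\<lambda>n. conv (\<lambda>z. E z * cone_test (real S) 1 z) (mollifier (k n)) z) \<longlonglongrightarrow> E z * cone_test (real S) 1 z"
      using conv_mollifier_AE_subseq[of "{()}" "\<bar>C\<bar>" "\<lambda>_ z. E z * cone_test (real S) 1 z"] bb by auto
    then show ?thesis by eventually_elim (simp add: zero LIMSEQ_const_iff)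
  qed
  have "AE z in lborel. \<forall>S. E z * cone_test (real S) 1 z = 0"
    unfolding AE_all_countable using S by blast
  then show ?thesis
  proof eventually_elim
    case (elim z)
    obtain S where "snd z + sqrt (1 + (fst z)\<^sup>2) < real S" using reals_Archimedean2 by blast
    then have "snd z \<ge> 0 \<Longrightarrow> cone_test (real S) 1 z > 0"
      by (simp add: cone_test_def sq_pos_def)
    with elim show ?case by (metis less_irrefl mult_eq_0_iff)
  qed
qed

text \<open>The slope of \<open>Y\<close> in \<open>y\<close> is the density, at least
  \<open>r0\<close>, so every time slice contains at most one zero off a null set, and Fubini makes
  the whole zero set null. Here the lower bound on the density enters the transport
  argument.\<close>

lemma Y_nonzero: "AE z in lborel. Y z \<noteq> 0"
proof -
  obtain k :: "nat \<Rightarrow> nat" where lim: "AE y in lborel. \<forall>t. (\<lambda>n. Yn (k n) (y, t)) \<longlonglongrightarrow> Y (y, t)"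
    by (rule approximation)
  obtain N where N: "{y. \<not> (\<forall>t. (\<lambda>n. Yn (k n) (y, t)) \<longlonglongrightarrow> Y (y, t))} \<subseteq> N" "N \<in> null_sets lborel"
    using lim by (auto simp: eventually_ae_filter)
  have r_ge: "conv r (mollifier n) z \<ge> r0" for n z
  proof -
    have "r0 = conv (\<lambda>_. r0) (mollifier n) z" by (rule conv_mollifier_const[symmetric]) simp
    also have "\<dots> \<le> conv r (mollifier n) z"
      unfolding conv_def
      by (intro integral_mono conv_integrable[OF bounded_borel_const mollifier_kernels(1)]
        conv_integrable[OF bounded(1) mollifier_kernels(1)] mult_right_mono r0 mollifier_nonneg)
    finally show ?thesis .
  qed
  have inc: "Yn n (y', t) - Yn n (y, t) \<ge> r0 * (y' - y)" if "y < y'" for n y y' t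
  proof -
    have "((\<lambda>y. Yn n (y, t)) has_real_derivative conv r (mollifier n) (x, t)) (at x)" for x
      using C1_Yn unfolding C1_def has_dir_deriv_fst by blast
    with MVT2[OF that, of "\<lambda>y. Yn n (y, t)" "\<lambda>x. conv r (mollifier n) (x, t)"]
    obtain x where "Yn n (y', t) - Yn n (y, t) = (y' - y) * conv r (mollifier n) (x, t)" by blast
    with r_ge[of n "(x, t)"] that show ?thesis by (simp add: mult.commute mult_left_mono)
  qed
  have inj: "Y (y, t) < Y (y', t)" if "y < y'" "y \<notin> N" "y' \<notin> N" for y y' t
  proof -
    have "(\<lambda>n. Yn (k n) (y', t) - Yn (k n) (y, t)) \<longlonglongrightarrow> Y (y', t) - Y (y, t)"
      using N(1) that by (intro tendsto_intros) auto
    then have "Y (y', t) - Y (y, t) \<ge> r0 * (y' - y)"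
      by (rule LIMSEQ_le_const) (use inc that in auto)
    moreover have "r0 * (y' - y) > 0" using r0 that by simp
    ultimately show ?thesis by linarith
  qed
  have "AE y in lborel. Y (y, t) \<noteq> 0" for t
  proof -
    \<comment> \<open>Strict monotonicity leaves at most one candidate; if there is none, any
      \<open>y0\<close> serves.\<close>
    obtain y0 where y0: "\<And>y. y \<notin> N \<Longrightarrow> Y (y, t) = 0 \<Longrightarrow> y = y0"
      using inj by (metis less_irrefl linorder_neqE)
    have "AE y in lborel. y \<noteq> y0" by (rule AE_lborel_singleton)
    with AE_not_in[OF N(2)] show ?thesis by eventually_elim (use y0 in blast)
  qed
  then have "AE t in lborel. AE y in lborel. Y (y, t) \<noteq> 0" by blast
  moreover have Ym: "{z \<in> space (lborel \<Otimes>\<^sub>M lborel). Y (fst z, snd z) \<noteq> 0} \<in> sets (lborel \<Otimes>\<^sub>M lborel)"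
    unfolding lborel_prod by simp measurable
  ultimately have "AE y in lborel. AE t in lborel. Y (y, t) \<noteq> 0"
    using lborel_pair.AE_commute[of "\<lambda>y t. Y (y, t) \<noteq> 0"] by simp
  with lborel_pair.AE_pair_iff[OF Ym] have "AE z in lborel \<Otimes>\<^sub>M lborel. Y (fst z, snd z) \<noteq> 0"
    by blast
  then show ?thesis unfolding lborel_prod prod.collapse .
qed

text \<open>Since \<open>D1 - D2 = (b - a) Y\<close> is nonzero almost everywhere, exactly one of
  the potentials vanishes. Then \<open>E = 0\<close> reduces to the vanishing of the density that
  belongs to this potential.\<close>

theorem velocity_two_valued: "AE z in lborel. w z = a \<or> w z = b"
  using product_vanishes E_vanishes Y_nonzero
proof eventually_elim
  case (elim z)
  show ?case
  proof (cases "snd z < 0")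
    case True
    then show ?thesis using past(3) by auto
  next
    case False
    with elim have E: "F1 z * D2 z + D1 z * F2 z = 0" by (simp add: E_def)
    have rp: "r z > 0" using r0(1) r0(2)[of z] by linarith
    consider "D1 z = 0" "D2 z \<noteq> 0" | "D2 z = 0" "D1 z \<noteq> 0"
      using elim(1,3) ab by (cases "D1 z = 0"; cases "D2 z = 0") (auto simp: D2_def)
    then show ?thesis
    proof cases
      case 1
      with E have "F1 z = 0" by simp
      then have "r z * (w z - a) = 0" by (simp add: F1_def algebra_simps)
      with rp show ?thesis by simp
    next
      case 2
      with E have "F2 z = 0" by simp
      then have "r z * (w z - b) = 0" by (simp add: F2_eq algebra_simps)
      with rp show ?thesis by simp
    qed
  qed
qed

text \<open>With \<open>u = 0\<close> the flux \<open>G1\<close> vanishes, so the mollified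
  \<open>F1\<close> does not depend on time and can be read off at time -3, where it is a step away
  from \<open>y = 0\<close>.\<close>

theorem velocity_of_rest_flow:
  assumes rest: "AE z in lborel. r z = \<rho> \<and> u z = 0"
  shows "AE z in lborel. w z = (if fst z < 0 then a else b)"
proof -
  have past_eq: "conv F1 (mollifier n) (y, t) = conv F1 (mollifier n) (y, - 3)" for n y t
  proof -
    have "conv G1 (mollifier_y n) (y, s) = 0" for s
      unfolding conv_def
      by (intro integral_eq_zero_AE) (use rest in \<open>auto simp: G1_eq elim: eventually_mono\<close>)
    with conservation_1 have "conv F1 (mollifier_t n) (y, s) = 0" for s
      by (metis add.right_neutral)
    moreover have "((\<lambda>s. conv F1 (mollifier n) (y, s)) has_real_derivative conv F1 (mollifier_t n) (y, s)) (at s)" for s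
      using C1_conv[OF bounded(3)] unfolding C1_def has_dir_deriv_snd by blast
    ultimately have "\<And>s. ((\<lambda>s. conv F1 (mollifier n) (y, s)) has_real_derivative 0) (at s)" by metis
    then show ?thesis using DERIV_isconst_all[of "\<lambda>s. conv F1 (mollifier n) (y, s)"] by blast
  qed
  obtain k :: "nat \<Rightarrow> nat" where k: "strict_mono k"
    and lim: "AE z in lborel. \<forall>f\<in>{F1}. (\<lambda>n. conv f (mollifier (k n)) z) \<longlonglongrightarrow> f z"
    using conv_mollifier_AE_subseq[of "{F1}" M "\<lambda>f. f"] bounded(3) by auto
  have "AE y in lborel. y \<noteq> (0::real)" by (rule AE_lborel_singleton)
  then have "AE z::real \<times> real in lborel. fst z \<noteq> 0"
    using AE_plane_from_fst[of "\<lambda>z. fst z \<noteq> 0"] by simp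
  with lim rest show ?thesis
  proof eventually_elim
    case (elim z)
    have "(\<lambda>n. 2 * inverse (real (Suc n))) \<longlonglongrightarrow> 2 * 0"
      by (intro tendsto_intros LIMSEQ_inverse_real_of_nat)
    then have "\<forall>\<^sub>F n in sequentially. 2 / real (Suc n) < \<bar>fst z\<bar>"
      using order_tendstoD(2)[of _ 0 sequentially "\<bar>fst z\<bar>"] elim by (simp add: divide_inverse)
    then have "\<forall>\<^sub>F n in sequentially. 2 / real (Suc (k n)) < \<bar>fst z\<bar>"
      using filterlim_subseq[OF k] unfolding filterlim_iff by blast
    then have "\<forall>\<^sub>F n in sequentially. conv F1 (mollifier (k n)) z = (if fst z < 0 then 0 else \<rho> * (b - a))"
      by eventually_elim (use F1_past_const past_eq in \<open>metis prod.collapse\<close>)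
    then have "(\<lambda>n. conv F1 (mollifier (k n)) z) \<longlonglongrightarrow> (if fst z < 0 then 0 else \<rho> * (b - a))"
      by (rule tendsto_eventually)
    with elim(1) have "F1 z = (if fst z < 0 then 0 else \<rho> * (b - a))"
      using LIMSEQ_unique by blast
    moreover have "\<rho> > 0" using r0(1) r0(2)[of z] elim(2) by simp
    moreover have "F1 z = \<rho> * (w z - a)" using elim(2) by (simp add: F1_def algebra_simps)
    ultimately show ?case by (auto split: if_splits)
  qed
qed

end

section \<open>Relative energy\<close>

text \<open>Bregman distance of the convex function \<open>r * \<epsilon> r\<close> at
  \<open>\<rho>\<close>; its slope there is \<open>\<epsilon> \<rho> + p \<rho> / \<rho>\<close>
  because \<open>p r = r^2 * \<epsilon>' r\<close>.\<close>

definition relative_energy :: "(real \<Rightarrow> real) \<Rightarrow> (real \<Rightarrow> real) \<Rightarrow> real \<Rightarrow> real \<Rightarrow> real" where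
  "relative_energy p \<epsilon> \<rho> r = r * \<epsilon> r - \<rho> * \<epsilon> \<rho> - (\<epsilon> \<rho> + p \<rho> / \<rho>) * (r - \<rho>)"

definition relative_enthalpy :: "(real \<Rightarrow> real) \<Rightarrow> (real \<Rightarrow> real) \<Rightarrow> real \<Rightarrow> real \<Rightarrow> real" where
  "relative_enthalpy p \<epsilon> \<rho> r = \<epsilon> r + p r / r - (\<epsilon> \<rho> + p \<rho> / \<rho>)"

context
  fixes p \<epsilon> :: "real \<Rightarrow> real" and \<rho> :: real
  assumes p: "pressure_law p" and \<epsilon>: "internal_energy p \<epsilon>" and \<rho>: "\<rho> > 0"
begin

lemma pressure_deriv: "r > 0 \<Longrightarrow> (p has_real_derivative deriv p r) (at r)" and pressure_deriv_pos: "r > 0 \<Longrightarrow> deriv p r > 0"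
  using p by (auto simp: pressure_law_def DERIV_deriv_iff_real_differentiable)

lemma energy_deriv: "r > 0 \<Longrightarrow> (\<epsilon> has_real_derivative p r / r\<^sup>2) (at r)"
  using \<epsilon> by (auto simp: internal_energy_def simp flip: DERIV_deriv_iff_real_differentiable)

lemma relative_energy_deriv:
  assumes "r > 0"
  shows "(relative_energy p \<epsilon> \<rho> has_real_derivative relative_enthalpy p \<epsilon> \<rho> r) (at r)"
proof -
  have "((\<lambda>r. r * \<epsilon> r - \<rho> * \<epsilon> \<rho> - (\<epsilon> \<rho> + p \<rho> / \<rho>) * (r - \<rho>)) has_real_derivative relative_enthalpy p \<epsilon> \<rho> r) (at r)"
    using assms
    by (auto intro!: derivative_eq_intros energy_deriv simp: relative_enthalpy_def power2_eq_square)
  then show ?thesis by (simp add: relative_energy_def[abs_def])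
qed

lemma relative_enthalpy_deriv:
  assumes "r > 0"
  shows "(relative_enthalpy p \<epsilon> \<rho> has_real_derivative deriv p r / r) (at r)"
proof -
  have "((\<lambda>r. \<epsilon> r + p r / r - (\<epsilon> \<rho> + p \<rho> / \<rho>)) has_real_derivative p r / r\<^sup>2 + (deriv p r * r - p r * 1) / (r * r)) (at r)"
    using assms by (auto intro!: derivative_eq_intros energy_deriv pressure_deriv)
  moreover have "p r / r\<^sup>2 + (deriv p r * r - p r * 1) / (r * r) = deriv p r / r"
    using assms by (simp add: power2_eq_square field_simps)
  ultimately show ?thesis by (simp add: relative_enthalpy_def[abs_def])
qed

lemma relative_enthalpy_strict_mono: "0 < r \<Longrightarrow> r < s \<Longrightarrow> relative_enthalpy p \<epsilon> \<rho> r < relative_enthalpy p \<epsilon> \<rho> s"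
  by (rule DERIV_pos_imp_increasing[where f = "relative_enthalpy p \<epsilon> \<rho>"])
    (auto intro!: exI relative_enthalpy_deriv pressure_deriv_pos divide_pos_pos)

lemma relative_enthalpy_self: "relative_enthalpy p \<epsilon> \<rho> \<rho> = 0"
  by (simp add: relative_enthalpy_def)

lemma relative_energy_self: "relative_energy p \<epsilon> \<rho> \<rho> = 0"
  by (simp add: relative_energy_def)

text \<open>By the mean value theorem from its derivative, the enthalpy, which is strictly
  increasing and zero at \<open>\<rho>\<close>.\<close>

lemma relative_energy_pos:
  assumes "r > 0" "r \<noteq> \<rho>"
  shows "relative_energy p \<epsilon> \<rho> r > 0"
proof (cases "r < \<rho>")
  case True
  have "\<exists>x. x > r \<and> x < \<rho> \<and> relative_energy p \<epsilon> \<rho> \<rho> - relative_energy p \<epsilon> \<rho> r = (\<rho> - r) * relative_enthalpy p \<epsilon> \<rho> x"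
    using True assms by (intro MVT2 relative_energy_deriv) auto
  then obtain x where x: "x > r" "x < \<rho>" "relative_energy p \<epsilon> \<rho> \<rho> - relative_energy p \<epsilon> \<rho> r = (\<rho> - r) * relative_enthalpy p \<epsilon> \<rho> x"
    by blast
  have "relative_enthalpy p \<epsilon> \<rho> x < 0"
    using relative_enthalpy_strict_mono[of x \<rho>] x assms by (simp add: relative_enthalpy_self)
  with True have "(\<rho> - r) * relative_enthalpy p \<epsilon> \<rho> x < 0" by (simp add: mult_pos_neg)
  with x(3) show ?thesis by (simp add: relative_energy_self)
next
  case False
  have "\<exists>x. x > \<rho> \<and> x < r \<and> relative_energy p \<epsilon> \<rho> r - relative_energy p \<epsilon> \<rho> \<rho> = (r - \<rho>) * relative_enthalpy p \<epsilon> \<rho> x"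
    using False assms \<rho> by (intro MVT2 relative_energy_deriv) auto
  then obtain x where x: "x > \<rho>" "x < r" "relative_energy p \<epsilon> \<rho> r - relative_energy p \<epsilon> \<rho> \<rho> = (r - \<rho>) * relative_enthalpy p \<epsilon> \<rho> x"
    by blast
  have "relative_enthalpy p \<epsilon> \<rho> x > 0"
    using relative_enthalpy_strict_mono[of \<rho> x] x \<rho> by (simp add: relative_enthalpy_self)
  with x(1,2) have "(r - \<rho>) * relative_enthalpy p \<epsilon> \<rho> x > 0" by simp
  with x(3) show ?thesis by (simp add: relative_energy_self)
qed

lemma relative_energy_nonneg: "r > 0 \<Longrightarrow> relative_energy p \<epsilon> \<rho> r \<ge> 0"
  using relative_energy_pos relative_energy_self by (cases "r = \<rho>") (auto intro: less_imp_le)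

lemma relative_energy_eq_0_iff: "r > 0 \<Longrightarrow> relative_energy p \<epsilon> \<rho> r = 0 \<longleftrightarrow> r = \<rho>"
  using relative_energy_pos relative_energy_self by (metis less_irrefl)

text \<open>As \<open>p\<close> is only differentiable, no continuous second derivative is at hand;
  but the difference quotient of the enthalpy at \<open>\<rho>\<close> has a positive limit, and
  integrating the resulting linear bound gives the quadratic one.\<close>

lemma relative_energy_locally_quadratic:
  obtains c d where "c > 0" "d > 0" "d < \<rho>"
    "\<And>r. \<bar>r - \<rho>\<bar> < d \<Longrightarrow> relative_energy p \<epsilon> \<rho> r \<ge> c * (r - \<rho>)\<^sup>2"
proof -
  define g where "g = relative_enthalpy p \<epsilon> \<rho>"
  \<comment> \<open>The slope of the enthalpy at \<open>\<rho>\<close> is \<open>4 * c\<close>; half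
    of it is given up in passing from the limit to a neighbourhood, and another half when
    \<open>2 c h\<close> is integrated to \<open>c h^2\<close>.\<close>
  define c where "c = deriv p \<rho> / \<rho> / 4"
  have c: "c > 0" using pressure_deriv_pos[OF \<rho>] \<rho> by (simp add: c_def)
  have "((\<lambda>h. (g (\<rho> + h) - g \<rho>) / h) \<longlongrightarrow> 4 * c) (at 0)"
    using relative_enthalpy_deriv[OF \<rho>] by (simp add: DERIV_def c_def g_def)
  then have "\<forall>\<^sub>F h in at 0. (g (\<rho> + h) - g \<rho>) / h > 2 * c"
    using c by (intro order_tendstoD(1)) auto
  then obtain e where e: "e > 0" "\<And>h. h \<noteq> 0 \<Longrightarrow> \<bar>h\<bar> < e \<Longrightarrow> g (\<rho> + h) / h > 2 * c"
    using relative_enthalpy_self by (auto simp: eventually_at dist_real_def g_def)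
  define d where "d = min e (\<rho> / 2)"
  have d: "d > 0" "d < \<rho>" "d \<le> e" using e(1) \<rho> by (auto simp: d_def)
  define f where "f r = relative_energy p \<epsilon> \<rho> r - c * (r - \<rho>)\<^sup>2" for r
  have f: "(f has_real_derivative g r - 2 * c * (r - \<rho>)) (at r)" if "r > 0" for r
    unfolding f_def[abs_def]
    using that by (auto intro!: derivative_eq_intros relative_energy_deriv simp: g_def)
  have up: "g r - 2 * c * (r - \<rho>) \<ge> 0" if "\<rho> \<le> r" "r < \<rho> + d" for r
    using that e(2)[of "r - \<rho>"] d relative_enthalpy_self
    by (cases "r = \<rho>") (auto simp: field_simps g_def)
  have down: "g r - 2 * c * (r - \<rho>) \<le> 0" if "r \<le> \<rho>" "r > \<rho> - d" for r
    using that e(2)[of "r - \<rho>"] d relative_enthalpy_self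
    by (cases "r = \<rho>") (auto simp: field_simps g_def)
  have "f r \<ge> 0" if r: "\<bar>r - \<rho>\<bar> < d" for r
  proof -
    have "f \<rho> \<le> f r"
    proof (cases "\<rho> \<le> r")
      case True
      show ?thesis
      proof (rule DERIV_nonneg_imp_nondecreasing[OF True])
        fix x assume "\<rho> \<le> x" "x \<le> r"
        then show "\<exists>y. (f has_real_derivative y) (at x) \<and> 0 \<le> y"
          using f[of x] up[of x] r \<rho> by (intro exI[of _ "g x - 2 * c * (x - \<rho>)"] conjI) (linarith | simp)+
      qed
    next
      case False
      show ?thesis
      proof (rule DERIV_nonpos_imp_nonincreasing[where f = f and a = r and b = \<rho>])
        show "r \<le> \<rho>" using False by simp
        fix x assume "r \<le> x" "x \<le> \<rho>"
        then show "\<exists>y. (f has_real_derivative y) (at x) \<and> y \<le> 0"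
          using f[of x] down[of x] r d by (intro exI[of _ "g x - 2 * c * (x - \<rho>)"] conjI) (linarith | simp)+
      qed
    qed
    then show ?thesis by (simp add: f_def relative_energy_self)
  qed
  with c d show thesis by (intro that[of c d]) (auto simp: f_def)
qed

lemma continuous_on_pressure: "A \<subseteq> {0<..} \<Longrightarrow> continuous_on A p"
  and continuous_on_energy: "A \<subseteq> {0<..} \<Longrightarrow> continuous_on A \<epsilon>"
  and continuous_on_relative_energy: "A \<subseteq> {0<..} \<Longrightarrow> continuous_on A (relative_energy p \<epsilon> \<rho>)"
  using pressure_deriv[THEN DERIV_isCont] energy_deriv[THEN DERIV_isCont] relative_energy_deriv[THEN DERIV_isCont]
  unfolding greaterThan_def subset_iff mem_Collect_eq
  by (simp_all add: continuous_at_imp_continuous_on)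

text \<open>Near \<open>\<rho>\<close> by the local estimate; on the compact remainder of the
  interval the energy has a positive minimum while \<open>(r - \<rho>)^2\<close> is bounded by
  \<open>T\<close>.\<close>

lemma relative_energy_quadratic:
  assumes "0 < r0"
  obtains c where "c > 0" "\<And>r. r \<in> {r0..R} \<Longrightarrow> relative_energy p \<epsilon> \<rho> r \<ge> c * (r - \<rho>)\<^sup>2"
proof -
  obtain c d where c: "c > 0" "d > 0" "\<And>r. \<bar>r - \<rho>\<bar> < d \<Longrightarrow> relative_energy p \<epsilon> \<rho> r \<ge> c * (r - \<rho>)\<^sup>2"
    using relative_energy_locally_quadratic by blast
  define S where "S = {r0..R} - {\<rho> - d<..<\<rho> + d}"
  have "compact S" unfolding S_def by (intro compact_diff) auto
  show thesis
  proof (cases "S = {}")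
    case True
    then have "\<bar>r - \<rho>\<bar> < d" if "r \<in> {r0..R}" for r
      using that by (auto simp: S_def abs_less_iff)
    with c show thesis by (intro that[of c]) auto
  next
    case False
    have "continuous_on S (relative_energy p \<epsilon> \<rho>)"
      using assms by (intro continuous_on_relative_energy) (auto simp: S_def)
    from continuous_attains_inf[OF \<open>compact S\<close> False this]
    obtain x where x: "x \<in> S" "\<And>r. r \<in> S \<Longrightarrow> relative_energy p \<epsilon> \<rho> x \<le> relative_energy p \<epsilon> \<rho> r" by blast
    define \<mu> where "\<mu> = relative_energy p \<epsilon> \<rho> x"
    have \<mu>: "\<mu> > 0"
      unfolding \<mu>_def using x(1) assms c(2) by (intro relative_energy_pos) (auto simp: S_def)
    define T where "T = (\<bar>R\<bar> + \<rho>)\<^sup>2"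
    have T: "T > 0" using \<rho> by (simp add: T_def add_nonneg_pos)
    show thesis
    proof (rule that[of "min c (\<mu> / T)"])
      show "min c (\<mu> / T) > 0" using c \<mu> T by simp
      fix r assume r: "r \<in> {r0..R}"
      show "relative_energy p \<epsilon> \<rho> r \<ge> min c (\<mu> / T) * (r - \<rho>)\<^sup>2"
      proof (cases "\<bar>r - \<rho>\<bar> < d")
        case True
        have "min c (\<mu> / T) * (r - \<rho>)\<^sup>2 \<le> c * (r - \<rho>)\<^sup>2" by (intro mult_right_mono) auto
        with c(3)[OF True] show ?thesis by linarith
      next
        case False
        then have "r \<in> S" using r by (auto simp: S_def abs_less_iff)
        have "(r - \<rho>)\<^sup>2 \<le> T"
          unfolding T_def using r assms \<rho> by (intro power2_le_iff_abs_le[THEN iffD2]) auto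
        then have "min c (\<mu> / T) * (r - \<rho>)\<^sup>2 \<le> \<mu> / T * T"
          using \<mu> T by (intro mult_mono) auto
        also have "\<dots> = \<mu>" using T by simp
        also have "\<dots> \<le> relative_energy p \<epsilon> \<rho> r" unfolding \<mu>_def by (rule x(2)[OF \<open>r \<in> S\<close>])
        finally show ?thesis .
      qed
    qed
  qed
qed

text \<open>The derivative of \<open>p\<close> may be unbounded on a compact interval, so a mean
  value estimate is out of reach. The difference quotient with fixed base point
  \<open>\<rho>\<close>, completed by the derivative, is continuous and therefore bounded.\<close>

lemma pressure_difference_bound:
  assumes "0 < r0"
  obtains L where "L \<ge> 0" "\<And>r. r \<in> {r0..R} \<Longrightarrow> \<bar>p r - p \<rho>\<bar> \<le> L * \<bar>r - \<rho>\<bar>"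
proof -
  define q where "q r = (if r = \<rho> then deriv p \<rho> else (p r - p \<rho>) / (r - \<rho>))" for r
  have "isCont q r" if "r > 0" for r
  proof (cases "r = \<rho>")
    case True
    have "((\<lambda>x. (p x - p \<rho>) / (x - \<rho>)) \<longlongrightarrow> deriv p \<rho>) (at \<rho>)"
      using pressure_deriv[OF \<rho>] by (simp add: has_field_derivative_iff)
    then have "(q \<longlongrightarrow> deriv p \<rho>) (at \<rho>)"
      by (rule Lim_transform_eventually) (auto simp: q_def eventually_at_filter)
    then show ?thesis using True by (simp add: isCont_def q_def)
  next
    case False
    have "isCont (\<lambda>r. (p r - p \<rho>) / (r - \<rho>)) r"
      using False DERIV_isCont[OF pressure_deriv[OF that]] by (intro continuous_intros) auto
    moreover have "\<forall>\<^sub>F x in nhds r. q x = (p x - p \<rho>) / (x - \<rho>)"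
      using t1_space_nhds[OF False] by eventually_elim (simp add: q_def)
    ultimately show ?thesis by (simp add: isCont_cong)
  qed
  then have "compact (q ` {r0..R})"
    using assms by (intro compact_continuous_image continuous_at_imp_continuous_on) auto
  then obtain L where L: "\<And>r. r \<in> {r0..R} \<Longrightarrow> \<bar>q r\<bar> \<le> L"
    by (force dest: compact_imp_bounded simp: bounded_iff)
  have "\<bar>p r - p \<rho>\<bar> \<le> \<bar>L\<bar> * \<bar>r - \<rho>\<bar>" if "r \<in> {r0..R}" for r
  proof (cases "r = \<rho>")
    case False
    have "\<bar>p r - p \<rho>\<bar> = \<bar>q r\<bar> * \<bar>r - \<rho>\<bar>" using False by (simp add: q_def abs_divide)
    also have "\<dots> \<le> \<bar>L\<bar> * \<bar>r - \<rho>\<bar>" using L[OF that] by (intro mult_right_mono) auto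
    finally show ?thesis .
  qed simp
  then show thesis by (intro that[of "\<bar>L\<bar>"]) auto
qed

text \<open>Young's inequality splits \<open>|u| * |r - \<rho>|\<close> into two squares, absorbed
  by the quadratic lower bound and by \<open>r \<ge> r0\<close>; these are the two summands of
  \<open>K\<close>. The pressure flux thereby obeys a finite speed for the relative energy.\<close>

lemma pressure_work_bound:
  assumes "0 < r0"
  obtains K where "\<And>r u. r \<in> {r0..R} \<Longrightarrow> \<bar>u * (p r - p \<rho>)\<bar> \<le> K * (relative_energy p \<epsilon> \<rho> r + r * u\<^sup>2 / 2)"
proof -
  obtain c where c: "c > 0" "\<And>r. r \<in> {r0..R} \<Longrightarrow> relative_energy p \<epsilon> \<rho> r \<ge> c * (r - \<rho>)\<^sup>2"
    using relative_energy_quadratic[OF assms] by blast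
  obtain L where L: "L \<ge> 0" "\<And>r. r \<in> {r0..R} \<Longrightarrow> \<bar>p r - p \<rho>\<bar> \<le> L * \<bar>r - \<rho>\<bar>"
    using pressure_difference_bound[OF assms] by blast
  define K where "K = L / (2 * c) + L / r0"
  have K: "K \<ge> L / (2 * c)" "K \<ge> L / r0" using c L assms by (auto simp: K_def)
  show thesis
  proof (rule that)
    fix r u assume r: "r \<in> {r0..R}"
    have "2 * (\<bar>u\<bar> * \<bar>r - \<rho>\<bar>) \<le> u\<^sup>2 + (r - \<rho>)\<^sup>2"
      using zero_le_power2[of "\<bar>u\<bar> - \<bar>r - \<rho>\<bar>"] by (simp add: power2_diff)
    then have am: "L * (\<bar>u\<bar> * \<bar>r - \<rho>\<bar>) \<le> L * ((u\<^sup>2 + (r - \<rho>)\<^sup>2) / 2)" using L(1) by (intro mult_left_mono) auto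
    have "\<bar>u * (p r - p \<rho>)\<bar> \<le> \<bar>u\<bar> * (L * \<bar>r - \<rho>\<bar>)"
      unfolding abs_mult using L(2)[OF r] by (intro mult_left_mono) auto
    also have "\<dots> \<le> L * ((u\<^sup>2 + (r - \<rho>)\<^sup>2) / 2)" using am by (simp add: mult_ac)
    also have "\<dots> = L / (2 * c) * (c * (r - \<rho>)\<^sup>2) + L / r0 * (r0 * u\<^sup>2 / 2)"
      using c(1) assms by (simp add: field_simps)
    also have "\<dots> \<le> K * relative_energy p \<epsilon> \<rho> r + K * (r * u\<^sup>2 / 2)"
    proof (intro add_mono mult_mono K)
      show "c * (r - \<rho>)\<^sup>2 \<le> relative_energy p \<epsilon> \<rho> r" by (rule c(2)[OF r])
      show "r0 * u\<^sup>2 / 2 \<le> r * u\<^sup>2 / 2" using r by (auto intro!: mult_right_mono divide_right_mono)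
      show "0 \<le> K" using K c L assms by (simp add: K_def)
      then show "0 \<le> K" .
    qed (use c assms in auto)
    finally show "\<bar>u * (p r - p \<rho>)\<bar> \<le> K * (relative_energy p \<epsilon> \<rho> r + r * u\<^sup>2 / 2)"
      by (simp add: distrib_left)
  qed
qed

end

section \<open>Rigidity of the flow\<close>

context contact_flow
begin

text \<open>The indefinite term of \<open>H\<close> vanishes almost everywhere because
  \<open>w\<close> takes only the values \<open>a\<close> and \<open>b\<close>; what remains is
  nonnegative, zero in the past, and has a flux of at most \<open>B + K\<close> times
  itself.\<close>

theorem rest_flow:
  fixes p \<epsilon> :: "real \<Rightarrow> real" and H Q :: "real \<times> real \<Rightarrow> real"
  assumes p: "pressure_law p" and \<epsilon>: "internal_energy p \<epsilon>"
    and H_def: "\<And>z. H z = relative_energy p \<epsilon> \<rho> (r z) + r z * (u z)\<^sup>2 / 2 + r z * (w z - a) * (w z - b) / 2"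
    and Q_def: "\<And>z. Q z = u z * H z + u z * (p (r z) - p \<rho>)"
    and H: "bounded_borel N H" and Q: "bounded_borel N Q"
    and entropy: "\<And>n z. mollified_div n H Q z \<le> 0"
  shows "AE z in lborel. r z = \<rho> \<and> u z = 0 \<and> w z = (if fst z < 0 then a else b)"
proof -
  have "r (0, - 1) = \<rho>" by (rule past(1)) simp
  then have \<rho>: "\<rho> > 0" using r0(1) r0(2)[of "(0, - 1)"] by linarith
  have rpos: "r z > 0" for z using r0(1) r0(2)[of z] by linarith
  have rR: "r z \<in> {r0..B}" for z
  proof -
    have "\<bar>r z\<bar> \<le> B" using bounds(1) unfolding bounded_borel_def by blast
    then show ?thesis using r0(2)[of z] by auto
  qed
  obtain K where K: "\<And>r u. r \<in> {r0..B} \<Longrightarrow> \<bar>u * (p r - p \<rho>)\<bar> \<le> K * (relative_energy p \<epsilon> \<rho> r + r * u\<^sup>2 / 2)"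
    using pressure_work_bound[OF p \<epsilon> \<rho> r0(1)] by blast
  have H_eq: "AE z in lborel. H z = relative_energy p \<epsilon> \<rho> (r z) + r z * (u z)\<^sup>2 / 2"
    using velocity_two_valued by eventually_elim (auto simp: H_def)
  have pos: "relative_energy p \<epsilon> \<rho> (r z) \<ge> 0" "r z * (u z)\<^sup>2 / 2 \<ge> 0" for z
    using relative_energy_nonneg[OF p \<epsilon> \<rho> rpos] rpos[of z] by auto
  have "AE z in lborel. H z = 0"
  proof (rule cone_vanishing[where q = Q and K = "B + K"])
    show "H \<in> borel_measurable borel" "Q \<in> borel_measurable borel"
      using H Q by (auto simp: bounded_borel_def)
    show "\<exists>C. \<forall>z. norm z \<le> R \<longrightarrow> \<bar>H z\<bar> \<le> C \<and> \<bar>Q z\<bar> \<le> C" for R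
      using H Q unfolding bounded_borel_def by blast
    show "AE z in lborel. H z \<ge> 0"
      using H_eq by eventually_elim (use pos in auto)
    show "AE z in lborel. \<bar>Q z\<bar> \<le> (B + K) * H z"
      using H_eq
    proof eventually_elim
      case (elim z)
      have "\<bar>u z\<bar> \<le> B" using bounds(2) unfolding bounded_borel_def by blast
      moreover have "H z \<ge> 0" unfolding elim using pos by (intro add_nonneg_nonneg)
      ultimately have "\<bar>u z * H z\<bar> \<le> B * H z" by (simp add: abs_mult mult_right_mono)
      moreover have "\<bar>u z * (p (r z) - p \<rho>)\<bar> \<le> K * H z" unfolding elim by (rule K[OF rR])
      ultimately show ?case unfolding Q_def distrib_right by linarith
    qed
    show "AE z in lborel. snd z < 0 \<longrightarrow> H z = 0"
      by (intro AE_I2) (simp add: H_def past relative_energy_self[OF p \<epsilon> \<rho>])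
  qed (rule weak_inequality_C1[OF H Q entropy])
  with H_eq have rest: "AE z in lborel. r z = \<rho> \<and> u z = 0"
  proof eventually_elim
    case (elim z)
    with pos[of z] have "relative_energy p \<epsilon> \<rho> (r z) = 0" "r z * (u z)\<^sup>2 / 2 = 0" by linarith+
    then show ?case
      using relative_energy_eq_0_iff[OF p \<epsilon> \<rho> rpos] rpos[of z] by simp
  qed
  with velocity_of_rest_flow[OF rest] show ?thesis by eventually_elim simp
qed

end

section \<open>Reduction to one space dimension\<close>

definition mk2 :: "real \<Rightarrow> real \<Rightarrow> real^2" where
  "mk2 a b = (\<chi> i. if i = 1 then a else b)"

lemma mk2_nth [simp]: "mk2 a b $ 1 = a" "mk2 a b $ 2 = b"
  by (simp_all add: mk2_def)

lemma continuous_on_mk2 [continuous_intros]: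
  "continuous_on A f \<Longrightarrow> continuous_on A g \<Longrightarrow> continuous_on A (\<lambda>x. mk2 (f x) (g x))"
  unfolding mk2_def
proof (rule continuous_on_vec_lambda)
  fix i :: 2
  assume "continuous_on A f" "continuous_on A g"
  then show "continuous_on A (\<lambda>x. if i = 1 then f x else g x)" by (cases "i = 1") auto
qed

lemma Basis_vec2: "(Basis :: (real^2) set) = {axis 1 1, axis 2 1}"
  by (auto simp: Basis_vec_def UNIV_2)

lemma axis_2_neq: "axis 1 (1::real) \<noteq> (axis 2 1 :: real^2)"
  by (simp add: axis_eq_axis)

text \<open>Lebesgue measure is determined by its values on boxes, and these are the same product of
  side lengths on both sides.\<close>

lemma distr_mk2: "distr lborel borel (\<lambda>z. mk2 (fst z) (snd z)) = lborel"
proof (rule lborel_eqI[symmetric])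
  have m: "(\<lambda>z. mk2 (fst z) (snd z)) \<in> borel_measurable borel"
    by (intro borel_measurable_continuous_onI continuous_intros)
  fix l u :: "real^2"
  assume le: "\<And>b. b \<in> Basis \<Longrightarrow> l \<bullet> b \<le> u \<bullet> b"
  have vi: "(\<lambda>z. mk2 (fst z) (snd z)) -` box l u = box (l $ 1, l $ 2) (u $ 1, u $ 2)"
    by (auto simp: box_def Basis_vec2 Basis_prod_def inner_axis)
  have le': "(l $ 1, l $ 2) \<bullet> b \<le> (u $ 1, u $ 2) \<bullet> b" if "b \<in> Basis" for b
    using that le[of "axis 1 1"] le[of "axis 2 1"] by (auto simp: Basis_vec2 Basis_prod_def inner_axis)
  have B: "(Basis :: (real \<times> real) set) = {(1, 0), (0, 1)}" by (auto simp: Basis_prod_def)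
  have "emeasure (distr lborel borel (\<lambda>z. mk2 (fst z) (snd z))) (box l u)
      = emeasure lborel (box (l $ 1, l $ 2) (u $ 1, u $ 2))"
    using m by (subst emeasure_distr) (auto simp: vi)
  also have "\<dots> = ennreal (\<Prod>b\<in>Basis. ((u $ 1, u $ 2) - (l $ 1, l $ 2)) \<bullet> b)"
    by (rule emeasure_lborel_box) (rule le')
  also have "\<dots> = ennreal (\<Prod>b\<in>Basis. (u - l) \<bullet> b)"
    unfolding B Basis_vec2 using axis_2_neq by (simp add: inner_axis)
  finally show "emeasure (distr lborel borel (\<lambda>z. mk2 (fst z) (snd z))) (box l u) = ennreal (\<Prod>b\<in>Basis. (u - l) \<bullet> b)" .
qed simp

text \<open>Coordinates moving with the contact discontinuity: the plane variable is
  \<open>(x\<^sub>2 - c t, t)\<close>, so that the discontinuity sits at \<open>y = 0\<close>.\<close>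

definition from_moving :: "real \<Rightarrow> real \<times> real \<times> real \<Rightarrow> spacetime" where
  "from_moving c p = (mk2 (fst p) (fst (snd p) + c * snd (snd p)), snd (snd p))"

definition moving :: "real \<Rightarrow> spacetime \<Rightarrow> real \<times> real" where
  "moving c z = (fst z $ 2 - c * snd z, snd z)"

lemma moving_from_moving [simp]:
  "moving c (from_moving c p) = snd p" "fst (from_moving c p) $ 1 = fst p" "snd (from_moving c p) = snd (snd p)"
  by (simp_all add: moving_def from_moving_def)

lemma from_moving_measurable [measurable]: "from_moving c \<in> borel_measurable borel"
  unfolding from_moving_def by (intro borel_measurable_continuous_onI continuous_intros)

lemma moving_measurable [measurable]: "moving c \<in> borel_measurable borel"
  unfolding moving_def by (intro borel_measurable_continuous_onI continuous_intros)

lemma nn_integral_shear: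
  assumes [measurable]: "f \<in> borel_measurable borel"
  shows "(\<integral>\<^sup>+q. f (fst q + c * snd q, snd q) \<partial>lborel) = (\<integral>\<^sup>+q. f q \<partial>(lborel :: (real \<times> real) measure))"
proof -
  have f [measurable]: "f \<in> borel_measurable (borel \<Otimes>\<^sub>M borel)" using assms by (simp add: borel_prod)
  have "(\<integral>\<^sup>+q. f (fst q + c * snd q, snd q) \<partial>(lborel \<Otimes>\<^sub>M lborel))
      = (\<integral>\<^sup>+t. (\<integral>\<^sup>+y. f (y + c * t, t) \<partial>lborel) \<partial>lborel)"
    by (subst lborel_pair.nn_integral_snd[symmetric]) simp_all
  also have "\<dots> = (\<integral>\<^sup>+t. (\<integral>\<^sup>+y. f (y, t) \<partial>lborel) \<partial>lborel)"
  proof (rule nn_integral_cong)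
    fix t
    show "(\<integral>\<^sup>+y. f (y + c * t, t) \<partial>lborel) = (\<integral>\<^sup>+y. f (y, t) \<partial>lborel)"
      using lborel_nn_integral_diff_right[of "\<lambda>y. f (y, t)" "- (c * t)"] by simp
  qed
  also have "\<dots> = (\<integral>\<^sup>+q. f q \<partial>(lborel \<Otimes>\<^sub>M lborel))"
    by (subst lborel_pair.nn_integral_snd[symmetric]) simp_all
  finally show ?thesis by (simp only: lborel_prod)
qed

lemma nn_integral_mk2:
  assumes [measurable]: "f \<in> borel_measurable borel"
  shows "(\<integral>\<^sup>+x1. (\<integral>\<^sup>+x2. f (mk2 x1 x2) \<partial>lborel) \<partial>lborel) = (\<integral>\<^sup>+x. f x \<partial>lborel)"
proof -
  have m [measurable]: "(\<lambda>z. mk2 (fst z) (snd z)) \<in> borel_measurable borel"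
    by (intro borel_measurable_continuous_onI continuous_intros)
  have "(\<integral>\<^sup>+x. f x \<partial>lborel) = (\<integral>\<^sup>+x. f x \<partial>distr lborel borel (\<lambda>z. mk2 (fst z) (snd z)))"
    by (simp only: distr_mk2)
  also have "\<dots> = (\<integral>\<^sup>+z. f (mk2 (fst z) (snd z)) \<partial>(lborel \<Otimes>\<^sub>M lborel))"
    by (subst nn_integral_distr) (simp_all add: lborel_prod)
  also have "\<dots> = (\<integral>\<^sup>+x1. (\<integral>\<^sup>+x2. f (mk2 x1 x2) \<partial>lborel) \<partial>lborel)"
  proof (subst lborel.nn_integral_fst[symmetric])
    show "(\<lambda>z. f (mk2 (fst z) (snd z))) \<in> borel_measurable (lborel \<Otimes>\<^sub>M lborel)"
      unfolding lborel_prod by measurable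
  qed simp
  finally show ?thesis by simp
qed

text \<open>A shear and a regrouping of coordinates preserve volume; both are handled by iterated
  integrals.\<close>

lemma distr_from_moving: "distr lborel borel (from_moving c) = lborel"
proof (rule measure_eqI)
  fix A assume "A \<in> sets (distr lborel borel (from_moving c))"
  then have [measurable]: "A \<in> sets borel" by simp
  define f :: "spacetime \<Rightarrow> ennreal" where "f = indicator A"
  have f [measurable]: "f \<in> borel_measurable borel" unfolding f_def by measurable
  have f' [measurable]: "f \<in> borel_measurable (borel \<Otimes>\<^sub>M borel)" using f by (simp add: borel_prod)
  have s1 [measurable]: "(\<lambda>q. f (mk2 x1 (fst q), snd q)) \<in> borel_measurable borel" for x1
    by (rule measurable_compose[OF _ f]) (intro borel_measurable_continuous_onI continuous_intros)
  have s2: "(\<lambda>p. f (from_moving c p)) \<in> borel_measurable (lborel \<Otimes>\<^sub>M lborel)"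
    unfolding lborel_prod by measurable
  have "emeasure (distr lborel borel (from_moving c)) A = (\<integral>\<^sup>+z. f z \<partial>distr lborel borel (from_moving c))"
    by (simp add: f_def)
  also have "\<dots> = (\<integral>\<^sup>+p. f (from_moving c p) \<partial>lborel)"
    by (subst nn_integral_distr) auto
  also have "\<dots> = (\<integral>\<^sup>+p. f (from_moving c p) \<partial>(lborel \<Otimes>\<^sub>M lborel))"
    by (simp only: lborel_prod)
  also have "\<dots> = (\<integral>\<^sup>+x1. (\<integral>\<^sup>+q. f (from_moving c (x1, q)) \<partial>lborel) \<partial>lborel)"
    by (rule lborel.nn_integral_fst[symmetric, OF s2])
  also have "\<dots> = (\<integral>\<^sup>+x1. (\<integral>\<^sup>+q. f (mk2 x1 (fst q), snd q) \<partial>lborel) \<partial>lborel)"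
  proof (rule nn_integral_cong)
    fix x1
    show "(\<integral>\<^sup>+q. f (from_moving c (x1, q)) \<partial>lborel) = (\<integral>\<^sup>+q. f (mk2 x1 (fst q), snd q) \<partial>lborel)"
      using nn_integral_shear[OF s1, of x1 c] by (simp add: from_moving_def)
  qed
  also have "\<dots> = (\<integral>\<^sup>+x1. (\<integral>\<^sup>+t. (\<integral>\<^sup>+x2. f (mk2 x1 x2, t) \<partial>lborel) \<partial>lborel) \<partial>lborel)"
  proof (rule nn_integral_cong)
    fix x1
    have "(\<lambda>q. f (mk2 x1 (fst q), snd q)) \<in> borel_measurable (lborel \<Otimes>\<^sub>M lborel)"
      unfolding lborel_prod using s1 by simp
    from lborel_pair.nn_integral_snd[OF this]
    show "(\<integral>\<^sup>+q. f (mk2 x1 (fst q), snd q) \<partial>lborel) = (\<integral>\<^sup>+t. (\<integral>\<^sup>+x2. f (mk2 x1 x2, t) \<partial>lborel) \<partial>lborel)"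
      by (simp add: lborel_prod)
  qed
  also have "\<dots> = (\<integral>\<^sup>+t. (\<integral>\<^sup>+x1. (\<integral>\<^sup>+x2. f (mk2 x1 x2, t) \<partial>lborel) \<partial>lborel) \<partial>lborel)"
  proof (rule lborel_pair.Fubini'[symmetric])
    have "(\<lambda>w. f (mk2 (fst (fst w)) (snd w), snd (fst w))) \<in> borel_measurable (borel :: ((real \<times> real) \<times> real) measure)"
      by (rule measurable_compose[OF _ f]) (intro borel_measurable_continuous_onI continuous_intros)
    then have [measurable]: "(\<lambda>w. f (mk2 (fst (fst w)) (snd w), snd (fst w))) \<in> borel_measurable ((lborel \<Otimes>\<^sub>M lborel) \<Otimes>\<^sub>M lborel)"
      by (simp add: lborel_prod)
    from lborel.borel_measurable_nn_integral_fst[OF this]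
    show "(\<lambda>(x1, t). \<integral>\<^sup>+x2. f (mk2 x1 x2, t) \<partial>lborel) \<in> borel_measurable (lborel \<Otimes>\<^sub>M lborel)"
      by (simp add: case_prod_beta')
  qed
  also have "\<dots> = (\<integral>\<^sup>+t. (\<integral>\<^sup>+x. f (x, t) \<partial>lborel) \<partial>lborel)"
    by (intro nn_integral_cong nn_integral_mk2) measurable
  also have "\<dots> = (\<integral>\<^sup>+z. f z \<partial>lborel)"
    using lborel_pair.nn_integral_snd[of f] by (simp add: lborel_prod)
  finally show "emeasure (distr lborel borel (from_moving c)) A = emeasure lborel A"
    by (simp add: f_def)
qed simp

lemma integral_from_moving:
  fixes f :: "spacetime \<Rightarrow> real"
  assumes "f \<in> borel_measurable borel"
  shows "(LINT z|lborel. f z) = (LINT p|lborel. f (from_moving c p))"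
proof -
  have "(LINT z|lborel. f z) = (LINT z|distr lborel borel (from_moving c). f z)"
    by (simp only: distr_from_moving)
  also have "\<dots> = (LINT p|lborel. f (from_moving c p))"
    using assms by (subst integral_distr) auto
  finally show ?thesis .
qed

lemma AE_from_moving:
  assumes "AE z in lborel. P z"
  shows "AE x1 in lborel. AE q in lborel. P (from_moving c (x1, q))"
proof -
  have "AE p in lborel. P (from_moving c p)"
  proof (rule AE_distrD[of "from_moving c" lborel borel P])
    show "from_moving c \<in> measurable lborel borel" by simp
    show "AE z in distr lborel borel (from_moving c). P z" unfolding distr_from_moving by (rule assms)
  qed
  then have "AE p in lborel \<Otimes>\<^sub>M lborel. P (from_moving c p)" unfolding lborel_prod .
  then show ?thesis by (rule lborel_pair.AE_pair)
qed

text \<open>In the coordinates of \<open>from_moving\<close> the exceptional set lies in the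
  cylinder \<open>UNIV \<times> N\<close> over a null set.\<close>

lemma AE_moving:
  assumes "AE q in lborel. P q"
  shows "AE z in lborel. P (moving c z)"
proof -
  obtain N where N: "{q. \<not> P q} \<subseteq> N" "N \<in> null_sets lborel"
    using assms by (auto simp: eventually_ae_filter)
  have Nb [measurable]: "N \<in> sets borel" using N(2) by (auto simp: null_sets_def)
  have "UNIV \<times> N \<in> null_sets (lborel \<Otimes>\<^sub>M lborel :: (real \<times> real \<times> real) measure)"
    using N(2) by (auto simp: null_sets_def lborel.emeasure_pair_measure_Times)
  then have "AE p::real\<times>real\<times>real in lborel. p \<notin> UNIV \<times> N"
    unfolding lborel_prod by (rule AE_not_in)
  then have "AE p in lborel. moving c (from_moving c p) \<notin> N"
    by eventually_elim auto
  moreover have "{z \<in> space borel. moving c z \<notin> N} \<in> sets borel" by measurable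
  ultimately have "AE z in distr lborel borel (from_moving c). moving c z \<notin> N"
    by (subst AE_distr_iff) auto
  then have "AE z in lborel. moving c z \<notin> N" by (simp only: distr_from_moving)
  then show ?thesis by eventually_elim (use N(1) in blast)
qed

section \<open>The half space of nonnegative times and Borel representatives\<close>

lemma spacetime_region_sets: "spacetime_region \<in> sets borel" "spacetime_region \<in> sets lebesgue"
proof -
  have "closed spacetime_region" unfolding spacetime_region_def by (intro closed_Times) auto
  then show "spacetime_region \<in> sets borel" by simp
  then show "spacetime_region \<in> sets lebesgue" by simp
qed

lemma mem_spacetime_region: "z \<in> spacetime_region \<longleftrightarrow> snd z \<ge> 0"
  by (cases z) (simp add: spacetime_region_def)

lemma AE_spacetime_measure:
  "(AE z in spacetime_measure. P z) \<longleftrightarrow> (AE z in lborel. snd z \<ge> 0 \<longrightarrow> P z)"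
  using spacetime_region_sets by (subst AE_restrict_space_iff) (auto simp: AE_completion_iff mem_spacetime_region)

text \<open>The profile supplied by \<open>depends_only_on_x2\<close> need not be measurable. A
  Borel representative \<open>g'\<close> agrees with it on almost every slice of constant first
  coordinate; freezing one good \<open>x1\<close> yields a Borel profile.\<close>

lemma moving_representative:
  fixes f :: "spacetime \<Rightarrow> real"
  assumes f: "f \<in> borel_measurable spacetime_measure" and dep: "depends_only_on_x2 f"
  obtains g where "g \<in> borel_measurable borel" "AE z in lborel. snd z \<ge> 0 \<longrightarrow> f z = g (moving c z)"
proof -
  have "(\<lambda>z. if z \<in> spacetime_region then f z else 0) \<in> borel_measurable lebesgue"
    using f spacetime_region_sets(2) by (simp add: borel_measurable_if)
  from completion_ex_borel_measurable_real[OF this]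
  obtain g' where [measurable]: "g' \<in> borel_measurable borel"
    and g': "AE z in lborel. (if z \<in> spacetime_region then f z else 0) = g' z" by auto
  obtain h where h: "AE z in spacetime_measure. f z = h (fst z $ 2) (snd z)"
    using dep by (auto simp: depends_only_on_x2_def case_prod_beta')
  then have h: "AE z in lborel. snd z \<ge> 0 \<longrightarrow> f z = h (fst z $ 2) (snd z)" by (simp add: AE_spacetime_measure)
  from g' h have "AE z in lborel. snd z \<ge> 0 \<longrightarrow> g' z = h (fst z $ 2) (snd z)"
    by eventually_elim (auto simp: mem_spacetime_region)
  from AE_from_moving[OF this]
  have "AE x1 in lborel. AE q in lborel. snd q \<ge> 0 \<longrightarrow> g' (from_moving c (x1, q)) = h (fst q + c * snd q) (snd q)"
    by (simp add: from_moving_def)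
  \<comment> \<open>A property that holds almost everywhere on the line holds somewhere, so a good
    \<open>x1\<close> can be chosen.\<close>
  moreover have "ae_filter (lborel :: real measure) \<noteq> bot" by (simp add: ae_filter_eq_bot_iff)
  ultimately obtain x1 where "AE q in lborel. snd q \<ge> 0 \<longrightarrow> g' (from_moving c (x1, q)) = h (fst q + c * snd q) (snd q)"
    using eventually_happens' by blast
  from AE_moving[OF this, of c]
  have "AE z in lborel. snd z \<ge> 0 \<longrightarrow> g' (from_moving c (x1, moving c z)) = h (fst z $ 2) (snd z)"
    by (simp add: moving_def)
  with h have "AE z in lborel. snd z \<ge> 0 \<longrightarrow> f z = g' (from_moving c (x1, moving c z))"
    by eventually_elim auto
  moreover have "(\<lambda>q. g' (from_moving c (x1, q))) \<in> borel_measurable borel"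
  proof -
    have "(\<lambda>q. from_moving c (x1, q)) \<in> borel_measurable borel"
      unfolding from_moving_def by (intro borel_measurable_continuous_onI continuous_intros)
    then show ?thesis by measurable
  qed
  ultimately show thesis by (rule that[rotated])
qed

text \<open>A bump in the first coordinate times the mollifier reflected about \<open>q\<close> in
  moving coordinates: testing a law with it evaluates the mollified divergence at
  \<open>q\<close>.\<close>

definition moving_test :: "nat \<Rightarrow> real \<Rightarrow> real \<times> real \<Rightarrow> spacetime \<Rightarrow> real" where
  "moving_test n c q z = mol n (fst z $ 1) * mollifier n (q - moving c z)"

lemma moving_test_nonneg: "moving_test n c q z \<ge> 0"
  by (simp add: moving_test_def mol_nonneg mollifier_nonneg)

lemma bounded_linear_coordinates:
  "bounded_linear (\<lambda>z::spacetime. fst z $ i)" "bounded_linear (\<lambda>z::spacetime. snd z)"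
  by (intro bounded_linear_compose[OF bounded_linear_vec_nth bounded_linear_fst] bounded_linear_snd)+

lemma moving_test_eq:
  "moving_test n c q z = mol n (0 + fst z $ 1) *\<^sub>R
     (mol n (fst q + (c * snd z - fst z $ 2)) *\<^sub>R mol n (snd q + - snd z))"
  by (simp add: moving_test_def mollifier_def moving_def algebra_simps)

lemma times_differentiable_moving_test: "times_differentiable k (moving_test n c q)"
  unfolding moving_test_eq[abs_def]
  by (intro times_differentiable_scaleR times_differentiable_mol_affine bounded_linear_coordinates
    bounded_linear_sub bounded_linear_minus bounded_linear_const_mult)

lemma moving_test_support: "bounded {z. moving_test n c q z \<noteq> 0}"
proof (rule boundedI)
  fix z assume "z \<in> {z. moving_test n c q z \<noteq> 0}"
  then have nz: "mol n (fst z $ 1) \<noteq> 0" "mol n (fst q - (fst z $ 2 - c * snd z)) \<noteq> 0" "mol n (snd q - snd z) \<noteq> 0"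
    by (auto simp: moving_test_def mollifier_def moving_def)
  have le: "\<bar>x\<bar> \<le> 1" if "mol n x \<noteq> 0" for x
  proof -
    have "\<not> \<bar>x\<bar> \<ge> 1 / real (Suc n)" using mol_outside that by blast
    with inverse_Suc_le_1[of n] show ?thesis by linarith
  qed
  have t: "\<bar>snd z\<bar> \<le> \<bar>snd q\<bar> + 1" using le[OF nz(3)] by linarith
  have "\<bar>c * snd z\<bar> \<le> \<bar>c\<bar> * (\<bar>snd q\<bar> + 1)" unfolding abs_mult using t by (intro mult_left_mono) auto
  then have x2: "\<bar>fst z $ 2\<bar> \<le> \<bar>fst q\<bar> + 1 + \<bar>c\<bar> * (\<bar>snd q\<bar> + 1)" using le[OF nz(2)] by linarith
  have "norm (fst z) \<le> \<bar>fst z $ 1\<bar> + \<bar>fst z $ 2\<bar>"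
    using norm_le_l1_cart[of "fst z"] by (simp add: sum_2)
  then show "norm z \<le> 1 + (\<bar>fst q\<bar> + 1 + \<bar>c\<bar> * (\<bar>snd q\<bar> + 1)) + (\<bar>snd q\<bar> + 1)"
    using norm_Pair_le[of "fst z" "snd z"] x2 t le[OF nz(1)] unfolding prod.collapse real_norm_def by linarith
qed

lemma test_function_moving_test:
  fixes e :: "'b::real_normed_vector"
  shows "test_function (\<lambda>z. moving_test n c q z *\<^sub>R e)"
  unfolding test_function_def
proof (intro conjI allI)
  show "times_differentiable k (\<lambda>z. moving_test n c q z *\<^sub>R e)" for k
    by (intro times_differentiable_scaleR times_differentiable_moving_test times_differentiable_const)
  have "bounded {z. moving_test n c q z *\<^sub>R e \<noteq> 0}"
    by (rule bounded_subset[OF moving_test_support[of n c q]]) auto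
  then show "compact (closure {z. moving_test n c q z *\<^sub>R e \<noteq> 0})" by (simp add: compact_closure)
qed

lemma test_function_moving_test_real: "test_function (moving_test n c q)"
  using test_function_moving_test[of n c q "1::real"] by simp

lemma moving_test_has_derivative:
  "(moving_test n c q has_derivative (\<lambda>h.
      fst h $ 1 * (mol' n (fst z $ 1) * mollifier n (q - moving c z))
      + (c * snd h - fst h $ 2) * (mol n (fst z $ 1) * mollifier_y n (q - moving c z))
      - snd h * (mol n (fst z $ 1) * mollifier_t n (q - moving c z)))) (at z)"
proof -
  have d: "((\<lambda>z. mol n (a + L z)) has_derivative (\<lambda>h. mol' n (a + L z) * L h)) (at z)"
    if "bounded_linear L" for L :: "spacetime \<Rightarrow> real" and a
  proof -
    have "((\<lambda>z. a + L z) has_derivative L) (at z)"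
      using bounded_linear_imp_has_derivative[OF that] by (auto intro!: derivative_eq_intros)
    from has_derivative_compose[OF this mol_has_derivative[unfolded has_field_derivative_def]]
    show ?thesis by simp
  qed
  have L: "bounded_linear (\<lambda>z::spacetime. c * snd z - fst z $ 2)" "bounded_linear (\<lambda>z::spacetime. - snd z)"
    by (intro bounded_linear_sub bounded_linear_minus bounded_linear_const_mult bounded_linear_coordinates)+
  show ?thesis
    unfolding moving_test_eq[abs_def]
    by (rule has_derivative_eq_rhs[OF has_derivative_scaleR[OF d[OF bounded_linear_coordinates(1)]
        has_derivative_scaleR[OF d[OF L(1)] d[OF L(2)]]]])
      (simp add: fun_eq_iff mollifier_def mollifier_y_def mollifier_t_def moving_def algebra_simps)
qed

lemma moving_test_derivatives:
  fixes e :: "'b::real_normed_vector"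
  shows "dt (\<lambda>z. moving_test n c q z *\<^sub>R e) z
      = (mol n (fst z $ 1) * (c * mollifier_y n (q - moving c z) - mollifier_t n (q - moving c z))) *\<^sub>R e"
    and "dx 1 (\<lambda>z. moving_test n c q z *\<^sub>R e) z = (mol' n (fst z $ 1) * mollifier n (q - moving c z)) *\<^sub>R e"
    and "dx 2 (\<lambda>z. moving_test n c q z *\<^sub>R e) z = (- (mol n (fst z $ 1) * mollifier_y n (q - moving c z))) *\<^sub>R e"
  unfolding dt_def dx_def
    frechet_derivative_at[OF has_derivative_scaleR_left[OF moving_test_has_derivative[of n c q z], of e], symmetric]
  by (simp_all add: axis_def algebra_simps)

lemma moving_test_derivatives_real:
  "dt (moving_test n c q) z
      = mol n (fst z $ 1) * (c * mollifier_y n (q - moving c z) - mollifier_t n (q - moving c z))"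
  "dx 1 (moving_test n c q) z = mol' n (fst z $ 1) * mollifier n (q - moving c z)"
  "dx 2 (moving_test n c q) z = - (mol n (fst z $ 1) * mollifier_y n (q - moving c z))"
  using moving_test_derivatives[of n c q "1::real" z] by simp_all

section \<open>Integrating out the first coordinate and the past\<close>

lemma mol_kernels: "kernel 1 (mol n)" "kernel 1 (mol' n)"
proof -
  have "mol n x = 0" "mol' n x = 0" if "norm x > 1" for x
    using that inverse_Suc_le_1[of n] unfolding real_norm_def by (intro mol_outside mol'_outside; linarith)+
  then show "kernel 1 (mol n)" "kernel 1 (mol' n)"
    by (auto simp: kernel_def continuous_on_mol continuous_on_mol')
qed

lemma integral_mol': "integrable lborel (mol' n)" "(LINT x|lborel. mol' n x) = 0"
proof -
  show "integrable lborel (mol' n)" by (rule kernel_integrable[OF mol_kernels(2)])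
  have "has_dir_deriv (mol n) (mol' n) 1"
    unfolding has_dir_deriv_def
  proof
    fix z
    show "((\<lambda>h. mol n (z + h *\<^sub>R 1)) has_real_derivative mol' n z) (at 0)"
      using mol_has_derivative[of n z] DERIV_shift[of "mol n" "mol' n z" 0 z] by (simp add: add.commute)
  qed
  from integral_dir_deriv_eq_0[OF mol_kernels this] show "(LINT x|lborel. mol' n x) = 0" .
qed

text \<open>Integration in the first coordinate turns \<open>mol\<close> into 1 and
  \<open>mol'\<close> into 0: the flux in the direction of invariance disappears.\<close>

lemma integral_spacetime_separated:
  fixes X :: "spacetime \<Rightarrow> real"
  assumes A: "integrable lborel A" and C: "integrable lborel C"
    and X: "AE z in lborel. snd z \<ge> 0 \<longrightarrow> X z = mol n (fst z $ 1) * A (moving c z) + mol' n (fst z $ 1) * C (moving c z)"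
  shows "(LINT z|spacetime_measure. X z) = (LINT q|lborel. indicator {0..} (snd q) * A q)"
proof -
  have [measurable]: "A \<in> borel_measurable borel" "C \<in> borel_measurable borel" using A C by auto
  have [measurable]: "(\<lambda>z::spacetime. fst z $ 1) \<in> borel_measurable borel" "(\<lambda>z::spacetime. snd z) \<in> borel_measurable borel"
    "(\<lambda>z::real\<times>real. snd z) \<in> borel_measurable borel"
    "mol n \<in> borel_measurable borel" "mol' n \<in> borel_measurable borel"
    by (intro borel_measurable_continuous_onI continuous_intros continuous_on_mol continuous_on_mol')+
  define Z where "Z z = indicator {0..} (snd z) *
    (mol n (fst z $ 1) * A (moving c z) + mol' n (fst z $ 1) * C (moving c z))" for z :: spacetime
  have Zm [measurable]: "Z \<in> borel_measurable borel"
    unfolding Z_def[abs_def] by measurable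
  \<comment> \<open>\<open>X\<close> is known only almost everywhere; its measurability is inherited
    from \<open>Z\<close> through the completion.\<close>
  have eq: "AE z in lebesgue. Z z = indicator spacetime_region z *\<^sub>R X z"
    unfolding AE_completion_iff using X
    by eventually_elim (auto simp: Z_def indicator_def mem_spacetime_region)
  have ZL: "Z \<in> borel_measurable lebesgue" using Zm by (intro measurable_completion) simp
  have "(LINT z|spacetime_measure. X z) = (LINT z|lebesgue. indicator spacetime_region z *\<^sub>R X z)"
    using spacetime_region_sets by (subst integral_restrict_space) auto
  also have "\<dots> = (LINT z|lebesgue. Z z)"
    using eq by (intro integral_cong_AE ZL borel_measurable_AE[OF ZL eq]) (auto elim: eventually_mono)
  also have "\<dots> = (LINT z|lborel. Z z)"
    using Zm by (intro integral_completion) simp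
  also have "\<dots> = (LINT p|lborel. Z (from_moving c p))"
    by (rule integral_from_moving[OF Zm])
  also have "\<dots> = (LINT p|lborel. mol n (fst p) * (indicator {0..} (snd (snd p)) * A (snd p))
      + mol' n (fst p) * (indicator {0..} (snd (snd p)) * C (snd p)))"
    by (intro Bochner_Integration.integral_cong) (auto simp: Z_def algebra_simps)
  also have "\<dots> = (LINT q|lborel. indicator {0..} (snd q) * A q)"
  proof -
    have i: "integrable lborel (\<lambda>q. indicator {0..} (snd q) * A q)" "integrable lborel (\<lambda>q. indicator {0..} (snd q) * C q)"
      by (rule Bochner_Integration.integrable_bound[OF A], measurable, simp add: indicator_def)
        (rule Bochner_Integration.integrable_bound[OF C], measurable, simp add: indicator_def)
    show ?thesis
      using product_integral[OF integrable_mol[of n] i(1)] product_integral[OF integral_mol'(1)[of n] i(2)]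
      by (simp add: integral_mol integral_mol'(2))
  qed
  finally show ?thesis .
qed

lemma integral_initial_data:
  assumes F0: "bounded_borel M F0"
  shows "(LINT x|lebesgue. F0 (x $ 2) * moving_test n c q (x, 0)) = mol n (snd q) * conv F0 (mol n) (fst q)"
proof -
  have [measurable]: "F0 \<in> borel_measurable borel" using F0 by (simp add: bounded_borel_def)
  have [measurable]: "mol n \<in> borel_measurable borel"
    by (intro borel_measurable_continuous_onI continuous_on_mol)
  have m [measurable]: "(\<lambda>z. mk2 (fst z) (snd z)) \<in> borel_measurable borel"
    by (intro borel_measurable_continuous_onI continuous_intros)
  define f where "f x = F0 (x $ 2) * (mol n (x $ 1) * (mol n (fst q - x $ 2) * mol n (snd q)))" for x :: "real^2"
  have [measurable]: "(\<lambda>x::real^2. x $ i) \<in> borel_measurable borel" for i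
    by (intro borel_measurable_continuous_onI continuous_intros)
  have fm [measurable]: "f \<in> borel_measurable borel" unfolding f_def[abs_def] by measurable
  have "(LINT x|lebesgue. F0 (x $ 2) * moving_test n c q (x, 0)) = (LINT x|lebesgue. f x)"
    by (simp add: f_def[abs_def] moving_test_def mollifier_def moving_def)
  also have "\<dots> = (LINT x|lborel. f x)" using fm by (intro integral_completion) simp
  also have "\<dots> = (LINT x|distr lborel borel (\<lambda>z. mk2 (fst z) (snd z)). f x)" by (simp only: distr_mk2)
  also have "\<dots> = (LINT z|lborel. mol n (fst z) * (F0 (snd z) * mol n (fst q - snd z) * mol n (snd q)))"
    by (subst integral_distr) (auto simp: f_def mult_ac)
  also have "\<dots> = mol n (snd q) * conv F0 (mol n) (fst q)"
    using product_integral(2)[OF integrable_mol[of n] integrable_mult_left[OF conv_integrable[OF F0 mol_kernels(1)]]]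
    by (simp add: integral_mol conv_def mult.commute)
  finally show ?thesis .
qed


text \<open>The value is the boundary term at \<open>t = 0\<close> of the fundamental theorem, which
  will match the initial data.\<close>

lemma integral_mol'_past:
  "integrable lborel (\<lambda>t. indicator {..<0} t * mol' n (s - t))"
  "(LINT t|lborel. indicator {..<0} t * mol' n (s - t)) = - mol n s"
proof -
  have [measurable]: "mol' n \<in> borel_measurable borel"
    by (intro borel_measurable_continuous_onI continuous_on_mol')
  have "integrable lborel (\<lambda>t. mol' n (s - t))"
    by (intro lborel_integrable_minus_left integral_mol'(1)) measurable
  then show "integrable lborel (\<lambda>t. indicator {..<0} t * mol' n (s - t))"
    by (rule Bochner_Integration.integrable_bound) (auto simp: indicator_def)
  \<comment> \<open>Far enough in the past: \<open>s - t \<ge> 2\<close> for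
    \<open>t \<le> a\<close>, beyond the support radius 1 of the mollifier.\<close>
  define a where "a = - (\<bar>s\<bar> + 2)"
  have out: "mol' n (s - t) = 0" "mol n (s - t) = 0" if "t \<le> a" for t
    using that kernel_outside[OF mol_kernels(2), of "s - t"] kernel_outside[OF mol_kernels(1), of "s - t"]
    by (auto simp: a_def)
  have "(LINT t|lborel. mol' n (s - t) * indicator {a..0} t) = - mol n (s - 0) - - mol n (s - a)"
  proof (rule integral_FTC_Icc_real)
    show "((\<lambda>t. - mol n (s - t)) has_real_derivative mol' n (s - t)) (at t)" for t
    proof -
      have "((\<lambda>t. s - t) has_real_derivative - 1) (at t)" by (auto intro!: derivative_eq_intros)
      from DERIV_minus[OF DERIV_chain2[OF mol_has_derivative this]] show ?thesis by simp
    qed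
    have "continuous_on UNIV (\<lambda>t. mol' n (s - t))"
      by (rule continuous_on_compose2[OF continuous_on_mol'[of UNIV]]) (auto intro!: continuous_intros)
    then show "isCont (\<lambda>t. mol' n (s - t)) t" for t by (simp add: continuous_on_eq_continuous_at)
  qed (simp add: a_def)
  also have "\<dots> = - mol n s" using out(2)[of a] by simp
  also have "(LINT t|lborel. mol' n (s - t) * indicator {a..0} t) = (LINT t|lborel. indicator {..<0} t * mol' n (s - t))"
  proof (rule integral_cong_AE)
    have "AE t in lborel. t \<noteq> (0::real)" by (rule AE_lborel_singleton)
    then show "AE t in lborel. mol' n (s - t) * indicator {a..0} t = indicator {..<0} t * mol' n (s - t)"
    proof eventually_elim
      case (elim t)
      then show ?case using out(1)[of t] by (cases "t \<le> a") (auto simp: indicator_def)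
    qed
  qed measurable
  finally show "(LINT t|lborel. indicator {..<0} t * mol' n (s - t)) = - mol n s" by simp
qed

text \<open>For \<open>t < 0\<close> the density is stationary and the flux constant, so the time
  integral collapses to its boundary term at \<open>t = 0\<close> and the flux term integrates to
  zero in \<open>y\<close>. The artificial past thus contributes exactly minus the initial
  integral.\<close>

lemma integral_past_extension:
  assumes F0: "bounded_borel M F0"
    and past: "\<And>s. snd s < 0 \<Longrightarrow> F s = F0 (fst s)" "\<And>s. snd s < 0 \<Longrightarrow> G s = g"
  shows "(LINT s|lborel. indicator {..<0} (snd s) * (F s * mollifier_t n (q - s) + G s * mollifier_y n (q - s)))
    = - mol n (snd q) * conv F0 (mol n) (fst q)"
proof -
  have [measurable]: "mol n \<in> borel_measurable borel" "mol' n \<in> borel_measurable borel"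
    by (intro borel_measurable_continuous_onI continuous_on_mol continuous_on_mol')+
  have i1: "integrable lborel (\<lambda>y. F0 y * mol n (fst q - y))"
    by (rule conv_integrable[OF F0 mol_kernels(1)])
  have i2: "integrable lborel (\<lambda>y. mol' n (fst q - y))"
    by (intro lborel_integrable_minus_left integral_mol'(1)) measurable
  have "integrable lborel (\<lambda>t. mol n (snd q - t))"
    by (intro lborel_integrable_minus_left integrable_mol) measurable
  then have i3: "integrable lborel (\<lambda>t. g * (indicator {..<0} t * mol n (snd q - t)))"
    by (intro integrable_mult_right Bochner_Integration.integrable_bound[OF \<open>integrable lborel (\<lambda>t. mol n (snd q - t))\<close>])
      (auto simp: indicator_def)
  have z: "(LINT y|lborel. mol' n (fst q - y)) = 0"
    using lborel_integral_minus_left[of "mol' n" "fst q"] integral_mol'(2) by simp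
  have "(LINT s|lborel. indicator {..<0} (snd s) * (F s * mollifier_t n (q - s) + G s * mollifier_y n (q - s)))
    = (LINT s|lborel. (F0 (fst s) * mol n (fst q - fst s)) * (indicator {..<0} (snd s) * mol' n (snd q - snd s))
      + mol' n (fst q - fst s) * (g * (indicator {..<0} (snd s) * mol n (snd q - snd s))))"
    by (intro Bochner_Integration.integral_cong)
      (auto simp: past mollifier_t_def mollifier_y_def indicator_def)
  also have "\<dots> = - mol n (snd q) * conv F0 (mol n) (fst q)"
    using product_integral[OF i1 integral_mol'_past(1)[of n "snd q"]] product_integral[OF i2 i3]
    by (simp add: z integral_mol'_past(2) conv_def)
  finally show ?thesis .
qed

text \<open>On the test function \<open>dt\<close> produces
  \<open>c * mollifier_y - mollifier_t\<close>, so the flux \<open>G + c * F\<close> at rest becomes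
  \<open>G\<close> relative to the discontinuity. The assumption on \<open>X\<close> lets each weak
  law supply its integrand in its own form; \<open>C\<close> is its flux in the first
  coordinate.\<close>

lemma moving_reduction:
  assumes F: "bounded_borel M F" and G: "bounded_borel N G" and C: "bounded_borel L C" and F0: "bounded_borel M0 F0"
    and past: "\<And>s. snd s < 0 \<Longrightarrow> F s = F0 (fst s)" "\<And>s. snd s < 0 \<Longrightarrow> G s = g"
    and X: "AE z in lborel. snd z \<ge> 0 \<longrightarrow> X z = F (moving c z) * dt (moving_test n c q) z
        + (G (moving c z) + c * F (moving c z)) * dx 2 (moving_test n c q) z + C (moving c z) * dx 1 (moving_test n c q) z"
    and I: "\<And>x. I x = F0 (x $ 2) * moving_test n c q (x, 0)"
  shows "(LINT z|spacetime_measure. X z) + (LINT x|lebesgue. I x)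
    = - mollified_div n F G q"
proof -
  define W where "W s = F s * mollifier_t n (q - s) + G s * mollifier_y n (q - s)" for s
  note i = conv_integrable[OF F mollifier_kernels(3), of n q] conv_integrable[OF G mollifier_kernels(2), of n q]
  have W: "integrable lborel W" unfolding W_def[abs_def] by (intro Bochner_Integration.integrable_add i)
  have [measurable]: "W \<in> borel_measurable borel" using W by auto
  have [measurable]: "(\<lambda>z::real\<times>real. snd z) \<in> borel_measurable borel"
    by (intro borel_measurable_continuous_onI continuous_intros)
  have "(LINT z|spacetime_measure. X z) = (LINT s|lborel. indicator {0..} (snd s) * - W s)"
  proof (rule integral_spacetime_separated[where n = n and C = "\<lambda>s. C s * mollifier n (q - s)"])
    show "integrable lborel (\<lambda>s. - W s)" using W by simp
    show "integrable lborel (\<lambda>s. C s * mollifier n (q - s))" by (rule conv_integrable[OF C mollifier_kernels(1)])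
    show "AE z in lborel. 0 \<le> snd z \<longrightarrow> X z = mol n (fst z $ 1) * - W (moving c z)
        + mol' n (fst z $ 1) * (C (moving c z) * mollifier n (q - moving c z))"
      using X by eventually_elim (auto simp: moving_test_derivatives_real W_def algebra_simps)
  qed
  also have "\<dots> = - (LINT s|lborel. indicator {0..} (snd s) * W s)" by simp
  finally have 1: "(LINT z|spacetime_measure. X z) = - (LINT s|lborel. indicator {0..} (snd s) * W s)" .
  have 2: "(LINT x|lebesgue. I x) = - (LINT s|lborel. indicator {..<0} (snd s) * W s)"
    using integral_past_extension[where F = F and G = G and g = g and n = n and q = q, OF F0 past]
    unfolding I integral_initial_data[OF F0] W_def by simp
  have ind: "integrable lborel (\<lambda>s. indicator S (snd s) * W s)" if [measurable]: "S \<in> sets borel" for S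
    by (rule Bochner_Integration.integrable_bound[OF W]) (measurable, simp add: indicator_def)
  have "(LINT s|lborel. indicator {0..} (snd s) * W s) + (LINT s|lborel. indicator {..<0} (snd s) * W s)
      = (LINT s|lborel. indicator {0..} (snd s) * W s + indicator {..<0} (snd s) * W s)"
    using ind by simp
  also have "\<dots> = (LINT s|lborel. W s)"
    by (intro Bochner_Integration.integral_cong) (auto simp: indicator_def)
  also have "\<dots> = mollified_div n F G q"
    unfolding W_def conv_def by (rule Bochner_Integration.integral_add[OF i])
  finally show ?thesis using 1 2 by simp
qed

text \<open>Hides the bound, so that boundedness of the many densities and fluxes follows from
  closure rules alone.\<close>

definition bdd_borel :: "('a::euclidean_space \<Rightarrow> real) \<Rightarrow> bool" where
  "bdd_borel F \<longleftrightarrow> (\<exists>M. bounded_borel M F)"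

lemma bdd_borelI: "bounded_borel M F \<Longrightarrow> bdd_borel F"
  by (auto simp: bdd_borel_def)

lemma bdd_borel_const: "bdd_borel (\<lambda>_. k)"
  by (rule bdd_borelI[OF bounded_borel_const])

lemma bdd_borel_mult: "bdd_borel F \<Longrightarrow> bdd_borel G \<Longrightarrow> bdd_borel (\<lambda>z. F z * G z)"
  unfolding bdd_borel_def using bounded_borel_mult by blast

lemma bdd_borel_diff: "bdd_borel F \<Longrightarrow> bdd_borel G \<Longrightarrow> bdd_borel (\<lambda>z. F z - G z)"
  unfolding bdd_borel_def using bounded_borel_diff by blast

lemma bdd_borel_add: "bdd_borel F \<Longrightarrow> bdd_borel G \<Longrightarrow> bdd_borel (\<lambda>z. F z + G z)"
  using bdd_borel_diff[of F "\<lambda>z. 0 - G z"] bdd_borel_diff[OF bdd_borel_const[of 0], of G] by simp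

lemma bdd_borel_divide: "bdd_borel F \<Longrightarrow> bdd_borel (\<lambda>z. F z / k)"
  using bdd_borel_mult[OF _ bdd_borel_const[of "inverse k"], of F] by (simp add: divide_inverse)

lemma bdd_borel_power2: "bdd_borel F \<Longrightarrow> bdd_borel (\<lambda>z. (F z)\<^sup>2)"
  unfolding power2_eq_square by (rule bdd_borel_mult)

lemmas bdd_borel_intros = bdd_borel_const bdd_borel_mult bdd_borel_diff bdd_borel_add bdd_borel_divide bdd_borel_power2

lemma bdd_borel_step: "bdd_borel (\<lambda>y::real. if y < 0 then k else l)"
proof -
  have "{y::real. y < 0} \<in> sets borel" by (intro borel_open open_Collect_less continuous_intros)
  then have "(\<lambda>y::real. if y < 0 then k else l) \<in> borel_measurable borel"
    by (intro measurable_If) simp_all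
  then have "bounded_borel (max \<bar>k\<bar> \<bar>l\<bar>) (\<lambda>y::real. if y < 0 then k else l)"
    by (auto simp: bounded_borel_def)
  then show ?thesis by (rule bdd_borelI)
qed

lemma bdd_borel_compose:
  fixes f :: "real \<Rightarrow> real"
  assumes f: "continuous_on {l..h} f" and r: "r \<in> borel_measurable borel" "\<And>z. r z \<in> {l..h}"
  shows "bdd_borel (\<lambda>z. f (r z))"
proof -
  have "bounded (f ` {l..h})" by (intro compact_imp_bounded compact_continuous_image f) simp
  then obtain M where M: "\<And>x. x \<in> {l..h} \<Longrightarrow> \<bar>f x\<bar> \<le> M" by (force simp: bounded_iff)
  have "f \<in> borel_measurable (restrict_space borel {l..h})"
    by (rule borel_measurable_continuous_on_restrict[OF f])
  moreover have "r \<in> measurable borel (restrict_space borel {l..h})"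
    by (rule measurable_restrict_space2) (use r in auto)
  ultimately have "(\<lambda>z. f (r z)) \<in> borel_measurable borel"
    by (rule measurable_compose[rotated])
  with M r(2) have "bounded_borel M (\<lambda>z. f (r z))" by (simp add: bounded_borel_def)
  then show ?thesis by (rule bdd_borelI)
qed

lemma bdd_borel_reduction:
  assumes "bdd_borel F" "bdd_borel G" "bdd_borel C" "bdd_borel init"
    and "\<And>s. snd s < 0 \<Longrightarrow> F s = init (fst s)" "\<And>s. snd s < 0 \<Longrightarrow> G s = g"
    and "AE z in lborel. snd z \<ge> 0 \<longrightarrow> X z = F (moving c z) * dt (moving_test n c q) z
        + (G (moving c z) + c * F (moving c z)) * dx 2 (moving_test n c q) z + C (moving c z) * dx 1 (moving_test n c q) z"
    and "\<And>x. I x = init (x $ 2) * moving_test n c q (x, 0)"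
  shows "(LINT z|spacetime_measure. X z) + (LINT x|lebesgue. I x)
    = - mollified_div n F G q"
  using assms(1-4) moving_reduction[where g = g, OF _ _ _ _ assms(5-8)] unfolding bdd_borel_def by blast

lemma conv_lincomb_bdd:
  "bdd_borel F \<Longrightarrow> bdd_borel G \<Longrightarrow> kernel R k \<Longrightarrow> conv (\<lambda>z. F z - c * G z) k z = conv F k z - c * conv G k z"
  unfolding bdd_borel_def using conv_lincomb by blast

lemma conv_const_mollifier_t: "conv (\<lambda>_. 1) (mollifier_t n) q = 0"
  using integral_dir_deriv_eq_0[OF mollifier_kernels(1,3) mollifier_dir_deriv(2)]
  by (simp add: conv_def lborel_integral_minus_left)

lemma moving_test_scaleR_derivatives:
  "dt (\<lambda>z. moving_test n c q z *\<^sub>R e) z = dt (moving_test n c q) z *\<^sub>R e"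
  "dx j (\<lambda>z. moving_test n c q z *\<^sub>R e) z = dx j (moving_test n c q) z *\<^sub>R e"
  using exhaust_2[of j] by (auto simp: moving_test_derivatives moving_test_derivatives_real)

lemma inner_vec2: "(x::real^2) \<bullet> y = x $ 1 * y $ 1 + x $ 2 * y $ 2"
  by (simp add: inner_vec_def sum_2)

lemma depends_only_on_x2_component: "depends_only_on_x2 v \<Longrightarrow> depends_only_on_x2 (\<lambda>z. v z $ i)"
  unfolding depends_only_on_x2_def
proof (elim exE)
  fix g assume g: "AE (x, t) in spacetime_measure. v (x, t) = g (x $ 2) t"
  show "\<exists>g. AE (x, t) in spacetime_measure. v (x, t) $ i = g (x $ 2) t"
    by (rule exI[of _ "\<lambda>y t. g y t $ i"]) (use g in eventually_elim, auto)
qed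

lemma essential_infimum_lower_bound:
  assumes "essential_infimum M f > 0"
  obtains e where "e > 0" "AE z in M. e \<le> f z"
proof -
  define S where "S = esssup M (\<lambda>z. - ereal (f z))"
  have "0 < - S" using assms by (simp add: essential_infimum_def S_def)
  then obtain e where e: "0 < ereal e" "ereal e < - S" using ereal_dense2 by blast
  have "AE z in M. - ereal (f z) \<le> S" unfolding S_def by (rule esssup_AE)
  then have "AE z in M. e \<le> f z"
  proof eventually_elim
    case (elim z)
    then have "- S \<le> ereal (f z)" using ereal_uminus_le_reorder by blast
    with e(2) have "ereal e < ereal (f z)" by (rule less_le_trans)
    then show ?case by simp
  qed
  with e(1) show thesis by (intro that) auto
qed

section \<open>From the Euler system to the contact flow\<close>

theorem theorem1p2:
  fixes p \<epsilon> :: "real \<Rightarrow> real"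
    and \<rho>m \<rho>p :: real
    and vm vp :: "real^2"
    and \<rho> :: "spacetime \<Rightarrow> real"
    and v :: "spacetime \<Rightarrow> real^2"
  assumes "pressure_law p"
    and "internal_energy p \<epsilon>"
    and "\<rho>m > 0" and "\<rho>p > 0"
    and "\<rho>p = \<rho>m"
    and "vp $ 2 = vm $ 2"
    and "vp $ 1 \<noteq> vm $ 1"
    and "bounded_admissible_weak_solution p \<epsilon> (riemann_data \<rho>m \<rho>p) (riemann_data vm vp) \<rho> v"
    and "essential_infimum spacetime_measure \<rho> > 0"
    and "depends_only_on_x2 \<rho>"
    and "depends_only_on_x2 v"
  shows "AE (x, t) in spacetime_measure.
           \<rho> (x, t) = \<rho>p \<and> \<rho> (x, t) = \<rho>m \<and>
           v (x, t) $ 2 = vp $ 2 \<and> v (x, t) $ 2 = vm $ 2 \<and>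
           (x $ 2 < vp $ 2 * t \<longrightarrow> v (x, t) $ 1 = vm $ 1) \<and>
           (x $ 2 > vp $ 2 * t \<longrightarrow> v (x, t) $ 1 = vp $ 1)"
proof -
  define a b c where "a = vm $ 1" and "b = vp $ 1" and "c = vm $ 2"
  note p = assms(1) and \<epsilon> = assms(2)
  have \<rho>p: "\<rho>p = \<rho>m" and ab: "a \<noteq> b" and vp2: "vp $ 2 = c" using assms by (auto simp: a_def b_def c_def)
  have sol: "essentially_bounded spacetime_measure \<rho>" "essentially_bounded spacetime_measure v"
    "weak_continuity_equation (riemann_data \<rho>m \<rho>p) \<rho> v"
    "weak_momentum_equation p (riemann_data \<rho>m \<rho>p) (riemann_data vm vp) \<rho> v"
    "entropy_inequality p \<epsilon> (riemann_data \<rho>m \<rho>p) (riemann_data vm vp) \<rho> v"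
    using assms(8) by (auto simp: bounded_admissible_weak_solution_def)
  obtain C\<rho> Cv where \<rho>_meas: "\<rho> \<in> borel_measurable spacetime_measure" and C\<rho>: "AE z in spacetime_measure. norm (\<rho> z) \<le> C\<rho>"
    and v_meas: "v \<in> borel_measurable spacetime_measure" and Cv: "AE z in spacetime_measure. norm (v z) \<le> Cv"
    using sol(1,2) by (auto simp: essentially_bounded_def)
  obtain e where e: "e > 0" "AE z in spacetime_measure. e \<le> \<rho> z"
    using essential_infimum_lower_bound[OF assms(9)] by blast
  have nth_meas: "(\<lambda>z. v z $ i) \<in> borel_measurable spacetime_measure" for i
    by (rule measurable_compose[OF v_meas]) (intro borel_measurable_continuous_onI continuous_intros)
  obtain gr where gr [measurable]: "gr \<in> borel_measurable borel" and gr_eq: "AE z in lborel. snd z \<ge> 0 \<longrightarrow> \<rho> z = gr (moving c z)"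
    using moving_representative[OF \<rho>_meas assms(10)] by blast
  obtain g1 where g1 [measurable]: "g1 \<in> borel_measurable borel" and g1_eq: "AE z in lborel. snd z \<ge> 0 \<longrightarrow> v z $ 1 = g1 (moving c z)"
    using moving_representative[OF nth_meas depends_only_on_x2_component[OF assms(11)]] by blast
  obtain g2 where g2 [measurable]: "g2 \<in> borel_measurable borel" and g2_eq: "AE z in lborel. snd z \<ge> 0 \<longrightarrow> v z $ 2 = g2 (moving c z)"
    using moving_representative[OF nth_meas depends_only_on_x2_component[OF assms(11)]] by blast

  \<comment> \<open>The minimum with \<open>\<rho>m\<close> keeps the lower bound valid for the
    constant extension to \<open>t < 0\<close>.\<close>
  define r0 where "r0 = min e \<rho>m"
  define B where "B = \<bar>C\<rho>\<bar> + \<rho>m + \<bar>Cv\<bar> + \<bar>c\<bar> + \<bar>a\<bar> + \<bar>b\<bar>"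
  have r0: "r0 > 0" "r0 \<le> \<rho>m" "r0 \<le> e" using e(1) assms(3) by (auto simp: r0_def)
  have B: "\<rho>m \<le> B" "C\<rho> \<le> B" "Cv + \<bar>c\<bar> \<le> B" "Cv \<le> B" "\<bar>a\<bar> \<le> B" "\<bar>b\<bar> \<le> B" "0 \<le> B"
    using assms(3) by (auto simp: B_def)
  define r where "r s = (if snd s < 0 then \<rho>m else max r0 (min B (gr s)))" for s :: "real \<times> real"
  define u where "u s = (if snd s < 0 then 0 else max (- B) (min B (g2 s - c)))" for s :: "real \<times> real"
  define w where "w s = (if snd s < 0 then (if fst s < 0 then a else b) else max (- B) (min B (g1 s)))" for s :: "real \<times> real"
  have [measurable]: "(\<lambda>z::real\<times>real. snd z) \<in> borel_measurable borel" "(\<lambda>z::real\<times>real. fst z) \<in> borel_measurable borel"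
    by (intro borel_measurable_continuous_onI continuous_intros)+
  have r_meas [measurable]: "r \<in> borel_measurable borel" and u_meas: "u \<in> borel_measurable borel" and w_meas: "w \<in> borel_measurable borel"
    unfolding r_def[abs_def] u_def[abs_def] w_def[abs_def] by measurable
  have r_range: "r s \<in> {r0..B}" for s using r0 B by (auto simp: r_def)
  have bounds: "bounded_borel B r" "bounded_borel B u" "bounded_borel B w"
    using r_meas u_meas w_meas r0 B unfolding bounded_borel_def by (auto simp: r_def u_def w_def abs_le_iff)
  note bdd = bdd_borelI[OF bounds(1)] bdd_borelI[OF bounds(2)] bdd_borelI[OF bounds(3)]
  have past: "r s = \<rho>m" "u s = 0" "w s = (if fst s < 0 then a else b)" if "snd s < 0" for s
    using that by (auto simp: r_def u_def w_def)
  have fields: "AE z in lborel. snd z \<ge> 0 \<longrightarrow>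
      \<rho> z = r (moving c z) \<and> v z $ 1 = w (moving c z) \<and> v z $ 2 = u (moving c z) + c"
    using gr_eq g1_eq g2_eq C\<rho>[unfolded AE_spacetime_measure] Cv[unfolded AE_spacetime_measure] e(2)[unfolded AE_spacetime_measure]
  proof eventually_elim
    case (elim z)
    show ?case
    proof
      assume t: "snd z \<ge> 0"
      have "\<bar>v z $ 1\<bar> \<le> Cv" "\<bar>v z $ 2\<bar> \<le> Cv"
        using component_le_norm_cart[of "v z"] elim t order_trans by blast+
      moreover have "snd (moving c z) = snd z" by (simp add: moving_def)
      ultimately show "\<rho> z = r (moving c z) \<and> v z $ 1 = w (moving c z) \<and> v z $ 2 = u (moving c z) + c"
        using elim t r0 B by (auto simp: r_def u_def w_def)
    qed
  qed
  have sub: "{r0..B} \<subseteq> {0<..}" using r0 by auto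
  have bdd_p: "bdd_borel (\<lambda>s. p (r s))"
    by (rule bdd_borel_compose[OF continuous_on_pressure[OF p \<epsilon> assms(3) sub] r_meas r_range])
  have bdd_\<epsilon>: "bdd_borel (\<lambda>s. \<epsilon> (r s))"
    by (rule bdd_borel_compose[OF continuous_on_energy[OF p \<epsilon> assms(3) sub] r_meas r_range])

  define m1 m2 en where "m1 s = r s * w s" and "m2 s = r s * (u s + c)"
    and "en s = r s * \<epsilon> (r s) + r s * ((w s)\<^sup>2 + (u s + c)\<^sup>2) / 2" for s
  \<comment> \<open>Fluxes in the second coordinate relative to the moving frame: the flux at rest
    minus \<open>c\<close> times the density, for mass, both momenta and energy.\<close>
  define h0 h1 h2 h3 where "h0 s = r s * u s" and "h1 s = r s * w s * u s" and "h2 s = r s * (u s + c) * u s + p (r s)"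
    and "h3 s = en s * u s + p (r s) * (u s + c)" for s
  note defs = m1_def m2_def en_def h0_def h1_def h2_def h3_def
  have bdd': "bdd_borel m1" "bdd_borel m2" "bdd_borel en" "bdd_borel h0" "bdd_borel h1" "bdd_borel h2" "bdd_borel h3"
    unfolding defs[abs_def] by (intro bdd_borel_intros bdd bdd_p bdd_\<epsilon>)+

  have mass_eq: "mollified_div n r h0 q = 0" for n q
  proof -
    have "(LINT z|spacetime_measure. \<rho> z * dt (moving_test n c q) z + (\<rho> z *\<^sub>R v z) \<bullet> grad_x (moving_test n c q) z)
        + (LINT x|lebesgue. riemann_data \<rho>m \<rho>p x * moving_test n c q (x, 0))
      = - mollified_div n r h0 q"
    proof (rule bdd_borel_reduction[where C = m1 and init = "\<lambda>_. \<rho>m" and g = 0])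
      show "AE z in lborel. snd z \<ge> 0 \<longrightarrow> \<rho> z * dt (moving_test n c q) z + (\<rho> z *\<^sub>R v z) \<bullet> grad_x (moving_test n c q) z
        = r (moving c z) * dt (moving_test n c q) z + (h0 (moving c z) + c * r (moving c z)) * dx 2 (moving_test n c q) z
          + m1 (moving c z) * dx 1 (moving_test n c q) z"
        using fields by eventually_elim (auto simp: inner_vec2 grad_x_def defs algebra_simps)
    qed (auto simp: bdd bdd' bdd_borel_const past defs riemann_data_def \<rho>p)
    with sol(3) show ?thesis
      unfolding weak_continuity_equation_def using test_function_moving_test_real[of n c q] by simp
  qed
  \<comment> \<open>Both components at once: \<open>k\<close> is the direction of the test vector,
    and \<open>C\<close> the flux in the first coordinate, which integrates to zero.\<close>
  have momentum: "mollified_div n F G q = 0"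
    if "bdd_borel F" "bdd_borel G" "bdd_borel C"
      and past: "\<And>s. snd s < 0 \<Longrightarrow> F s = \<rho>m * (if fst s < 0 then vm $ k else vp $ k)" "\<And>s. snd s < 0 \<Longrightarrow> G s = g"
      and AE: "AE z in lborel. snd z \<ge> 0 \<longrightarrow> F (moving c z) = \<rho> z * v z $ k
        \<and> G (moving c z) + c * F (moving c z) = \<rho> z * v z $ k * v z $ 2 + (if k = 2 then p (\<rho> z) else 0)
        \<and> C (moving c z) = \<rho> z * v z $ k * v z $ 1 + (if k = 1 then p (\<rho> z) else 0)"
    for F G C :: "real \<times> real \<Rightarrow> real" and g k n q
  proof -
    define \<phi> :: "spacetime \<Rightarrow> real^2" where "\<phi> = (\<lambda>z. moving_test n c q z *\<^sub>R axis k 1)"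
    have "(LINT z|spacetime_measure. (\<rho> z *\<^sub>R v z) \<bullet> dt \<phi> z
          + (\<Sum>i\<in>UNIV. \<Sum>j\<in>UNIV. \<rho> z * v z $ i * v z $ j * dx j \<phi> z $ i) + p (\<rho> z) * div_x \<phi> z)
        + (LINT x|lebesgue. (riemann_data \<rho>m \<rho>p x *\<^sub>R riemann_data vm vp x) \<bullet> \<phi> (x, 0))
      = - mollified_div n F G q"
    proof (rule bdd_borel_reduction[where C = C and init = "\<lambda>y. \<rho>m * (if y < 0 then vm $ k else vp $ k)" and g = g])
      have k: "k = 1 \<or> k = 2" by (rule exhaust_2)
      show "AE z in lborel. snd z \<ge> 0 \<longrightarrow> (\<rho> z *\<^sub>R v z) \<bullet> dt \<phi> z
          + (\<Sum>i\<in>UNIV. \<Sum>j\<in>UNIV. \<rho> z * v z $ i * v z $ j * dx j \<phi> z $ i) + p (\<rho> z) * div_x \<phi> z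
        = F (moving c z) * dt (moving_test n c q) z + (G (moving c z) + c * F (moving c z)) * dx 2 (moving_test n c q) z
          + C (moving c z) * dx 1 (moving_test n c q) z"
        using AE
      proof eventually_elim
        case (elim z)
        show ?case
        proof
          assume "snd z \<ge> 0"
          with elim have f: "F (moving c z) = \<rho> z * v z $ k"
            "G (moving c z) + c * F (moving c z) = \<rho> z * v z $ k * v z $ 2 + (if k = 2 then p (\<rho> z) else 0)"
            "C (moving c z) = \<rho> z * v z $ k * v z $ 1 + (if k = 1 then p (\<rho> z) else 0)" by auto
          show "(\<rho> z *\<^sub>R v z) \<bullet> dt \<phi> z
              + (\<Sum>i\<in>UNIV. \<Sum>j\<in>UNIV. \<rho> z * v z $ i * v z $ j * dx j \<phi> z $ i) + p (\<rho> z) * div_x \<phi> z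
            = F (moving c z) * dt (moving_test n c q) z + (G (moving c z) + c * F (moving c z)) * dx 2 (moving_test n c q) z
              + C (moving c z) * dx 1 (moving_test n c q) z"
            unfolding f(2) unfolding f(1,3) using k
            by (auto simp: \<phi>_def moving_test_scaleR_derivatives inner_vec2 div_x_def sum_2 axis_def algebra_simps)
        qed
      qed
      show "(riemann_data \<rho>m \<rho>p x *\<^sub>R riemann_data vm vp x) \<bullet> \<phi> (x, 0)
          = \<rho>m * (if x $ 2 < 0 then vm $ k else vp $ k) * moving_test n c q (x, 0)" for x
        by (simp add: \<phi>_def riemann_data_def \<rho>p inner_axis)
    qed (use that in \<open>auto intro!: bdd_borel_mult bdd_borel_const bdd_borel_step\<close>)
    moreover have "test_function \<phi>" unfolding \<phi>_def by (rule test_function_moving_test)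
    note sol(4)[unfolded weak_momentum_equation_def, rule_format, OF this]
    ultimately show ?thesis by linarith
  qed
  have momentum_1: "mollified_div n m1 h1 q = 0" for n q
  proof (rule momentum[where k = 1 and g = 0 and C = "\<lambda>s. r s * w s * w s + p (r s)"])
    show "AE z in lborel. snd z \<ge> 0 \<longrightarrow> m1 (moving c z) = \<rho> z * v z $ 1
        \<and> h1 (moving c z) + c * m1 (moving c z) = \<rho> z * v z $ 1 * v z $ 2 + (if (1::2) = 2 then p (\<rho> z) else 0)
        \<and> r (moving c z) * w (moving c z) * w (moving c z) + p (r (moving c z))
          = \<rho> z * v z $ 1 * v z $ 1 + (if (1::2) = 1 then p (\<rho> z) else 0)"
      using fields by eventually_elim (auto simp: defs algebra_simps)
  qed (auto simp: past defs a_def b_def intro!: bdd' bdd bdd_p bdd_borel_intros)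
  have momentum_2: "mollified_div n m2 h2 q = 0" for n q
  \<comment> \<open>In this component the pressure survives in the flux of the past, hence the
    constant \<open>p \<rho>m\<close>.\<close>
  proof (rule momentum[where k = 2 and g = "p \<rho>m" and C = "\<lambda>s. r s * (u s + c) * w s"])
    show "AE z in lborel. snd z \<ge> 0 \<longrightarrow> m2 (moving c z) = \<rho> z * v z $ 2
        \<and> h2 (moving c z) + c * m2 (moving c z) = \<rho> z * v z $ 2 * v z $ 2 + (if (2::2) = 2 then p (\<rho> z) else 0)
        \<and> r (moving c z) * (u (moving c z) + c) * w (moving c z)
          = \<rho> z * v z $ 2 * v z $ 1 + (if (2::2) = 1 then p (\<rho> z) else 0)"
      using fields by eventually_elim (auto simp: defs algebra_simps)
  qed (auto simp: past defs c_def vp2[unfolded c_def] intro!: bdd' bdd bdd_p bdd_borel_intros)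
  \<comment> \<open>The left side of the entropy inequality equals minus the mollified divergence,
    whence the sign.\<close>
  have energy: "mollified_div n en h3 q \<le> 0" for n q
  proof -
    define E0 where "E0 y = energy_density \<epsilon> \<rho>m (if y < 0 then vm else vp)" for y :: real
    have norm2: "(norm x)\<^sup>2 = (x $ 1)\<^sup>2 + (x $ 2)\<^sup>2" for x :: "real^2"
      using power2_norm_eq_inner[of x] by (simp add: inner_vec2 power2_eq_square)
    have "(LINT z|spacetime_measure. energy_density \<epsilon> (\<rho> z) (v z) * dt (moving_test n c q) z
          + ((energy_density \<epsilon> (\<rho> z) (v z) + p (\<rho> z)) *\<^sub>R v z) \<bullet> grad_x (moving_test n c q) z)
        + (LINT x|lebesgue. energy_density \<epsilon> (riemann_data \<rho>m \<rho>p x) (riemann_data vm vp x) * moving_test n c q (x, 0))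
      = - mollified_div n en h3 q"
    proof (rule bdd_borel_reduction[where C = "\<lambda>s. (en s + p (r s)) * w s" and init = E0 and g = "p \<rho>m * c"])
      show "AE z in lborel. snd z \<ge> 0 \<longrightarrow> energy_density \<epsilon> (\<rho> z) (v z) * dt (moving_test n c q) z
          + ((energy_density \<epsilon> (\<rho> z) (v z) + p (\<rho> z)) *\<^sub>R v z) \<bullet> grad_x (moving_test n c q) z
        = en (moving c z) * dt (moving_test n c q) z + (h3 (moving c z) + c * en (moving c z)) * dx 2 (moving_test n c q) z
          + (en (moving c z) + p (r (moving c z))) * w (moving c z) * dx 1 (moving_test n c q) z"
        using fields
      proof eventually_elim
        case (elim z)
        show ?case
        proof
          assume "snd z \<ge> 0"
          with elim have f: "\<rho> z = r (moving c z)" "v z $ 1 = w (moving c z)" "v z $ 2 = u (moving c z) + c" by auto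
          have "energy_density \<epsilon> (\<rho> z) (v z) = en (moving c z)"
            by (simp add: energy_density_def norm2 f en_def)
          then show "energy_density \<epsilon> (\<rho> z) (v z) * dt (moving_test n c q) z
            + ((energy_density \<epsilon> (\<rho> z) (v z) + p (\<rho> z)) *\<^sub>R v z) \<bullet> grad_x (moving_test n c q) z
            = en (moving c z) * dt (moving_test n c q) z + (h3 (moving c z) + c * en (moving c z)) * dx 2 (moving_test n c q) z
            + (en (moving c z) + p (r (moving c z))) * w (moving c z) * dx 1 (moving_test n c q) z"
            by (simp add: inner_vec2 grad_x_def f h3_def algebra_simps)
        qed
      qed
      show "bdd_borel E0"
        unfolding E0_def[abs_def] if_distrib[of "energy_density \<epsilon> \<rho>m"] by (rule bdd_borel_step)
      show "en s = E0 (fst s)" if "snd s < 0" for s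
        using that by (simp add: E0_def en_def past energy_density_def norm2 a_def b_def c_def assms(6))
      show "h3 s = p \<rho>m * c" if "snd s < 0" for s
        using that by (simp add: h3_def past)
      show "energy_density \<epsilon> (riemann_data \<rho>m \<rho>p x) (riemann_data vm vp x) * moving_test n c q (x, 0)
          = E0 (x $ 2) * moving_test n c q (x, 0)" for x
        by (simp add: E0_def riemann_data_def \<rho>p)
    qed (intro bdd' bdd bdd_p bdd_borel_intros)+
    with sol(5) show ?thesis
      unfolding entropy_inequality_def using test_function_moving_test_real[of n c q] moving_test_nonneg[of n c q]
      by fastforce
  qed

  interpret contact_flow r u w \<rho>m r0 B a b
  proof
    show "mollified_div n r (\<lambda>z. r z * u z) q = 0" for n q
      using mass_eq[of n q] by (simp add: h0_def[abs_def])
    show "mollified_div n (\<lambda>z. r z * w z) (\<lambda>z. r z * w z * u z) q = 0" for n q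
      using momentum_1[of n q] by (simp add: m1_def[abs_def] h1_def[abs_def])
  qed (use bounds r0 r_range past ab in auto)

  define H where "H s = relative_energy p \<epsilon> \<rho>m (r s) + r s * (u s)\<^sup>2 / 2 + r s * (w s - a) * (w s - b) / 2" for s
  define Q where "Q s = u s * H s + u s * (p (r s) - p \<rho>m)" for s
  \<comment> \<open>The mass coefficient: it completes the quadratic terms in \<open>u + c\<close>
    and \<open>w\<close> to \<open>u^2\<close> and \<open>(w - a) * (w - b)\<close>, and supplies
    the slope of the tangent to \<open>r * \<epsilon> r\<close> at \<open>\<rho>m\<close>.\<close>
  define l where "l = \<epsilon> \<rho>m + p \<rho>m / \<rho>m - c\<^sup>2 / 2 - a * b / 2"
  \<comment> \<open>Up to a constant, \<open>H\<close> is the energy minus a combination of conserved quantities; on the initial data it vanishes.\<close>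
  have H_eq: "H = (\<lambda>s. (((en s - c * m2 s) - (a + b) / 2 * m1 s) - l * r s) - (- p \<rho>m) * 1)"
    using assms(3) by (auto simp: fun_eq_iff H_def relative_energy_def l_def defs power2_eq_square field_simps)
  \<comment> \<open>The same combination of fluxes: the additive constant of \<open>H\<close>
    contributes \<open>u * p \<rho>m\<close> to \<open>u * H\<close>, and the
    \<open>- p \<rho>m\<close> in \<open>Q\<close> cancels it.\<close>
  have Q_eq: "Q = (\<lambda>s. ((h3 s - c * h2 s) - (a + b) / 2 * h1 s) - l * h0 s)"
  proof
    fix s
    have "Q s = u s * ((((en s - c * m2 s) - (a + b) / 2 * m1 s) - l * r s) - (- p \<rho>m) * 1) + u s * (p (r s) - p \<rho>m)"
      unfolding Q_def H_eq ..
    also have "\<dots> = ((h3 s - c * h2 s) - (a + b) / 2 * h1 s) - l * h0 s"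
      by (simp add: h3_def h2_def h1_def h0_def m1_def m2_def algebra_simps)
    finally show "Q s = ((h3 s - c * h2 s) - (a + b) / 2 * h1 s) - l * h0 s" .
  qed
  have entropy: "mollified_div n H Q q \<le> 0" for n q
  proof -
    \<comment> \<open>The additive constant of \<open>H\<close> disappears under the time
      derivative, so only mass, momentum and energy terms remain.\<close>
    have "conv H (mollifier_t n) q = conv en (mollifier_t n) q - c * conv m2 (mollifier_t n) q
        - (a + b) / 2 * conv m1 (mollifier_t n) q - l * conv r (mollifier_t n) q"
      unfolding H_eq
      by (subst conv_lincomb_bdd[OF _ _ mollifier_kernels(3)]; (intro bdd_borel_intros bdd' bdd)?)+
        (simp add: conv_const_mollifier_t)
    moreover have "conv Q (mollifier_y n) q = conv h3 (mollifier_y n) q - c * conv h2 (mollifier_y n) q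
        - (a + b) / 2 * conv h1 (mollifier_y n) q - l * conv h0 (mollifier_y n) q"
      unfolding Q_eq
      by (subst conv_lincomb_bdd[OF _ _ mollifier_kernels(2)]; (intro bdd_borel_intros bdd' bdd)?)+ simp
    ultimately have "mollified_div n H Q q
        = mollified_div n en h3 q
          - c * mollified_div n m2 h2 q
          - (a + b) / 2 * mollified_div n m1 h1 q
          - l * mollified_div n r h0 q"
      by (simp add: algebra_simps)
    then show ?thesis using energy[of n q] by (simp add: momentum_1 momentum_2 mass_eq)
  qed
  have "bdd_borel H" "bdd_borel Q"
    unfolding H_eq Q_eq by (intro bdd_borel_intros bdd' bdd)+
  then obtain N N' where "bounded_borel N H" "bounded_borel N' Q" unfolding bdd_borel_def by blast
  then have N: "bounded_borel (max N N') H" "bounded_borel (max N N') Q"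
    by (auto elim: bounded_borel_mono)
  have "AE s in lborel. r s = \<rho>m \<and> u s = 0 \<and> w s = (if fst s < 0 then a else b)"
    by (rule rest_flow[OF p \<epsilon> H_def Q_def N entropy])
  from AE_moving[OF this, of c] fields
  have "AE z in lborel. snd z \<ge> 0 \<longrightarrow> \<rho> z = \<rho>m \<and> v z $ 2 = c \<and> v z $ 1 = (if fst z $ 2 < c * snd z then a else b)"
    by eventually_elim (auto simp: moving_def)
  then have "AE z in spacetime_measure. \<rho> z = \<rho>m \<and> v z $ 2 = c \<and> v z $ 1 = (if fst z $ 2 < c * snd z then a else b)"
    unfolding AE_spacetime_measure .
  then show ?thesis
    by eventually_elim (auto simp: \<rho>p vp2 a_def b_def c_def assms(6))
qed

end
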